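(* Let $M$ be a closed oriented $2$-dimensional smooth manifold, let $f\colon M\to\mathbf{R}^3$ be a smooth ($C^\infty$) immersion, and let $n\colon M\to\mathbf{S}^2$ be the Gauss map induced by $f$. For $u\in\mathbf{S}^2$ let $S_u:=\{p\in M : \langle n(p),u\rangle>0\}$. Then $f$ is a convex embedding if and only if, for every $u\in\mathbf{S}^2$, $S_u$ is simply connected.
   Context: $\mathbf{S}^2$ is the unit sphere in $\mathbf{R}^3$ and $\langle\cdot,\cdot\rangle$ is the standard inner product. Closed means compact without boundary. The Gauss map induced by $f$ is a smooth unit normal vector field along $f$, i.e. a smooth map $n\colon M\to\mathbf{S}^2$ with $n(p)$ orthogonal to $f_*(T_pM)$ for all $p$; it exists since $M$ is oriented. $S_u$ is called the shadow in the direction $u$. The immersion $f$ is a convex embedding if $f$ maps $M$ homeomorphically onto the boundary of a convex body (a compact convex subset of $\mathbf{R}^3$ with nonempty interior). Simply connected includes connected. *)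

theory Defs
  imports "HOL-Analysis.Analysis"
begin

text \<open>\<open>C\<^sup>k\<close> and \<open>C\<^sup>\<infinity>\<close> maps on an \<^emph>\<open>open\<close> set \<open>S\<close>, by iterated partial derivatives.  As \<open>S\<close> is open,
  the values of \<open>f\<close> outside \<open>S\<close> do not matter.\<close>

primrec Ck_on :: "nat \<Rightarrow> ('a::euclidean_space \<Rightarrow> 'b::euclidean_space) \<Rightarrow> 'a set \<Rightarrow> bool" where
  "Ck_on 0 f S \<longleftrightarrow> continuous_on S f"
| "Ck_on (Suc k) f S \<longleftrightarrow>
     (\<forall>x\<in>S. f differentiable (at x)) \<and>
     (\<forall>i\<in>Basis. Ck_on k (\<lambda>x. frechet_derivative f (at x) i) S)"

definition smooth_on :: "('a::euclidean_space \<Rightarrow> 'b::euclidean_space) \<Rightarrow> 'a set \<Rightarrow> bool" where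
  "smooth_on f S \<longleftrightarrow> (\<forall>k. Ck_on k f S)"

text \<open>A chart is a pair \<open>(U, \<phi>)\<close>; only the values of \<open>\<phi>\<close> on \<open>U\<close> matter.  A manifold is a set \<open>M\<close>
  with the subspace topology, together with an atlas.  It is Hausdorff and second countable by
  the sort of the ambient type, and without boundary because charts map onto open subsets of
  \<open>\<real>\<^sup>n\<close>.\<close>

type_synonym ('a, 'n) chart = "'a set \<times> ('a \<Rightarrow> real ^ 'n)"

definition transition :: "('a, 'n::finite) chart \<Rightarrow> ('a, 'n) chart \<Rightarrow> real ^ 'n \<Rightarrow> real ^ 'n" where
  "transition c d = snd d \<circ> inv_into (fst c) (snd c)"

definition smooth_atlas ::
    "'a::{t2_space,second_countable_topology} set \<Rightarrow> ('a, 'n::finite) chart set \<Rightarrow> bool" where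
  "smooth_atlas M A \<longleftrightarrow>
     (\<Union>(U, \<phi>)\<in>A. U) = M \<and>
     (\<forall>(U, \<phi>)\<in>A. openin (top_of_set M) U \<and> open (\<phi> ` U) \<and>
        homeomorphism U (\<phi> ` U) \<phi> (inv_into U \<phi>)) \<and>
     (\<forall>c\<in>A. \<forall>d\<in>A. smooth_on (transition c d) (snd c ` (fst c \<inter> fst d)))"

text \<open>An orientation is given by an atlas whose transition maps have positive Jacobian.\<close>

definition oriented_atlas :: "('a, 'n::finite) chart set \<Rightarrow> bool" where
  "oriented_atlas A \<longleftrightarrow>
     (\<forall>c\<in>A. \<forall>d\<in>A. \<forall>x \<in> snd c ` (fst c \<inter> fst d).
        det (matrix (frechet_derivative (transition c d) (at x))) > 0)"

definition smooth_map :: "('a, 'n::finite) chart set \<Rightarrow> ('a \<Rightarrow> 'b::euclidean_space) \<Rightarrow> bool" where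
  "smooth_map A f \<longleftrightarrow> (\<forall>(U, \<phi>)\<in>A. smooth_on (f \<circ> inv_into U \<phi>) (\<phi> ` U))"

text \<open>The differential \<open>f\<^sub>*\<close> at \<open>p\<close>, with the tangent space at \<open>p\<close> identified with \<open>\<real>\<^sup>n\<close> by a chart.\<close>

definition differential ::
    "('a, 'n::finite) chart \<Rightarrow> ('a \<Rightarrow> 'b::euclidean_space) \<Rightarrow> 'a \<Rightarrow> real ^ 'n \<Rightarrow> 'b" where
  "differential c f p = frechet_derivative (f \<circ> inv_into (fst c) (snd c)) (at (snd c p))"

definition smooth_immersion ::
    "('a, 'n::finite) chart set \<Rightarrow> ('a \<Rightarrow> 'b::euclidean_space) \<Rightarrow> bool" where
  "smooth_immersion A f \<longleftrightarrow>
     smooth_map A f \<and> (\<forall>c\<in>A. \<forall>p \<in> fst c. inj (differential c f p))"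

text \<open>A smooth map into the unit sphere is one that is smooth as a map into \<open>\<real>\<^sup>3\<close>.  Any smooth unit
  normal field is allowed, so the sign is not tied to the orientation.\<close>

definition gauss_map ::
    "'a set \<Rightarrow> ('a, 2) chart set \<Rightarrow> ('a \<Rightarrow> real ^ 3) \<Rightarrow> ('a \<Rightarrow> real ^ 3) \<Rightarrow> bool" where
  "gauss_map M A f n \<longleftrightarrow>
     smooth_map A n \<and> n ` M \<subseteq> sphere 0 1 \<and>
     (\<forall>c\<in>A. \<forall>p \<in> fst c. \<forall>v. n p \<bullet> differential c f p v = 0)"

definition shadow :: "'a set \<Rightarrow> ('a \<Rightarrow> real ^ 3) \<Rightarrow> real ^ 3 \<Rightarrow> 'a set" where
  "shadow M n u = {p \<in> M. n p \<bullet> u > 0}"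

definition convex_body :: "'b::euclidean_space set \<Rightarrow> bool" where
  "convex_body K \<longleftrightarrow> compact K \<and> convex K \<and> interior K \<noteq> {}"

definition convex_embedding ::
    "'a::topological_space set \<Rightarrow> ('a \<Rightarrow> 'b::euclidean_space) \<Rightarrow> bool" where
  "convex_embedding M f \<longleftrightarrow> (\<exists>K g. convex_body K \<and> homeomorphism M (frontier K) f g)"

end

(* If n p = u or -u at three points p1, p2, p3 and n is a local diffeomorphism at p1 and p2, then not all
   shadows S_v with v orthogonal to u are simply connected.  Indeed, up to homotopy there is a unique path in S_v from
   a point near p1 to a point near p2, both displaced in direction v.  When v turns once, it comes back to itself, so
   the small loops around p1 and p2 have the same winding with respect to any continuous map
   h : M - {p1, p3} -> C - {0}.  But h can be chosen to wind once around p1, and it does not wind around p2.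

   By Sard's theorem n is a local diffeomorphism at all critical points of the height function <f, u> for almost every
   u, so such a height function has only its maximum and its minimum as critical points.  Hence n has rank less
   than two wherever f(M) has points strictly on both sides of the tangent plane.  A maximum principle on this flat part
   shows that it is empty.  So every tangent plane supports f(M), which puts f(M) on the boundary of its convex hull;
   f is open into this boundary, and injective again by the statement on three points.

   Conversely, the shadow of a convex surface is a retract of a convex cylinder. *)

theory Submission
  imports Defs "HOL-Complex_Analysis.Complex_Analysis"
begin

section \<open>Winding numbers along paths in simply connected sets\<close>

text \<open>The genus of \<open>M\<close> is not known in advance, so \<open>h\<close> cannot be
  given by a formula on all of \<open>M\<close>. Nor can only \<open>p1\<close> be removed: on a
  sphere a loop around \<open>p1\<close> is contractible in the complement of \<open>p1\<close>. The
  second removed point \<open>p3\<close> takes up the winding, and it has to be a zero of the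
  projected normal so that no half-surface meets it. This is where the number three comes from. In
  the maximum principle, the product of the two heights depends only on the tangent plane. Along a
  ruling of a flat surface the tangent plane is constant, so a maximum of the product alone is no
  contradiction. The added multiple of the squared norm of \<open>F\<close> is strictly convex along
  a ruling. Rulings are never constructed: identities between derivatives at a single point replace
  them, which leaves the planar points, where all of d\<nu> vanishes, as a separate case. Neither
  the connectedness of \<open>M\<close> nor an outward choice of \<open>n\<close> is given. Both
  have to be obtained on the way.\<close>

lemma winding_number_mult:
  assumes "path p" "path q" "0 \<notin> path_image p" "0 \<notin> path_image q"
  shows "winding_number (\<lambda>t. p t * q t) 0 = winding_number p 0 + winding_number q 0"
proof -
  obtain a where a: "path a" "pathfinish a - pathstart a = 2 * of_real pi * \<i> * winding_number p 0"
    "\<And>t. t \<in> {0..1} \<Longrightarrow> p t = 0 + exp (a t)"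
    using winding_number_as_continuous_log[OF assms(1,3)] by blast
  obtain b where b: "path b" "pathfinish b - pathstart b = 2 * of_real pi * \<i> * winding_number q 0"
    "\<And>t. t \<in> {0..1} \<Longrightarrow> q t = 0 + exp (b t)"
    using winding_number_as_continuous_log[OF assms(2,4)] by blast
  have "winding_number (\<lambda>t. p t * q t) 0 = winding_number (exp \<circ> (\<lambda>t. a t + b t)) 0"
    by (rule winding_number_cong) (use a b in \<open>auto simp: exp_add\<close>)
  also have "\<dots> = ((a 1 + b 1) - (a 0 + b 0)) / (2 * of_real pi * \<i>)"
    using winding_number_compose_exp[of "\<lambda>t. a t + b t"] a(1) b(1)
    by (simp add: path_def continuous_on_add pathfinish_def pathstart_def)
  also have "\<dots> = ((a 1 - a 0) + (b 1 - b 0)) / (2 * of_real pi * \<i>)" by (simp add: algebra_simps)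
  also have "\<dots> = winding_number p 0 + winding_number q 0"
    using a(2) b(2) by (simp add: pathfinish_def pathstart_def add_divide_distrib)
  finally show ?thesis .
qed

lemma winding_number_nullhomotopic_loop:
  fixes h :: "'a::topological_space \<Rightarrow> complex"
  assumes "homotopic_loops S g (\<lambda>t. a)" "continuous_on S h" "\<And>x. x \<in> S \<Longrightarrow> h x \<noteq> 0"
  shows "winding_number (h \<circ> g) 0 = 0"
proof -
  have *: "homotopic_loops (-{0}) (h \<circ> g) (h \<circ> (\<lambda>t. a))"
    by (rule homotopic_loops_continuous_image[OF assms(1)]) (use assms in auto)
  have "winding_number (h \<circ> g) 0 = winding_number (\<lambda>t. h a) 0"
    using winding_number_homotopic_loops[OF *] by (simp add: o_def)
  moreover have "h a \<noteq> 0"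
    using homotopic_loops_imp_subset[OF *] by (auto simp: path_image_def)
  ultimately show ?thesis by (simp add: winding_number_zero_const)
qed

lemma winding_number_simply_connected_loop:
  fixes h :: "'a::topological_space \<Rightarrow> complex"
  assumes S: "simply_connected S" "continuous_on S h" "\<And>x. x \<in> S \<Longrightarrow> h x \<noteq> 0"
    and l: "path l" "pathfinish l = pathstart l" "path_image l \<subseteq> S"
  shows "winding_number (h \<circ> l) 0 = 0"
proof (rule winding_number_nullhomotopic_loop)
  show "homotopic_loops S l (\<lambda>t. pathstart l)"
    using S(1)[unfolded simply_connected_def, rule_format, of l "\<lambda>t. pathstart l"]
      l pathstart_in_path_image[of l]
    by (auto simp: path_image_def pathfinish_def pathstart_def path_def image_subset_iff)
qed (use S in auto)

text \<open>The paths need not be closed, so these winding numbers are complex numbers rather than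
  integers. The loop \<open>p +++ reversepath q\<close> is null-homotopic, hence the winding of
  \<open>h\<close> along a path in a half-surface depends on its end points only.\<close>

lemma winding_number_simply_connected_unique:
  fixes h :: "'a::topological_space \<Rightarrow> complex"
  assumes "simply_connected S" "continuous_on S h" "\<And>x. x \<in> S \<Longrightarrow> h x \<noteq> 0"
    and p: "path p" "path_image p \<subseteq> S" and q: "path q" "path_image q \<subseteq> S"
    and eq: "pathstart p = pathstart q" "pathfinish p = pathfinish q"
  shows "winding_number (h \<circ> p) 0 = winding_number (h \<circ> q) 0"
proof -
  define l where "l = p +++ reversepath q"
  have l: "path l" "pathfinish l = pathstart l" "path_image l \<subseteq> S"
    using p q eq by (auto simp: l_def path_image_join)
  have "winding_number (h \<circ> l) 0 = 0"
    using assms l by (intro winding_number_simply_connected_loop)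
  moreover have "h \<circ> l = (h \<circ> p) +++ reversepath (h \<circ> q)"
    by (simp add: l_def path_compose_join path_compose_reversepath)
  moreover have "path (h \<circ> p)" "path (h \<circ> q)"
    using p q assms(2) by (auto intro!: path_continuous_image continuous_on_subset[OF assms(2)])
  moreover have "0 \<notin> path_image (h \<circ> p)" "0 \<notin> path_image (h \<circ> q)"
    using p q assms(3) by (auto simp: path_image_compose)
  moreover have "pathfinish (h \<circ> p) = pathfinish (h \<circ> q)"
    using eq by (simp add: pathfinish_compose)
  ultimately show ?thesis
    by (simp add: winding_number_join winding_number_reversepath)
qed

text \<open>\<open>simply_connected\<close> makes any two loops freely homotopic. For the constant
  loops at \<open>a\<close> and \<open>b\<close> the homotopy traces a path between them.\<close>

lemma simply_connected_obtain_path: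
  fixes S :: "'a::topological_space set"
  assumes "simply_connected S" "a \<in> S" "b \<in> S"
  obtains g where "path g" "path_image g \<subseteq> S" "pathstart g = a" "pathfinish g = b"
proof -
  have "homotopic_loops S (\<lambda>t. a) (\<lambda>t. b)"
    using assms(1)[unfolded simply_connected_def, rule_format, of "\<lambda>t. a" "\<lambda>t. b"] assms(2,3)
    by (auto simp: path_image_def pathfinish_def pathstart_def path_def image_subset_iff)
  then have "path_component S a b"
    using homotopic_loops_imp_path_component_value[of S "\<lambda>t. a" "\<lambda>t. b" 0] by simp
  then show ?thesis using that unfolding path_component_def by blast
qed

section \<open>Maps encircling a point of a surface\<close>

text \<open>\<open>\<iota>\<close> is the inverse of a complex chart centred at \<open>\<iota> 0\<close>.  Such a map \<open>h\<close> witnesses that a small loop around \<open>\<iota> 0\<close> is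
  not null-homotopic in the complement of the two points \<open>\<iota> 0\<close> and \<open>p\<close>.\<close>

definition encircling_map :: "'a::topological_space set \<Rightarrow> (complex \<Rightarrow> 'a) \<Rightarrow> 'a \<Rightarrow> ('a \<Rightarrow> complex) \<Rightarrow> bool" where
  "encircling_map M \<iota> p h \<longleftrightarrow> continuous_on (M - {\<iota> 0, p}) h \<and> (\<forall>x \<in> M - {\<iota> 0, p}. h x \<noteq> (0::complex)) \<and>
     (\<exists>\<delta>>0. \<forall>\<epsilon>. 0 < \<epsilon> \<and> \<epsilon> < \<delta> \<longrightarrow> winding_number (h \<circ> \<iota> \<circ> circlepath 0 \<epsilon>) 0 = 1)"

text \<open>In the coordinate, z / (z - b) has a zero at 0 and a pole at \<open>b\<close>. Along
  loops around both, the windings cancel, so the quotient can be deformed to 1 before the rim of the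
  disc: the pole slides back into 0 while the norm of z grows from \<open>norm b\<close> to
  \<open>r'\<close>. The result extends by 1 to the rest of \<open>M\<close>.\<close>

lemma encircling_map_near:
  fixes M :: "'a::t2_space set" and w :: "'a \<Rightarrow> complex"
  assumes contw: "continuous_on M w" and r: "r > 0"
    and cont: "continuous_on (ball 0 r) \<iota>" and op: "openin (top_of_set M) (\<iota> ` ball 0 r)"
    and inv: "\<And>z. z \<in> ball 0 r \<Longrightarrow> w (\<iota> z) = z"
    and b: "b \<noteq> 0" "norm b < r"
  shows "\<exists>h. encircling_map M \<iota> (\<iota> b) h"
proof -
  define r' where "r' = (norm b + r) / 2"
  have r': "norm b < r'" "r' < r" using b by (auto simp: r'_def)
  then have r'0: "r' > 0" using norm_ge_zero[of b] by linarith
  define \<eta> where "\<eta> t = max 0 (min 1 ((r' - t) / (r' - norm b)))" for t :: real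
  have \<eta>1: "\<eta> t = 1" if "t \<le> norm b" for t
    using that r' by (simp add: \<eta>_def)
  have \<eta>0: "\<eta> t = 0" if "t \<ge> r'" for t
    using that r' by (simp add: \<eta>_def divide_nonpos_pos)
  have \<eta>01: "0 \<le> \<eta> t" "\<eta> t \<le> 1" for t by (auto simp: \<eta>_def)
  \<comment> \<open>\<open>z / (z - b)\<close> near the segment from \<open>0\<close> to \<open>b\<close>, and \<open>1\<close> close to the rim of the disc\<close>
  define k where "k z = z / (z - b * of_real (\<eta> (norm z)))" for z
  define h where "h x = (if x \<in> \<iota> ` ball 0 r then k (w x) else 1)" for x
  have contk: "continuous_on (- {b}) k"
    and k0: "\<And>z. z \<noteq> b \<Longrightarrow> z \<noteq> 0 \<Longrightarrow> k z \<noteq> 0"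
  proof -
    \<comment> \<open>A zero of the denominator has norm at most \<open>norm b\<close>. There the
      cutoff is still 1, which leaves only z = \<open>b\<close>.\<close>
    have ne: "z - b * of_real (\<eta> (norm z)) \<noteq> 0" if "z \<noteq> b" for z
    proof
      assume "z - b * of_real (\<eta> (norm z)) = 0"
      then have z: "z = b * of_real (\<eta> (norm z))" by simp
      then have "norm z = norm b * \<eta> (norm z)"
        by (metis \<eta>01(1) abs_of_nonneg norm_mult norm_of_real)
      also have "\<dots> \<le> norm b * 1"
        using \<eta>01 by (intro mult_left_mono) auto
      finally have "\<eta> (norm z) = 1" by (intro \<eta>1) simp
      with z that show False by simp
    qed
    have "continuous_on (- {b}) (\<lambda>z. \<eta> (norm z))"
      unfolding \<eta>_def using r' by (intro continuous_intros) auto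
    then show "continuous_on (- {b}) k"
      unfolding k_def using ne by (intro continuous_intros) auto
    show "\<And>z. z \<noteq> b \<Longrightarrow> z \<noteq> 0 \<Longrightarrow> k z \<noteq> 0" using ne by (simp add: k_def)
  qed
  have sub: "\<iota> ` ball 0 r \<subseteq> M" using op by (meson openin_imp_subset)
  have wb: "w (\<iota> b) = b" and w0: "w (\<iota> 0) = 0" using inv b r by auto
  have cl: "closed (\<iota> ` cball 0 r')"
    using r' by (intro compact_imp_closed compact_continuous_image continuous_on_subset[OF cont]) auto
  let ?M = "M - {\<iota> 0, \<iota> b}"
  let ?A = "\<iota> ` ball 0 r \<inter> ?M" and ?B = "?M - \<iota> ` cball 0 r'"
  have un: "?A \<union> ?B = ?M"
  proof -
    have "\<iota> ` cball 0 r' \<subseteq> \<iota> ` ball 0 r" using r' by (intro image_mono) auto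
    then show ?thesis by blast
  qed
  have "continuous_on (?A \<union> ?B) h"
  proof (rule continuous_on_Un_local_open)
    have "openin (top_of_set ?M) ?A"
      by (metis Diff_subset inf.absorb_iff1 op openin_subtopology_Int2 subtopology_subtopology inf_commute)
    moreover have "openin (top_of_set ?M) ?B"
      using openin_open_Int[of "- \<iota> ` cball 0 r'" ?M] cl by (simp add: Diff_eq open_Compl)
    ultimately show "openin (top_of_set (?A \<union> ?B)) ?A" "openin (top_of_set (?A \<union> ?B)) ?B"
      by (simp_all only: un)
    have "continuous_on ?A (\<lambda>x. k (w x))"
    proof (rule continuous_on_compose2[OF contk])
      show "continuous_on ?A w" by (rule continuous_on_subset[OF contw]) auto
      show "w ` ?A \<subseteq> - {b}" using inv by auto
    qed
    then show "continuous_on ?A h"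
      by (rule continuous_on_eq) (auto simp: h_def)
    have "h x = 1" if "x \<in> ?B" for x
    proof (cases "x \<in> \<iota> ` ball 0 r")
      case True
      then obtain z where z: "x = \<iota> z" "norm z < r" by auto
      with that have "norm z > r'" by force
      then show ?thesis using z inv b r' r'0 True by (auto simp: h_def k_def \<eta>0)
    qed (simp add: h_def)
    then show "continuous_on ?B h"
      using continuous_on_eq[OF continuous_on_const[of ?B 1], of h] by auto
  qed
  then have "continuous_on ?M h" by (simp only: un)
  moreover have "\<forall>x\<in>?M. h x \<noteq> 0"
    using k0 inv by (auto simp: h_def) metis
  \<comment> \<open>On circles of radius below \<open>norm b\<close> the pole has not moved yet, and
    the factor 1 / (z - b) has neither zero nor pole in the enclosed disc. Only the factor z
    winds.\<close>
  moreover have "winding_number (h \<circ> \<iota> \<circ> circlepath 0 \<epsilon>) 0 = 1" if e: "0 < \<epsilon>" "\<epsilon> < norm b" for \<epsilon>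
  proof -
    let ?c = "circlepath 0 \<epsilon>"
    define q where "q t = inverse (?c t - b)" for t
    have nc: "norm (?c t) = \<epsilon>" for t using e by (simp add: circlepath norm_mult)
    have cz: "?c t \<noteq> 0" for t using nc[of t] e by auto
    have cb: "?c t \<noteq> b" for t using nc[of t] e by auto
    have "winding_number (h \<circ> \<iota> \<circ> ?c) 0 = winding_number (\<lambda>t. ?c t * q t) 0"
      using nc e b inv by (intro winding_number_cong) (auto simp: h_def k_def q_def \<eta>1 divide_inverse)
    also have "\<dots> = winding_number ?c 0 + winding_number q 0"
    proof (rule winding_number_mult)
      show "path q" unfolding q_def path_def using cb path_circlepath[of 0 \<epsilon>]
        by (intro continuous_intros) (auto simp: path_def)
    qed (use cz cb in \<open>auto simp: path_image_def q_def\<close>)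
    also have "winding_number q 0 = 0"
    proof -
      have "winding_number ((\<lambda>z. inverse (z - b)) \<circ> ?c) 0 = 0"
      proof (rule winding_number_simply_connected_loop)
        show "simply_connected (ball (0::complex) (norm b))"
          by (simp add: convex_imp_simply_connected)
        show "path_image ?c \<subseteq> ball 0 (norm b)"
          using nc e by (auto simp: path_image_def)
        show "continuous_on (ball 0 (norm b)) (\<lambda>z. inverse (z - b))"
          by (intro continuous_intros) auto
      qed auto
      then show ?thesis by (simp add: q_def[abs_def] o_def)
    qed
    also have "winding_number ?c 0 + 0 = 1" using e by (simp add: winding_number_circlepath_centre)
    finally show ?thesis .
  qed
  ultimately show ?thesis
    unfolding encircling_map_def using b by (metis zero_less_norm_iff)
qed

text \<open>A homeomorphism of the plane supported in the ball moves the coordinate of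
  \<open>q\<close> to that of \<open>p\<close>. It is carried over by the chart and extended by the
  identity; this is continuous because the image of the closed ball is compact, hence closed in the
  Hausdorff space.\<close>

lemma disc_pushing:
  fixes M :: "'a::t2_space set" and \<phi> :: "'a \<Rightarrow> 'b::euclidean_space"
  assumes U: "openin (top_of_set M) U" "homeomorphism U (\<phi> ` U) \<phi> \<psi>" "open (\<phi> ` U)"
    and e: "cball x e \<subseteq> \<phi> ` U" and pq: "p \<in> \<psi> ` ball x e" "q \<in> \<psi> ` ball x e"
  obtains \<tau> where "continuous_on M \<tau>" "\<tau> ` M \<subseteq> M" "\<tau> q = p" "inj_on \<tau> M"
    "\<And>y. y \<notin> \<psi> ` ball x e \<Longrightarrow> \<tau> y = y"
proof -
  let ?D = "\<psi> ` ball x e"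
  have \<psi>\<phi>: "\<And>y. y \<in> U \<Longrightarrow> \<psi> (\<phi> y) = y" and \<phi>\<psi>: "\<And>z. z \<in> \<phi> ` U \<Longrightarrow> \<phi> (\<psi> z) = z"
    and con: "continuous_on U \<phi>" "continuous_on (\<phi> ` U) \<psi>" and im: "\<psi> ` \<phi> ` U = U"
    using U(2) by (auto simp: homeomorphism_def)
  have UM: "U \<subseteq> M" using U(1) by (meson openin_imp_subset)
  have bU: "ball x e \<subseteq> \<phi> ` U" using e ball_subset_cball by blast
  have DU: "?D \<subseteq> U" using bU im by blast
  have pq': "\<phi> p \<in> ball x e" "\<phi> q \<in> ball x e" using pq \<phi>\<psi> bU by auto
  have aff: "affine hull ball x e = UNIV"
    using pq' by (intro affine_hull_open open_ball) blast
  obtain \<theta> \<theta>' where \<theta>: "homeomorphism UNIV UNIV \<theta> \<theta>'" "\<theta> (\<phi> q) = \<phi> p"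
    "{x. \<not> (\<theta> x = x \<and> \<theta>' x = x)} \<subseteq> ball x e"
    by (rule homeomorphism_moving_point[of "ball x e" UNIV "\<phi> q" "\<phi> p"];
        simp add: aff pq' del: mem_ball)
  have \<theta>id: "\<theta> z = z" if "z \<notin> ball x e" for z using \<theta>(3) that by auto
  have inj\<theta>: "\<theta> z = \<theta> z' \<longleftrightarrow> z = z'" for z z'
    using \<theta>(1) by (metis UNIV_I homeomorphism_def)
  have \<theta>b: "\<theta> z \<in> ball x e \<longleftrightarrow> z \<in> ball x e" for z
    using \<theta>id inj\<theta> by metis
  have \<theta>U: "\<theta> z \<in> \<phi> ` U" if "z \<in> \<phi> ` U" for z
    using \<theta>b \<theta>id bU that by (metis subsetD)
  define \<tau> where "\<tau> y = (if y \<in> ?D then \<psi> (\<theta> (\<phi> y)) else y)" for y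
  have \<tau>U: "\<tau> y = \<psi> (\<theta> (\<phi> y))" if "y \<in> U" for y
  proof (cases "y \<in> ?D")
    case False
    then have "\<phi> y \<notin> ball x e" using \<psi>\<phi> that by force
    then show ?thesis using False \<theta>id \<psi>\<phi> that by (simp add: \<tau>_def)
  qed (simp add: \<tau>_def)
  have \<tau>D: "\<tau> y \<in> ?D \<longleftrightarrow> y \<in> ?D" for y
  proof (cases "y \<in> ?D")
    case True
    then have "\<phi> y \<in> ball x e" using \<phi>\<psi> bU by auto
    then show ?thesis using True \<theta>b by (simp add: \<tau>_def)
  qed (simp add: \<tau>_def)
  show ?thesis
  proof
    have cc: "closed (\<psi> ` cball x e)"
      by (intro compact_imp_closed compact_continuous_image continuous_on_subset[OF con(2)] e) auto
    have un: "U \<union> (M - \<psi> ` cball x e) = M"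
      using UM e im by blast
    have "continuous_on (U \<union> (M - \<psi> ` cball x e)) \<tau>"
    proof (rule continuous_on_Un_local_open)
      show "openin (top_of_set (U \<union> (M - \<psi> ` cball x e))) U"
        unfolding un by (fact U(1))
      show "openin (top_of_set (U \<union> (M - \<psi> ` cball x e))) (M - \<psi> ` cball x e)"
        unfolding un using openin_open_Int[of "- \<psi> ` cball x e" M] cc by (simp add: Diff_eq open_Compl)
      have "continuous_on U (\<lambda>y. \<psi> (\<theta> (\<phi> y)))"
      proof (rule continuous_on_compose2[OF con(2)])
        show "continuous_on U (\<lambda>y. \<theta> (\<phi> y))"
          using \<theta>(1) con(1) by (auto simp: homeomorphism_def intro: continuous_on_compose2)
      qed (use \<theta>U in auto)
      then show "continuous_on U \<tau>" by (rule continuous_on_eq) (simp add: \<tau>U)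
      show "continuous_on (M - \<psi> ` cball x e) \<tau>"
        by (rule continuous_on_eq[OF continuous_on_id]) (auto simp: \<tau>_def)
    qed
    then show "continuous_on M \<tau>" unfolding un .
    show "\<tau> ` M \<subseteq> M"
    proof (rule image_subsetI)
      fix y assume "y \<in> M"
      then show "\<tau> y \<in> M"
        using \<tau>D[of y] subsetD[OF DU, of "\<tau> y"] UM by (cases "y \<in> ?D") (auto simp: \<tau>_def)
    qed
    have "\<psi> (\<phi> p) = p" using pq DU \<psi>\<phi> by blast
    then show "\<tau> q = p" using pq \<theta>(2) by (simp add: \<tau>_def)
    show "inj_on \<tau> M"
    proof (rule inj_onI)
      fix y z assume "y \<in> M" "z \<in> M" and eq: "\<tau> y = \<tau> z"
      then consider "y \<in> ?D" "z \<in> ?D" | "y \<notin> ?D" "z \<notin> ?D" using \<tau>D by metis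
      then show "y = z"
      proof cases
        case 1
        then have yz: "y \<in> U" "z \<in> U" using DU by auto
        then have "\<theta> (\<phi> y) = \<theta> (\<phi> z)"
          using eq \<tau>U \<theta>U \<phi>\<psi> by (metis imageI)
        then show ?thesis using inj\<theta> \<psi>\<phi> yz by metis
      qed (use eq in \<open>simp add: \<tau>_def\<close>)
    qed
  qed (simp add: \<tau>_def)
qed

text \<open>By injectivity, \<open>\<tau>\<close> takes only \<open>\<iota> 0\<close> and
  \<open>q\<close> to the two exceptional points of \<open>h\<close>. Since \<open>\<tau>\<close> is
  the identity near \<open>\<iota> 0\<close>, small circles there keep their winding.\<close>

lemma encircling_map_push:
  assumes h: "encircling_map M \<iota> p h" and \<tau>: "continuous_on M \<tau>" "\<tau> ` M \<subseteq> M" "\<tau> q = p" "inj_on \<tau> M"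
    and q: "q \<in> M" and fix_near: "\<And>z. norm z < d \<Longrightarrow> \<tau> (\<iota> z) = \<iota> z" "d > 0" and "\<iota> 0 \<in> M"
  shows "encircling_map M \<iota> q (h \<circ> \<tau>)"
proof -
  obtain \<delta> where \<delta>: "\<delta> > 0" "\<And>\<epsilon>. 0 < \<epsilon> \<Longrightarrow> \<epsilon> < \<delta> \<Longrightarrow> winding_number (h \<circ> \<iota> \<circ> circlepath 0 \<epsilon>) 0 = 1"
    using h unfolding encircling_map_def by blast
  have t0: "\<tau> (\<iota> 0) = \<iota> 0" using fix_near by simp
  have im: "\<tau> ` (M - {\<iota> 0, q}) \<subseteq> M - {\<iota> 0, p}"
  proof -
    have "\<tau> y \<noteq> \<iota> 0" "\<tau> y \<noteq> p" if "y \<in> M" "y \<noteq> \<iota> 0" "y \<noteq> q" for y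
      using that \<tau>(3,4) t0 q \<open>\<iota> 0 \<in> M\<close> by (metis inj_onD)+
    then show ?thesis using \<tau>(2) by auto
  qed
  have "continuous_on (M - {\<iota> 0, q}) (h \<circ> \<tau>)"
    using h im unfolding encircling_map_def
    by (intro continuous_on_compose continuous_on_subset[OF \<tau>(1)]) (auto intro: continuous_on_subset)
  moreover have "\<forall>x\<in>M - {\<iota> 0, q}. (h \<circ> \<tau>) x \<noteq> 0"
    using h im unfolding encircling_map_def by auto
  moreover have "winding_number (h \<circ> \<tau> \<circ> \<iota> \<circ> circlepath 0 \<epsilon>) 0 = 1" if "0 < \<epsilon>" "\<epsilon> < min \<delta> d" for \<epsilon>
  proof -
    have "norm (circlepath 0 \<epsilon> t) = \<epsilon>" for t using that by (simp add: circlepath norm_mult)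
    then have "h \<circ> \<tau> \<circ> \<iota> \<circ> circlepath 0 \<epsilon> = h \<circ> \<iota> \<circ> circlepath 0 \<epsilon>"
      using fix_near(1) that by (auto simp: o_def)
    then show ?thesis using \<delta> that by simp
  qed
  ultimately show ?thesis
    unfolding encircling_map_def using \<delta>(1) fix_near(2) by (metis min_less_iff_conj)
qed

definition locally_planar :: "'a::topological_space set \<Rightarrow> bool" where
  "locally_planar M \<longleftrightarrow> (\<forall>x\<in>M. \<exists>U (\<phi> :: 'a \<Rightarrow> real^2) \<psi>. x \<in> U \<and> openin (top_of_set M) U \<and>
     homeomorphism U (\<phi> ` U) \<phi> \<psi> \<and> open (\<phi> ` U))"

text \<open>The admissible positions of the second point are propagated through the connected
  surface: close to \<open>\<iota> 0\<close> the explicit map serves, and elsewhere a disc push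
  moves the second point within a small disc.\<close>

lemma encircling_map_exists:
  fixes M :: "'a::t2_space set" and w :: "'a \<Rightarrow> complex"
  assumes M: "connected M" "locally_planar M"
    and contw: "continuous_on M w" and r: "r > 0"
    and cont: "continuous_on (ball 0 r) \<iota>" and op: "openin (top_of_set M) (\<iota> ` ball 0 r)"
    and inv: "\<And>z. z \<in> ball 0 r \<Longrightarrow> w (\<iota> z) = z"
    and p: "p \<in> M" "p \<noteq> \<iota> 0"
  shows "\<exists>h. encircling_map M \<iota> p h"
proof -
  \<comment> \<open>The centre is counted as admissible, so that the induction can start
    there.\<close>
  define P where "P q \<longleftrightarrow> q = \<iota> 0 \<or> (\<exists>h. encircling_map M \<iota> q h)" for q
  have sub: "\<iota> ` ball 0 r \<subseteq> M" using op by (meson openin_imp_subset)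
  have p1: "\<iota> 0 \<in> M" using sub r by auto
  have "P p"
  proof (rule connected_induction_simple[OF M(1) p1 p(1), of P])
    show "P (\<iota> 0)" by (simp add: P_def)
    fix x assume x: "x \<in> M"
    show "\<exists>T. openin (top_of_set M) T \<and> x \<in> T \<and> (\<forall>q\<in>T. \<forall>q'\<in>T. P q \<longrightarrow> P q')"
    proof (cases "x = \<iota> 0")
      case True
      have "P q" if "q \<in> \<iota> ` ball 0 r" for q
        using that encircling_map_near[OF contw r cont op inv] by (auto simp: P_def) metis
      then show ?thesis using op True r by (intro exI[of _ "\<iota> ` ball 0 r"]) auto
    next
      case False
      obtain U and \<phi> :: "'a \<Rightarrow> real^2" and \<psi> where U: "x \<in> U" "openin (top_of_set M) U"
        "homeomorphism U (\<phi> ` U) \<phi> \<psi>" "open (\<phi> ` U)"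
        using M(2) x unfolding locally_planar_def by metis
      \<comment> \<open>Removing the centre from the chart domain keeps the disc in which points are
        pushed away from \<open>\<iota> 0\<close>.\<close>
      define U' where "U' = U - {\<iota> 0}"
      have U'1: "openin (top_of_set M) U'"
        unfolding U'_def Diff_eq by (rule openin_Int_open[OF U(2)]) auto
      have "openin (top_of_set U) U'"
        by (metis Diff_subset U'_def U'1 U(2) openin_imp_subset openin_subset_trans)
      then have "openin (top_of_set (\<phi> ` U)) (\<phi> ` U')"
        using homeomorphism_imp_open_map[OF U(3)] by blast
      then have U'2: "open (\<phi> ` U')" using U(4) openin_open_trans by blast
      have U'3: "homeomorphism U' (\<phi> ` U') \<phi> \<psi>"
        by (rule homeomorphism_of_subsets[OF U(3)]) (auto simp: U'_def)
      have xU': "x \<in> U'" using False U(1) by (simp add: U'_def)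
      then obtain e where e: "e > 0" "cball (\<phi> x) e \<subseteq> \<phi> ` U'"
        using U'2 open_contains_cball by blast
      let ?D = "\<psi> ` ball (\<phi> x) e"
      have inv': "\<psi> ` \<phi> ` U' = U'" using U'3 by (auto simp: homeomorphism_def)
      have cDU: "\<psi> ` cball (\<phi> x) e \<subseteq> U'" using image_mono[OF e(2), of \<psi>] inv' by simp
      have Dc: "?D \<subseteq> \<psi> ` cball (\<phi> x) e" by (intro image_mono ball_subset_cball)
      have DM: "?D \<subseteq> M" "\<iota> 0 \<notin> \<psi> ` cball (\<phi> x) e"
        using Dc cDU openin_imp_subset[OF U'1] by (auto simp: U'_def)
      have opD: "openin (top_of_set M) ?D"
      proof -
        have "openin (top_of_set U') ?D"
          using homeomorphism_imp_open_map[OF homeomorphism_symD[OF U'3]] e(2) ball_subset_cball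
          by (metis open_ball open_subset order_trans)
        then show ?thesis using U'1 openin_trans by blast
      qed
      have xD: "x \<in> ?D"
        using e(1) xU' U'3 by (intro rev_image_eqI[of "\<phi> x"]) (auto simp: homeomorphism_def)
      have "P q'" if qq: "q \<in> ?D" "q' \<in> ?D" "P q" for q q'
      proof -
        have "q \<noteq> \<iota> 0" using subsetD[OF Dc qq(1)] DM(2) by metis
        then obtain h where h: "encircling_map M \<iota> q h"
          using qq(3) unfolding P_def by metis
        obtain \<tau> where \<tau>: "continuous_on M \<tau>" "\<tau> ` M \<subseteq> M" "\<tau> q' = q" "inj_on \<tau> M"
          "\<And>y. y \<notin> ?D \<Longrightarrow> \<tau> y = y"
          using disc_pushing[OF U'1 U'3 U'2 e(2) qq(1,2)] by metis
        \<comment> \<open>The closed disc misses the centre, hence a whole coordinate neighbourhood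
          of the centre, on which the push is therefore the identity.\<close>
        have "closed (\<psi> ` cball (\<phi> x) e)"
          using U'3 e by (intro compact_imp_closed compact_continuous_image)
            (auto simp: homeomorphism_def intro: continuous_on_subset)
        then have "open (ball 0 r \<inter> \<iota> -` (- \<psi> ` cball (\<phi> x) e))"
          using continuous_open_preimage[OF cont] by (simp add: open_Compl)
        moreover have "0 \<in> ball 0 r \<inter> \<iota> -` (- \<psi> ` cball (\<phi> x) e)" using r DM(2) by simp
        ultimately obtain d where d: "d > 0" "ball 0 d \<subseteq> ball 0 r \<inter> \<iota> -` (- \<psi> ` cball (\<phi> x) e)"
          using open_contains_ball by blast
        have "\<tau> (\<iota> z) = \<iota> z" if "norm z < d" for z
        proof (rule \<tau>(5))
          have "z \<in> ball 0 d" using that by simp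
          then have "\<iota> z \<notin> \<psi> ` cball (\<phi> x) e" using subsetD[OF d(2)] by auto
          then show "\<iota> z \<notin> ?D" using Dc by (metis subsetD)
        qed
        then have "encircling_map M \<iota> q' (h \<circ> \<tau>)"
          using subsetD[OF DM(1) qq(2)] d p1 by (intro encircling_map_push[OF h \<tau>(1-4)])
        then show ?thesis unfolding P_def by blast
      qed
      then show ?thesis using opD xD by (intro exI[of _ ?D]) metis
    qed
  qed
  then show ?thesis using p by (simp add: P_def)
qed

section \<open>Rotating half-surfaces\<close>

lemma cis_circlepath: "circlepath 0 \<epsilon> t = of_real \<epsilon> * cis (2 * pi * t)"
  by (simp add: circlepath cis_conv_exp algebra_simps)

lemma path_reversed_join3:
  assumes "path a" "path b" "path c" "pathstart a = pathstart b" "pathfinish b = pathstart c"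
  shows "path (reversepath a +++ b +++ c)"
    "path_image (reversepath a +++ b +++ c) = path_image a \<union> path_image b \<union> path_image c"
    "pathstart (reversepath a +++ b +++ c) = pathfinish a" "pathfinish (reversepath a +++ b +++ c) = pathfinish c"
  using assms by (auto simp: path_image_join)

lemma winding_number_reversed_join3:
  assumes abc: "path a" "path b" "path c" "pathstart a = pathstart b" "pathfinish b = pathstart c"
    and h: "continuous_on S h" "path_image a \<union> path_image b \<union> path_image c \<subseteq> S" "\<And>x. x \<in> S \<Longrightarrow> h x \<noteq> (0::complex)"
  shows "winding_number (h \<circ> (reversepath a +++ b +++ c)) 0 =
    winding_number (h \<circ> b) 0 + winding_number (h \<circ> c) 0 - winding_number (h \<circ> a) 0"
proof -
  have P: "path (h \<circ> g)" "0 \<notin> path_image (h \<circ> g)" if "path g" "path_image g \<subseteq> S" for g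
    using that h by (auto intro!: path_continuous_image continuous_on_subset[OF h(1)] simp: path_image_compose)
  have "h \<circ> (reversepath a +++ b +++ c) = reversepath (h \<circ> a) +++ (h \<circ> b) +++ (h \<circ> c)"
    by (simp add: path_compose_join path_compose_reversepath)
  then show ?thesis
    using P[of a] P[of b] P[of c] abc h(2)
    by (simp add: winding_number_join winding_number_reversepath path_image_join pathstart_compose pathfinish_compose)
qed

text \<open>As the direction turns once, a path inside the rotating half-surface joining the points
  \<open>\<iota>\<^sub>1 (\<epsilon> cis \<theta>)\<close> and \<open>\<iota>\<^sub>2 (\<epsilon> cis \<theta>)\<close> returns to itself up to homotopy, so the two end points
  have the same winding with respect to any map without zeros on the half-surfaces.\<close>

lemma rotating_half_surfaces:
  fixes M :: "'a::t2_space set" and w :: "'a \<Rightarrow> complex"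
  assumes contw: "continuous_on M w" and \<epsilon>: "0 < \<epsilon>" "\<epsilon> < r"
    and sc: "\<And>\<theta>. simply_connected {p \<in> M. Re (w p * cnj (cis \<theta>)) > 0}"
    and \<iota>1: "continuous_on (ball 0 r) \<iota>1" "\<iota>1 ` ball 0 r \<subseteq> M" "\<And>z. z \<in> ball 0 r \<Longrightarrow> w (\<iota>1 z) = z"
    and \<iota>2: "continuous_on (ball 0 r) \<iota>2" "\<iota>2 ` ball 0 r \<subseteq> M" "\<And>z. z \<in> ball 0 r \<Longrightarrow> w (\<iota>2 z) = z"
    and h: "continuous_on {p \<in> M. w p \<noteq> 0} h" "\<And>p. p \<in> M \<Longrightarrow> w p \<noteq> 0 \<Longrightarrow> h p \<noteq> (0::complex)"
  shows "winding_number (h \<circ> \<iota>1 \<circ> circlepath 0 \<epsilon>) 0 = winding_number (h \<circ> \<iota>2 \<circ> circlepath 0 \<epsilon>) 0"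
proof -
  let ?c = "circlepath 0 \<epsilon>"
  define S where "S t = {p \<in> M. Re (w p * cnj (?c t)) > 0}" for t
  have S_eq: "S t = {p \<in> M. Re (w p * cnj (cis (2 * pi * t))) > 0}" for t
  proof -
    have "Re (w p * cnj (?c t)) = \<epsilon> * Re (w p * cnj (cis (2 * pi * t)))" for p
      by (simp add: cis_circlepath algebra_simps)
    then show ?thesis using \<epsilon> by (simp add: S_def zero_less_mult_iff)
  qed
  have scS: "simply_connected (S t)" for t unfolding S_eq by (rule sc)
  have SM: "S t \<subseteq> {p \<in> M. w p \<noteq> 0}" for t by (auto simp: S_def)
  have hS: "continuous_on (S t) h" "\<And>x. x \<in> S t \<Longrightarrow> h x \<noteq> 0" for t
    using h SM[of t] by (auto intro: continuous_on_subset)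
  have nc: "norm (?c t) = \<epsilon>" for t using \<epsilon> by (simp add: circlepath norm_mult)
  have sq: "Re (z * cnj z) = (norm z)\<^sup>2" for z
    by (simp only: cmod_power2) (simp add: power2_eq_square)
  have cb: "?c t \<in> ball 0 r" for t using nc[of t] \<epsilon> by simp
  have cont_c: "continuous_on UNIV ?c"
    unfolding circlepath by (intro continuous_intros)
  have mem: "\<iota> (?c s) \<in> S t" if "Re (?c s * cnj (?c t)) > 0" "\<iota> = \<iota>1 \<or> \<iota> = \<iota>2" for \<iota> s t
    using that \<iota>1 \<iota>2 cb[of s] by (auto simp: S_def)
  have self: "Re (?c t * cnj (?c t)) > 0" for t
    using nc[of t] \<epsilon> sq[of "?c t"] by simp
  have "\<exists>g. path g \<and> path_image g \<subseteq> S t \<and> pathstart g = \<iota>1 (?c t) \<and> pathfinish g = \<iota>2 (?c t)" for t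
    using simply_connected_obtain_path[OF scS mem[OF self, of \<iota>1] mem[OF self, of \<iota>2]] by metis
  then obtain g where g: "\<And>t. path (g t)" "\<And>t. path_image (g t) \<subseteq> S t"
    "\<And>t. pathstart (g t) = \<iota>1 (?c t)" "\<And>t. pathfinish (g t) = \<iota>2 (?c t)"
    by metis
  \<comment> \<open>The paths \<open>g t\<close> are chosen independently and need not vary
    continuously with \<open>t\<close>. Their windings are still well defined, as \<open>S t\<close>
    is simply connected.\<close>
  define W where "W t = winding_number (h \<circ> g t) 0" for t
  define L where "L \<iota> s t = winding_number (h \<circ> (\<iota> \<circ> subpath s t ?c)) 0" for \<iota> s t
  define M0 where "M0 = {p \<in> M. w p \<noteq> 0}"
  have pc: "path (\<iota> \<circ> ?c)" "path_image (\<iota> \<circ> ?c) \<subseteq> M0" if "\<iota> = \<iota>1 \<or> \<iota> = \<iota>2" for \<iota>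
  proof -
    have "continuous_on {0..1} (\<iota> \<circ> ?c)"
      using that \<iota>1(1) \<iota>2(1) cb
      by (intro continuous_on_compose continuous_on_subset[OF cont_c]) (auto elim!: continuous_on_subset)
    then show "path (\<iota> \<circ> ?c)" by (simp add: path_def)
    have "w (\<iota> (?c t)) = ?c t" "\<iota> (?c t) \<in> M" "?c t \<noteq> 0" for t
      using that \<iota>1 \<iota>2 cb[of t] nc[of t] \<epsilon> by auto
    then show "path_image (\<iota> \<circ> ?c) \<subseteq> M0" by (auto simp: path_image_def M0_def)
  qed
  have Lcombine: "L \<iota> 0 s + L \<iota> s t = L \<iota> 0 t" if "\<iota> = \<iota>1 \<or> \<iota> = \<iota>2" "s \<in> {0..1}" "t \<in> {0..1}" for \<iota> s t
  proof -
    have "path (h \<circ> (\<iota> \<circ> ?c))" "0 \<notin> path_image (h \<circ> (\<iota> \<circ> ?c))"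
      using pc[OF that(1)] h(1) h(2)[of "\<iota> (?c _)"] unfolding M0_def[symmetric]
      by (auto intro!: path_continuous_image elim: continuous_on_subset) (auto simp: path_image_def M0_def image_subset_iff h(2))
    from winding_number_subpath_combine[OF this, of 0 s t] that show ?thesis
      by (simp add: L_def subpath_def o_def)
  qed
  \<comment> \<open>Moving the two ends along the small circles from direction 0 to direction
    \<open>t\<close> changes the winding of the joining path by the winding of the second arc minus
    that of the first. \<open>\<Phi>\<close> removes this change, so it is locally constant.
    Comparing its values at 0 and 1 gives the claim.\<close>
  define \<Phi> where "\<Phi> t = W t - L \<iota>2 0 t + L \<iota>1 0 t" for t
  have loc: "\<exists>T. openin (top_of_set {0..1}) T \<and> s \<in> T \<and> (\<forall>t\<in>T. \<Phi> t = \<Phi> s)" if s: "s \<in> {0..1}" for s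
  proof -
    define Q where "Q = path_image (g s)"
    have Q: "compact (w ` Q)" "\<And>z. z \<in> w ` Q \<Longrightarrow> Re (z * cnj (?c s)) > 0" "w ` Q \<noteq> {}"
      using g(1,2) contw by (auto simp: Q_def S_def intro!: compact_continuous_image compact_path_image
        elim!: continuous_on_subset)
    then obtain m where m: "m > 0" "\<And>z. z \<in> w ` Q \<Longrightarrow> Re (z * cnj (?c s)) \<ge> m"
    proof -
      have "continuous_on (w ` Q) (\<lambda>z. Re (z * cnj (?c s)))" by (intro continuous_intros)
      then obtain z0 where "z0 \<in> w ` Q" "\<And>z. z \<in> w ` Q \<Longrightarrow> Re (z0 * cnj (?c s)) \<le> Re (z * cnj (?c s))"
        using continuous_attains_inf Q by metis
      then show ?thesis using that Q(2) by blast
    qed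
    obtain B where B: "B > 0" "\<And>z. z \<in> w ` Q \<Longrightarrow> norm z \<le> B"
      using compact_imp_bounded[OF Q(1)] unfolding bounded_pos by metis
    \<comment> \<open>The bound \<epsilon>/4 keeps short arcs of both circles in the turned
      half-surface, and m/(2B) keeps the compact old path in it.\<close>
    define e where "e = min (\<epsilon> / 4) (m / (2 * B))"
    have e: "e > 0" using \<epsilon> m B by (simp add: e_def)
    obtain d where d: "d > 0" "\<And>t. dist t s < d \<Longrightarrow> dist (?c t) (?c s) < e"
      using cont_c e unfolding continuous_on_iff by (metis UNIV_I)
    have near: "Re (z * cnj (?c t)) > 0" if "dist t s < d" "z \<in> w ` Q" for z t
    proof -
      have "norm (z * cnj (?c t - ?c s)) \<le> B * e"
        unfolding norm_mult complex_mod_cnj using d(2)[OF that(1)] B(2)[OF that(2)] e B(1)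
        by (intro mult_mono) (auto simp: dist_norm)
      also have "\<dots> \<le> B * (m / (2 * B))" using B(1) by (intro mult_left_mono) (auto simp: e_def)
      also have "\<dots> < m" using m B by simp
      finally have "\<bar>Re (z * cnj (?c t - ?c s))\<bar> < m"
        using abs_Re_le_cmod le_less_trans by blast
      then show ?thesis using m(2)[OF that(2)] by (simp add: algebra_simps)
    qed
    have near_arc: "Re (?c a * cnj (?c t)) > 0" if "dist a s < d" "dist t s < d" for a t
    proof -
      have "dist (?c a) (?c t) < \<epsilon> / 2"
        using d(2)[OF that(1)] d(2)[OF that(2)] dist_triangle2[of "?c a" "?c t" "?c s"]
        unfolding e_def by linarith
      then have "norm (?c a - ?c t) * norm (?c t) < \<epsilon> * \<epsilon>"
        using mult_strict_right_mono[of "norm (?c a - ?c t)" \<epsilon> "norm (?c t)"] nc[of t] \<epsilon> by (simp add: dist_norm)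
      then have "\<bar>Re ((?c a - ?c t) * cnj (?c t))\<bar> < \<epsilon> * \<epsilon>"
        using abs_Re_le_cmod[of "(?c a - ?c t) * cnj (?c t)"] by (simp add: norm_mult)
      moreover have "Re (?c t * cnj (?c t)) = \<epsilon> * \<epsilon>"
        using nc[of t] sq[of "?c t"] by (simp add: power2_eq_square)
      ultimately show ?thesis by (simp add: algebra_simps)
    qed
    have "\<Phi> t = \<Phi> s" if t: "t \<in> {0..1}" "dist t s < d" for t
    proof -
      define a b where "a = \<iota>1 \<circ> subpath s t ?c" and "b = \<iota>2 \<circ> subpath s t ?c"
      have arc: "path (\<iota> \<circ> subpath s t ?c)" "path_image (\<iota> \<circ> subpath s t ?c) \<subseteq> S t" if io: "\<iota> = \<iota>1 \<or> \<iota> = \<iota>2" for \<iota>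
      proof -
        have "dist x s < d" if "x \<in> closed_segment s t" for x
          using that t(2) dist_in_closed_segment[OF that] by (auto simp: dist_commute)
        then show "path_image (\<iota> \<circ> subpath s t ?c) \<subseteq> S t"
          using mem[OF near_arc io] t by (auto simp: path_image_compose path_image_subpath_gen)
        have "path (subpath s t ?c)" using s t by (simp add: path_subpath)
        moreover have "path_image (subpath s t ?c) \<subseteq> ball 0 r"
          using cb by (auto simp: path_image_subpath_gen)
        ultimately show "path (\<iota> \<circ> subpath s t ?c)"
          using io \<iota>1(1) \<iota>2(1) by (auto intro!: path_continuous_image elim: continuous_on_subset)
      qed
      have ab: "path a" "path b" "path_image a \<subseteq> S t" "path_image b \<subseteq> S t"
        using arc by (auto simp: a_def b_def)
      have gs: "path_image (g s) \<subseteq> S t"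
        using g(2)[of s] near[OF t(2)] unfolding Q_def S_def by auto
      have ends: "pathstart a = pathstart (g s)" "pathfinish (g s) = pathstart b"
        "pathfinish a = \<iota>1 (?c t)" "pathfinish b = \<iota>2 (?c t)"
        by (auto simp: a_def b_def g pathstart_compose pathfinish_compose)
      \<comment> \<open>The old path, prolonged by the two arcs, lies in \<open>S t\<close> and has
        the ends of \<open>g t\<close>, so it has the same winding.\<close>
      have "W t = winding_number (h \<circ> (reversepath a +++ g s +++ b)) 0"
        unfolding W_def using path_reversed_join3[OF ab(1) g(1) ab(2) ends(1,2)] ab gs ends g
        by (intro winding_number_simply_connected_unique[OF scS hS]) auto
      also have "\<dots> = W s + L \<iota>2 s t - L \<iota>1 s t"
        using winding_number_reversed_join3[OF ab(1) g(1) ab(2) ends(1,2) hS(1) _ hS(2)] ab gs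
        by (simp add: W_def L_def a_def b_def)
      finally have "W t = W s + L \<iota>2 s t - L \<iota>1 s t" .
      moreover have "L \<iota>1 s t = L \<iota>1 0 t - L \<iota>1 0 s" "L \<iota>2 s t = L \<iota>2 0 t - L \<iota>2 0 s"
        using Lcombine[of \<iota>1 s t] Lcombine[of \<iota>2 s t] s t by (simp_all add: eq_diff_eq add.commute)
      ultimately show ?thesis unfolding \<Phi>_def by simp
    qed
    moreover have "openin (top_of_set {0..1}) ({0..1} \<inter> ball s d)" by (simp add: openin_open_Int)
    moreover have "s \<in> {0..1} \<inter> ball s d" using d(1) s by simp
    ultimately show ?thesis by (metis IntD1 IntD2 dist_commute mem_ball)
  qed
  have "\<Phi> constant_on {0..1}"
    by (rule locally_constant_imp_constant) (use loc in auto)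
  then have "\<Phi> 0 = \<Phi> 1" by (auto simp: constant_on_def)
  moreover have "W 0 = W 1"
  proof -
    have "?c 0 = ?c 1" by (simp add: cis_circlepath)
    then have "S 0 = S 1" by (simp add: S_def)
    then show ?thesis unfolding W_def using g \<open>?c 0 = ?c 1\<close>
      by (intro winding_number_simply_connected_unique[OF scS[of 0] hS(1) hS(2)]) auto
  qed
  moreover have "L \<iota> 0 0 = 0" if "\<iota> = \<iota>1 \<or> \<iota> = \<iota>2" for \<iota>
    using Lcombine[OF that, of 0 0] by simp
  moreover have "L \<iota> 0 1 = winding_number (h \<circ> \<iota> \<circ> ?c) 0" for \<iota>
    by (simp add: L_def o_assoc)
  ultimately show ?thesis unfolding \<Phi>_def by simp
qed

text \<open>The roles of the discs differ: \<open>\<iota>1\<close> has to be a chart, since a map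
  winding around its centre is constructed, while \<open>\<iota>2\<close> only serves as a
  continuous section of \<open>w\<close>.\<close>

lemma three_points_contradiction:
  fixes M :: "'a::t2_space set" and w :: "'a \<Rightarrow> complex"
  assumes M: "connected M" "locally_planar M"
    and contw: "continuous_on M w" and r: "r > 0"
    and sc: "\<And>\<theta>. simply_connected {p \<in> M. Re (w p * cnj (cis \<theta>)) > 0}"
    and \<iota>1: "continuous_on (ball 0 r) \<iota>1" "openin (top_of_set M) (\<iota>1 ` ball 0 r)"
      "\<And>z. z \<in> ball 0 r \<Longrightarrow> w (\<iota>1 z) = z"
    and \<iota>2: "continuous_on (ball 0 r) \<iota>2" "\<iota>2 ` ball 0 r \<subseteq> M" "\<And>z. z \<in> ball 0 r \<Longrightarrow> w (\<iota>2 z) = z"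
    and p3: "p3 \<in> M" "w p3 = 0" and distinct: "\<iota>1 0 \<noteq> \<iota>2 0" "\<iota>1 0 \<noteq> p3" "\<iota>2 0 \<noteq> p3"
  shows False
proof -
  have sub: "\<iota>1 ` ball 0 r \<subseteq> M" using \<iota>1(2) by (meson openin_imp_subset)
  obtain h where h: "encircling_map M \<iota>1 p3 h"
    using encircling_map_exists[OF M contw r \<iota>1 p3(1)] distinct by auto
  then obtain \<delta> where \<delta>: "\<delta> > 0" "\<And>\<epsilon>. 0 < \<epsilon> \<Longrightarrow> \<epsilon> < \<delta> \<Longrightarrow> winding_number (h \<circ> \<iota>1 \<circ> circlepath 0 \<epsilon>) 0 = 1"
    unfolding encircling_map_def by blast
  have h': "continuous_on (M - {\<iota>1 0, p3}) h" "\<And>x. x \<in> M - {\<iota>1 0, p3} \<Longrightarrow> h x \<noteq> 0"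
    using h unfolding encircling_map_def by auto
  define \<epsilon> where "\<epsilon> = min \<delta> r / 2"
  have \<epsilon>: "0 < \<epsilon>" "\<epsilon> < \<delta>" "\<epsilon> < r" using \<delta>(1) r by (auto simp: \<epsilon>_def)
  have w0: "w (\<iota>1 0) = 0" using \<iota>1(3)[of 0] r by simp
  have "winding_number (h \<circ> \<iota>1 \<circ> circlepath 0 \<epsilon>) 0 = winding_number (h \<circ> \<iota>2 \<circ> circlepath 0 \<epsilon>) 0"
    using \<epsilon> w0 p3 h' by (intro rotating_half_surfaces[OF contw _ _ sc \<iota>1(1) sub \<iota>1(3) \<iota>2])
      (auto elim!: continuous_on_subset)
  also have "\<dots> = 0"
  proof -
    \<comment> \<open>On the second disc \<open>w\<close> vanishes at the centre only, so the disc
      contains neither exceptional point of \<open>h\<close>, and \<open>h\<close> is zero-free on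
      it.\<close>
    have im: "\<iota>2 ` ball 0 r \<subseteq> M - {\<iota>1 0, p3}"
    proof -
      have "\<iota>2 z \<in> M - {\<iota>1 0, p3}" if "z \<in> ball 0 r" for z
        using \<iota>2(3)[OF that] w0 p3(2) distinct \<iota>2(2) that by auto
      then show ?thesis by (rule image_subsetI)
    qed
    have "winding_number ((h \<circ> \<iota>2) \<circ> circlepath 0 \<epsilon>) 0 = 0"
    proof (rule winding_number_simply_connected_loop)
      show "simply_connected (ball (0::complex) r)"
        by (simp add: convex_imp_simply_connected)
      show "continuous_on (ball 0 r) (h \<circ> \<iota>2)"
        using im by (intro continuous_on_compose[OF \<iota>2(1)] continuous_on_subset[OF h'(1)])
      show "(h \<circ> \<iota>2) x \<noteq> 0" if "x \<in> ball 0 r" for x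
        using subsetD[OF im imageI[OF that]] h'(2) by simp
      show "path_image (circlepath 0 \<epsilon>) \<subseteq> ball 0 r"
        using \<epsilon> by (auto simp: path_image_def circlepath norm_mult)
    qed auto
    then show ?thesis .
  qed
  finally show False using \<delta>(2)[of \<epsilon>] \<epsilon> by simp
qed

section \<open>Second derivatives\<close>

text \<open>The direction comes first, so that \<open>pd v g\<close> is again a map and can be
  differentiated. For \<open>v\<close> in \<open>Basis\<close> it is the map in the recursion of
  \<open>Ck_on\<close>.\<close>

definition pd :: "'a::euclidean_space \<Rightarrow> ('a \<Rightarrow> 'b::euclidean_space) \<Rightarrow> 'a \<Rightarrow> 'b" where
  "pd v g x = frechet_derivative g (at x) v"

lemma Ck_on_continuous: "Ck_on k g S \<Longrightarrow> continuous_on S g"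
proof (cases k)
  case (Suc m)
  assume "Ck_on k g S"
  then show ?thesis using Suc
    by (auto simp: continuous_on_eq_continuous_within dest!: differentiable_imp_continuous_within
       intro: continuous_within_subset)
qed simp

lemma has_derivative_pd:
  assumes "Ck_on (Suc k) g S" "x \<in> S"
  shows "(g has_derivative (\<lambda>v. pd v g x)) (at x)"
  using assms by (simp add: pd_def frechet_derivative_works[symmetric])

lemma linear_pd:
  assumes "Ck_on (Suc k) g S" "x \<in> S"
  shows "linear (\<lambda>v. pd v g x)"
  using has_derivative_pd[OF assms] has_derivative_linear by blast

lemma pd_eqI: "(g has_derivative D) (at x) \<Longrightarrow> pd v g x = D v"
  unfolding pd_def using frechet_derivative_at by metis

lemma pd_eq_sum:
  assumes "Ck_on (Suc k) g S" "x \<in> S"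
  shows "pd v g x = (\<Sum>i\<in>Basis. (v \<bullet> i) *\<^sub>R pd i g x)"
proof -
  interpret linear "\<lambda>v. pd v g x" by (rule linear_pd[OF assms])
  have "pd v g x = pd (\<Sum>i\<in>Basis. (v \<bullet> i) *\<^sub>R i) g x" by (simp add: euclidean_representation)
  also have "\<dots> = (\<Sum>i\<in>Basis. (v \<bullet> i) *\<^sub>R pd i g x)" by (simp add: sum scale)
  finally show ?thesis .
qed

text \<open>\<open>Ck_on\<close> controls derivatives along \<open>Basis\<close> only. Near
  \<open>x\<close>, \<open>pd v g\<close> is a fixed linear combination of these, which carries
  differentiability over to arbitrary directions.\<close>

lemma pd_pd_eq_sum:
  assumes g: "Ck_on (Suc (Suc k)) g S" and S: "open S" "x \<in> S"
  shows "(pd v g has_derivative (\<lambda>w. \<Sum>i\<in>Basis. (v \<bullet> i) *\<^sub>R pd w (pd i g) x)) (at x)"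
proof -
  have "(pd i g has_derivative (\<lambda>w. pd w (pd i g) x)) (at x)" if "i \<in> Basis" for i
    using g that S(2) by (intro has_derivative_pd[of k _ S]) (simp_all add: pd_def[abs_def])
  then have "((\<lambda>x. \<Sum>i\<in>Basis. (v \<bullet> i) *\<^sub>R pd i g x) has_derivative
      (\<lambda>w. \<Sum>i\<in>Basis. (v \<bullet> i) *\<^sub>R pd w (pd i g) x)) (at x)"
    by (intro has_derivative_sum has_derivative_scaleR_right) auto
  then show ?thesis
    using has_derivative_transform_within_open[OF _ S] pd_eq_sum[OF g] by (metis (no_types, lifting))
qed

lemma has_derivative_pd_pd:
  assumes g: "Ck_on (Suc (Suc k)) g S" and S: "open S" "x \<in> S"
  shows "(pd v g has_derivative (\<lambda>w. pd w (pd v g) x)) (at x)"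
  using pd_pd_eq_sum[OF assms, of v] pd_eqI[OF pd_pd_eq_sum[OF assms, of v]]
  by simp

lemma continuous_on_pd_pd:
  assumes g: "Ck_on (Suc (Suc k)) g S" and S: "open S"
  shows "continuous_on S (pd w (pd v g))"
proof -
  have "continuous_on S (\<lambda>x. \<Sum>i\<in>Basis. (v \<bullet> i) *\<^sub>R (\<Sum>j\<in>Basis. (w \<bullet> j) *\<^sub>R pd j (pd i g) x))"
  proof (intro continuous_intros)
    fix i j :: 'a assume "i \<in> Basis" "j \<in> Basis"
    then have "Ck_on k (pd j (pd i g)) S"
      using g by (simp add: pd_def[abs_def])
    then show "continuous_on S (pd j (pd i g))" by (rule Ck_on_continuous)
  qed
  moreover have "pd w (pd v g) x = (\<Sum>i\<in>Basis. (v \<bullet> i) *\<^sub>R (\<Sum>j\<in>Basis. (w \<bullet> j) *\<^sub>R pd j (pd i g) x))"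
    if "x \<in> S" for x
  proof -
    have "pd w (pd i g) x = (\<Sum>j\<in>Basis. (w \<bullet> j) *\<^sub>R pd j (pd i g) x)" if "i \<in> Basis" for i
      using g that \<open>x \<in> S\<close> by (intro pd_eq_sum[of k _ S]) (simp_all add: pd_def[abs_def])
    then show ?thesis using pd_eqI[OF pd_pd_eq_sum[OF g S that, of v]] by simp
  qed
  ultimately show ?thesis by (simp cong: continuous_on_cong)
qed

lemma continuous_on_pd:
  assumes g: "Ck_on (Suc (Suc k)) g S" and S: "open S"
  shows "continuous_on S (pd v g)"
  using has_derivative_continuous[OF has_derivative_pd_pd[OF g S]]
  by (simp add: continuous_at_imp_continuous_on)

lemma DERIV_along_line:
  assumes "(g has_derivative D) (at (a + t *\<^sub>R v))"
  shows "((\<lambda>t. g (a + t *\<^sub>R v) \<bullet> b) has_real_derivative D v \<bullet> b) (at t)"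
proof -
  have "((\<lambda>t. a + t *\<^sub>R v) has_derivative (\<lambda>s. s *\<^sub>R v)) (at t)"
    by (auto intro!: derivative_eq_intros)
  from has_derivative_compose[OF this assms]
  have "((\<lambda>t. g (a + t *\<^sub>R v) \<bullet> b) has_derivative (\<lambda>s. D (s *\<^sub>R v) \<bullet> b)) (at t)"
    by (intro has_derivative_inner_left) auto
  moreover have "(\<lambda>s. D (s *\<^sub>R v) \<bullet> b) = (\<lambda>s. (D v \<bullet> b) * s)"
    using has_derivative_linear[OF assms] by (auto simp: linear_scale)
  ultimately show ?thesis by (simp add: has_field_derivative_def)
qed

text \<open>The mean value theorem is used twice, first along \<open>v\<close> for the difference of
  two parallel edges, then along \<open>w\<close>. It is scalar, so everything is tested against
  \<open>b\<close>.\<close>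

lemma second_difference_mean_value:
  assumes g: "Ck_on (Suc (Suc k)) g S" and S: "open S" and d: "d > 0"
    and sub: "\<And>s t. 0 \<le> s \<Longrightarrow> s \<le> d \<Longrightarrow> 0 \<le> t \<Longrightarrow> t \<le> d \<Longrightarrow> x + s *\<^sub>R v + t *\<^sub>R w \<in> S"
  obtains \<xi> \<eta> where "0 < \<xi>" "\<xi> < d" "0 < \<eta>" "\<eta> < d"
    "(g (x + d *\<^sub>R v + d *\<^sub>R w) - g (x + d *\<^sub>R v) - g (x + d *\<^sub>R w) + g x) \<bullet> b
      = d * d * (pd w (pd v g) (x + \<xi> *\<^sub>R v + \<eta> *\<^sub>R w) \<bullet> b)"
proof -
  define \<phi> where "\<phi> s = g ((x + d *\<^sub>R w) + s *\<^sub>R v) \<bullet> b - g (x + s *\<^sub>R v) \<bullet> b" for s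
  have in1: "(x + d *\<^sub>R w) + s *\<^sub>R v \<in> S" "x + s *\<^sub>R v \<in> S" if "0 \<le> s" "s \<le> d" for s
    using sub[OF that, of d] sub[OF that, of 0] d by (simp_all add: algebra_simps)
  have "(\<phi> has_real_derivative (pd v g ((x + d *\<^sub>R w) + s *\<^sub>R v) \<bullet> b - pd v g (x + s *\<^sub>R v) \<bullet> b)) (at s)"
    if "0 \<le> s" "s \<le> d" for s
    unfolding \<phi>_def using in1[OF that]
    by (intro DERIV_diff DERIV_along_line has_derivative_pd[OF g])
  then obtain \<xi> where \<xi>: "0 < \<xi>" "\<xi> < d"
    "\<phi> d - \<phi> 0 = (d - 0) * (pd v g ((x + d *\<^sub>R w) + \<xi> *\<^sub>R v) \<bullet> b - pd v g (x + \<xi> *\<^sub>R v) \<bullet> b)"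
    using MVT2[of 0 d \<phi> "\<lambda>s. pd v g ((x + d *\<^sub>R w) + s *\<^sub>R v) \<bullet> b - pd v g (x + s *\<^sub>R v) \<bullet> b"] d by blast
  have "((\<lambda>t. pd v g ((x + \<xi> *\<^sub>R v) + t *\<^sub>R w) \<bullet> b) has_real_derivative
      pd w (pd v g) ((x + \<xi> *\<^sub>R v) + t *\<^sub>R w) \<bullet> b) (at t)" if "0 \<le> t" "t \<le> d" for t
    using sub[of \<xi> t] \<xi> that by (intro DERIV_along_line has_derivative_pd_pd[OF g S]) simp
  then obtain \<eta> where \<eta>: "0 < \<eta>" "\<eta> < d"
    "pd v g ((x + \<xi> *\<^sub>R v) + d *\<^sub>R w) \<bullet> b - pd v g ((x + \<xi> *\<^sub>R v) + 0 *\<^sub>R w) \<bullet> b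
      = (d - 0) * (pd w (pd v g) ((x + \<xi> *\<^sub>R v) + \<eta> *\<^sub>R w) \<bullet> b)"
    using MVT2[of 0 d "\<lambda>t. pd v g ((x + \<xi> *\<^sub>R v) + t *\<^sub>R w) \<bullet> b"
      "\<lambda>t. pd w (pd v g) ((x + \<xi> *\<^sub>R v) + t *\<^sub>R w) \<bullet> b"] d by blast
  have eq: "(x + d *\<^sub>R w) + \<xi> *\<^sub>R v = (x + \<xi> *\<^sub>R v) + d *\<^sub>R w" by simp
  have "\<phi> d - \<phi> 0 = d * d * (pd w (pd v g) (x + \<xi> *\<^sub>R v + \<eta> *\<^sub>R w) \<bullet> b)"
    using \<xi>(3) \<eta>(3) unfolding eq by simp
  moreover have "g (x + d *\<^sub>R w + d *\<^sub>R v) = g (x + d *\<^sub>R v + d *\<^sub>R w)" by (simp add: add_ac)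
  then have "\<phi> d - \<phi> 0 = (g (x + d *\<^sub>R v + d *\<^sub>R w) - g (x + d *\<^sub>R v) - g (x + d *\<^sub>R w) + g x) \<bullet> b"
    by (simp add: \<phi>_def inner_diff_left inner_add_left)
  ultimately show ?thesis using that[OF \<xi>(1,2) \<eta>(1,2)] by simp
qed

text \<open>The second difference is symmetric in \<open>v\<close> and \<open>w\<close>, so the two
  mixed derivatives agree at two nearby points. Continuity moves both points to
  \<open>x\<close>.\<close>

lemma pd_pd_commute:
  assumes g: "Ck_on (Suc (Suc k)) g S" and S: "open S" "x \<in> S"
  shows "pd w (pd v g) x = pd v (pd w g) x"
proof (rule euclidean_eqI)
  fix b :: 'b assume "b \<in> Basis"
  show "pd w (pd v g) x \<bullet> b = pd v (pd w g) x \<bullet> b"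
  proof (rule ccontr)
    assume ne: "pd w (pd v g) x \<bullet> b \<noteq> pd v (pd w g) x \<bullet> b"
    \<comment> \<open>With half of the gap as tolerance, values near the two different limits cannot
      coincide.\<close>
    define e where "e = \<bar>pd w (pd v g) x \<bullet> b - pd v (pd w g) x \<bullet> b\<bar> / 2"
    have e: "e > 0" using ne by (simp add: e_def)
    have near: "\<exists>\<delta>>0. \<forall>y. dist y x < \<delta> \<longrightarrow> \<bar>pd w (pd v g) y \<bullet> b - pd w (pd v g) x \<bullet> b\<bar> < e" for v w
    proof -
      have "continuous_on S (\<lambda>y. pd w (pd v g) y \<bullet> b)"
        by (intro continuous_intros continuous_on_pd_pd[OF g S(1)])
      then have "isCont (\<lambda>y. pd w (pd v g) y \<bullet> b) x"
        using S by (simp add: continuous_on_eq_continuous_at)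
      then show ?thesis using e unfolding continuous_at_eps_delta dist_real_def by blast
    qed
    obtain \<delta>1 where \<delta>1: "\<delta>1 > 0" "\<And>y. dist y x < \<delta>1 \<Longrightarrow> \<bar>pd w (pd v g) y \<bullet> b - pd w (pd v g) x \<bullet> b\<bar> < e"
      using near[of w v] by blast
    obtain \<delta>2 where \<delta>2: "\<delta>2 > 0" "\<And>y. dist y x < \<delta>2 \<Longrightarrow> \<bar>pd v (pd w g) y \<bullet> b - pd v (pd w g) x \<bullet> b\<bar> < e"
      using near[of v w] by blast
    obtain \<delta>3 where \<delta>3: "\<delta>3 > 0" "ball x \<delta>3 \<subseteq> S" using S open_contains_ball by blast
    define \<delta> where "\<delta> = min \<delta>1 (min \<delta>2 \<delta>3)"
    have \<delta>: "\<delta> > 0" using \<delta>1 \<delta>2 \<delta>3 by (simp add: \<delta>_def)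
    define d where "d = \<delta> / (2 * (norm v + norm w + 1))"
    have nvw: "norm v + norm w + 1 > 0" by (simp add: add_nonneg_pos)
    have d: "d > 0" using \<delta> nvw by (simp add: d_def)
    have dist: "dist (x + s *\<^sub>R v + t *\<^sub>R w) x < \<delta>" if "0 \<le> s" "s \<le> d" "0 \<le> t" "t \<le> d" for s t
    proof -
      have "dist (x + s *\<^sub>R v + t *\<^sub>R w) x \<le> s * norm v + t * norm w"
        using that norm_triangle_ineq[of "s *\<^sub>R v" "t *\<^sub>R w"] by (simp add: dist_norm algebra_simps)
      also have "\<dots> \<le> d * norm v + d * norm w"
        using that by (intro add_mono mult_right_mono) auto
      also have "\<dots> \<le> d * (norm v + norm w + 1)" using d by (simp add: algebra_simps)
      also have "\<dots> = \<delta> / 2" using nvw by (simp add: d_def field_simps)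
      finally show ?thesis using \<delta> by linarith
    qed
    have sub: "x + s *\<^sub>R v + t *\<^sub>R w \<in> S" if "0 \<le> s" "s \<le> d" "0 \<le> t" "t \<le> d" for s t
      using dist[OF that] \<delta>3(2) by (auto simp: \<delta>_def dist_commute)
    obtain \<xi> \<eta> where 1: "0 < \<xi>" "\<xi> < d" "0 < \<eta>" "\<eta> < d"
      "(g (x + d *\<^sub>R v + d *\<^sub>R w) - g (x + d *\<^sub>R v) - g (x + d *\<^sub>R w) + g x) \<bullet> b
        = d * d * (pd w (pd v g) (x + \<xi> *\<^sub>R v + \<eta> *\<^sub>R w) \<bullet> b)"
      using second_difference_mean_value[OF g S(1) d sub, of b] by blast
    have sub': "x + s *\<^sub>R w + t *\<^sub>R v \<in> S" if "0 \<le> s" "s \<le> d" "0 \<le> t" "t \<le> d" for s t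
      using sub[of t s] that by (simp add: algebra_simps)
    obtain \<xi>' \<eta>' where 2: "0 < \<xi>'" "\<xi>' < d" "0 < \<eta>'" "\<eta>' < d"
      "(g (x + d *\<^sub>R w + d *\<^sub>R v) - g (x + d *\<^sub>R w) - g (x + d *\<^sub>R v) + g x) \<bullet> b
        = d * d * (pd v (pd w g) (x + \<xi>' *\<^sub>R w + \<eta>' *\<^sub>R v) \<bullet> b)"
      using second_difference_mean_value[OF g S(1) d sub', of b] by blast
    have "g (x + d *\<^sub>R w + d *\<^sub>R v) = g (x + d *\<^sub>R v + d *\<^sub>R w)"
      "pd v (pd w g) (x + \<xi>' *\<^sub>R w + \<eta>' *\<^sub>R v) = pd v (pd w g) (x + \<eta>' *\<^sub>R v + \<xi>' *\<^sub>R w)"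
      by (simp_all add: add_ac)
    then have "d * d * (pd w (pd v g) (x + \<xi> *\<^sub>R v + \<eta> *\<^sub>R w) \<bullet> b) = d * d * (pd v (pd w g) (x + \<eta>' *\<^sub>R v + \<xi>' *\<^sub>R w) \<bullet> b)"
      using 1(5) 2(5) by (simp only: inner_diff_left inner_add_left)
    then have "pd w (pd v g) (x + \<xi> *\<^sub>R v + \<eta> *\<^sub>R w) \<bullet> b = pd v (pd w g) (x + \<eta>' *\<^sub>R v + \<xi>' *\<^sub>R w) \<bullet> b"
      using d by simp
    moreover have "\<bar>pd w (pd v g) (x + \<xi> *\<^sub>R v + \<eta> *\<^sub>R w) \<bullet> b - pd w (pd v g) x \<bullet> b\<bar> < e"
      using 1 dist[of \<xi> \<eta>] by (intro \<delta>1(2)) (simp add: \<delta>_def)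
    moreover have "\<bar>pd v (pd w g) (x + \<eta>' *\<^sub>R v + \<xi>' *\<^sub>R w) \<bullet> b - pd v (pd w g) x \<bullet> b\<bar> < e"
      using 2 dist[of \<eta>' \<xi>'] by (intro \<delta>2(2)) (simp add: \<delta>_def)
    moreover have False if "A = B" "\<bar>A - a\<bar> < \<bar>a - c\<bar> / 2" "\<bar>B - c\<bar> < \<bar>a - c\<bar> / 2" for A B a c :: real
      using that by (auto simp: abs_if split: if_splits)
    ultimately show False unfolding e_def by blast
  qed
qed

text \<open>If \<open>c\<close> were positive, \<open>k'\<close> would be positive immediately to
  the right of 0, and \<open>k\<close> would exceed its maximum there. Only differentiability of
  \<open>k'\<close> at 0 enters.\<close>

lemma local_max_second_derivative:
  fixes k k' :: "real \<Rightarrow> real"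
  assumes \<delta>: "\<delta> > 0" and k: "\<And>t. \<bar>t\<bar> < \<delta> \<Longrightarrow> (k has_real_derivative k' t) (at t)"
    and k': "(k' has_real_derivative c) (at 0)" and max: "\<And>t. \<bar>t\<bar> < \<delta> \<Longrightarrow> k t \<le> k 0"
  shows "k' 0 = 0" "c \<le> 0"
proof -
  show k0: "k' 0 = 0"
    using DERIV_local_max[OF k[of 0] \<delta>] max \<delta> by auto
  show "c \<le> 0"
  proof (rule ccontr)
    assume "\<not> c \<le> 0"
    then obtain d where d: "d > 0" "\<And>h. h > 0 \<Longrightarrow> h < d \<Longrightarrow> k' 0 < k' (0 + h)"
      using DERIV_pos_inc_right[OF k'] by auto
    define h where "h = min d \<delta> / 2"
    have h: "0 < h" "h < d" "h < \<delta>" using d \<delta> by (auto simp: h_def)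
    obtain z where z: "0 < z" "z < h" "k h - k 0 = (h - 0) * k' z"
      using MVT2[of 0 h k k'] k h by fastforce
    then have "k h - k 0 > 0" using d(2)[of z] h k0 by simp
    then show False using max[of h] h by simp
  qed
qed

section \<open>A maximum principle for flat surfaces\<close>

text \<open>Cramer's rule; \<open>D\<close> is the determinant of \<open>X\<close> and
  \<open>Y\<close>.\<close>

lemma real2_coords:
  fixes X Y Z :: "real^2"
  assumes "X \<noteq> 0" "\<And>c. Y \<noteq> c *\<^sub>R X"
  obtains \<alpha> \<beta> where "Z = \<alpha> *\<^sub>R X + \<beta> *\<^sub>R Y"
proof -
  define D where "D = X $ 1 * Y $ 2 - X $ 2 * Y $ 1"
  have "D \<noteq> 0"
  proof
    assume "D = 0"
    consider "X $ 1 \<noteq> 0" | "X $ 2 \<noteq> 0" using assms(1) by (auto simp: vec_eq_iff forall_2)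
    then show False
    proof cases
      case 1
      then have "Y = (Y $ 1 / X $ 1) *\<^sub>R X"
        using \<open>D = 0\<close> by (simp add: vec_eq_iff forall_2 D_def field_simps)
      then show False using assms(2) by blast
    next
      case 2
      then have "Y = (Y $ 2 / X $ 2) *\<^sub>R X"
        using \<open>D = 0\<close> by (simp add: vec_eq_iff forall_2 D_def field_simps)
      then show False using assms(2) by blast
    qed
  qed
  then have "Z = ((Z $ 1 * Y $ 2 - Z $ 2 * Y $ 1) / D) *\<^sub>R X + ((X $ 1 * Z $ 2 - X $ 2 * Z $ 1) / D) *\<^sub>R Y"
    by (simp add: vec_eq_iff forall_2 divide_simps) (simp add: D_def algebra_simps)
  then show ?thesis using that by blast
qed

lemma tangent_plane_range:
  fixes L :: "real^2 \<Rightarrow> real^3"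
  assumes L: "linear L" "inj L" and n: "norm n = 1" "\<And>v. n \<bullet> L v = 0" and z: "n \<bullet> z = 0"
  obtains Z where "z = L Z"
proof -
  have "dim (range L) = 2" using L by (simp add: dim_image_eq)
  moreover have "dim {y. n \<bullet> y = 0} = 2"
    using n(1) by (subst dim_hyperplane) auto
  moreover have "range L \<subseteq> {y. n \<bullet> y = 0}" using n(2) by auto
  ultimately have "range L = {y. n \<bullet> y = 0}"
    using L(1) by (intro subspace_dim_equal) (auto simp: linear_subspace_image subspace_hyperplane)
  then show ?thesis using z that by auto
qed

lemma unit_normal_unique:
  fixes L :: "real^2 \<Rightarrow> real^3"
  assumes L: "linear L" "inj L" and n: "norm n = 1" "\<And>v. n \<bullet> L v = 0" and m: "norm m = 1" "\<And>v. m \<bullet> L v = 0"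
  shows "m = n \<or> m = - n"
proof -
  define z where "z = m - (m \<bullet> n) *\<^sub>R n"
  have nn: "n \<bullet> n = 1" "m \<bullet> m = 1" using n(1) m(1) by (simp_all add: dot_square_norm)
  have "n \<bullet> z = 0" using nn by (simp add: z_def inner_diff_right inner_commute)
  then obtain Z where Z: "z = L Z" using tangent_plane_range[OF L n] by blast
  have "z \<bullet> z = 0"
  proof -
    have "z \<bullet> z = m \<bullet> z - (m \<bullet> n) * (n \<bullet> z)"
      by (subst (1) z_def) (simp add: inner_diff_left)
    then show ?thesis using m(2)[of Z] n(2)[of Z] Z by simp
  qed
  then have "m = (m \<bullet> n) *\<^sub>R n" by (simp add: z_def)
  moreover from arg_cong[OF this, of norm] have "\<bar>m \<bullet> n\<bar> = 1" using n(1) m(1) by simp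
  then have "m \<bullet> n = 1 \<or> m \<bullet> n = -1" by linarith
  ultimately show ?thesis by auto
qed

text \<open>This turns "rank below two" into an equation, which can be differentiated and passed to
  a limit.\<close>

lemma cross3_rank_one:
  fixes L :: "real^2 \<Rightarrow> real^3"
  assumes L: "linear L" and v: "v \<noteq> 0" "L v = 0"
  shows "cross3 (L X) (L Y) = 0"
proof (cases "\<exists>c. X = c *\<^sub>R v")
  case True
  then show ?thesis using v L by (auto simp: linear_scale)
next
  case False
  then obtain \<alpha> \<beta> where "Y = \<alpha> *\<^sub>R v + \<beta> *\<^sub>R X" using real2_coords[OF v(1)] by metis
  then have "L Y = \<beta> *\<^sub>R L X" using L v by (simp add: linear_add linear_scale)
  then show ?thesis by (simp add: cross_mult_right)
qed

lemma cross3_eq_0_parallel: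
  assumes "cross3 a b = 0" "b \<noteq> 0"
  obtains c where "a = c *\<^sub>R b"
proof -
  have "collinear {0, b, a}" using assms(1) cross_eq_0[of a b] by (simp add: insert_commute)
  then have "a = 0 \<or> (\<exists>c. a = c *\<^sub>R b)" using assms(2) by (simp add: collinear_lemma)
  then show ?thesis using that[of 0] that by auto
qed

text \<open>All five come from differentiating the unit length of \<nu> and its orthogonality to dF.
  They are: tangency of d\<nu>, the second fundamental form in terms of d\<nu>, its symmetry, and
  the derivatives of the symmetry and of the tangency. Differentiating the symmetry, and not the
  form itself, avoids third derivatives of \<open>F\<close>.\<close>

lemma flat_gauss_map_identities:
  fixes F \<nu> :: "real^2 \<Rightarrow> real^3"
  assumes \<Omega>: "open \<Omega>" "x \<in> \<Omega>" and F: "Ck_on (Suc (Suc 0)) F \<Omega>" and \<nu>: "Ck_on (Suc (Suc 0)) \<nu> \<Omega>"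
    and tang: "\<And>x v. x \<in> \<Omega> \<Longrightarrow> \<nu> x \<bullet> pd v F x = 0" and unit: "\<And>x. x \<in> \<Omega> \<Longrightarrow> norm (\<nu> x) = 1"
  shows "\<nu> x \<bullet> pd X \<nu> x = 0"
    and "pd X \<nu> x \<bullet> pd Y F x + \<nu> x \<bullet> pd X (pd Y F) x = 0"
    and "pd X \<nu> x \<bullet> pd Y F x = pd Y \<nu> x \<bullet> pd X F x"
    and "pd Z (pd X \<nu>) x \<bullet> pd Y F x + pd X \<nu> x \<bullet> pd Z (pd Y F) x =
      pd Z (pd Y \<nu>) x \<bullet> pd X F x + pd Y \<nu> x \<bullet> pd Z (pd X F) x"
    and "\<nu> x \<bullet> pd X (pd Y \<nu>) x + pd X \<nu> x \<bullet> pd Y \<nu> x = 0"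
proof -
  have D0: "k x = 0 \<and> k' v = 0"
    if "(k has_derivative k') (at x)" "\<And>y. y \<in> \<Omega> \<Longrightarrow> k y = c" "c = 0" "x \<in> \<Omega>" for k :: "real^2 \<Rightarrow> real" and k' c x v
  proof -
    have "((\<lambda>_. c) has_derivative k') (at x)"
      using has_derivative_transform_within_open[OF that(1) \<Omega>(1) that(4)] that(2) by metis
    then have "k' = (\<lambda>_. 0)" using has_derivative_unique has_derivative_const by blast
    then show ?thesis using that by simp
  qed
  note dF = has_derivative_pd[OF F] and d\<nu> = has_derivative_pd[OF \<nu>]
  note ddF = has_derivative_pd_pd[OF F \<Omega>(1)] and dd\<nu> = has_derivative_pd_pd[OF \<nu> \<Omega>(1)]
  have 1: "\<nu> x \<bullet> pd X \<nu> x = 0" if "x \<in> \<Omega>" for x X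
  proof -
    have "((\<lambda>x. \<nu> x \<bullet> \<nu> x - 1) has_derivative (\<lambda>v. \<nu> x \<bullet> pd v \<nu> x + pd v \<nu> x \<bullet> \<nu> x)) (at x)"
      using d\<nu>[OF that] by (auto intro!: derivative_eq_intros)
    from D0[OF this, of 0 X] that unit show ?thesis by (simp add: inner_commute dot_square_norm)
  qed
  then show "\<nu> x \<bullet> pd X \<nu> x = 0" using \<Omega> by blast
  have 2: "pd X \<nu> x \<bullet> pd Y F x + \<nu> x \<bullet> pd X (pd Y F) x = 0" if "x \<in> \<Omega>" for x X Y
  proof -
    have "((\<lambda>x. \<nu> x \<bullet> pd Y F x) has_derivative (\<lambda>v. \<nu> x \<bullet> pd v (pd Y F) x + pd v \<nu> x \<bullet> pd Y F x)) (at x)"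
      using d\<nu>[OF that] ddF[OF that] by (auto intro!: derivative_eq_intros)
    from D0[OF this, of 0 X] that tang show ?thesis by simp
  qed
  then show "pd X \<nu> x \<bullet> pd Y F x + \<nu> x \<bullet> pd X (pd Y F) x = 0" using \<Omega> by blast
  have 3: "pd X \<nu> x \<bullet> pd Y F x = pd Y \<nu> x \<bullet> pd X F x" if "x \<in> \<Omega>" for x X Y
    using 2[OF that, of X Y] 2[OF that, of Y X] pd_pd_commute[OF F \<Omega>(1) that, of X Y] by simp
  then show "pd X \<nu> x \<bullet> pd Y F x = pd Y \<nu> x \<bullet> pd X F x" using \<Omega> by blast
  have "((\<lambda>x. pd X \<nu> x \<bullet> pd Y F x - pd Y \<nu> x \<bullet> pd X F x) has_derivative
     (\<lambda>v. (pd X \<nu> x \<bullet> pd v (pd Y F) x + pd v (pd X \<nu>) x \<bullet> pd Y F x) -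
        (pd Y \<nu> x \<bullet> pd v (pd X F) x + pd v (pd Y \<nu>) x \<bullet> pd X F x))) (at x)"
    using dd\<nu>[OF \<Omega>(2)] ddF[OF \<Omega>(2)] by (auto intro!: derivative_eq_intros)
  from D0[OF this, of 0 Z] \<Omega> 3 show "pd Z (pd X \<nu>) x \<bullet> pd Y F x + pd X \<nu> x \<bullet> pd Z (pd Y F) x =
      pd Z (pd Y \<nu>) x \<bullet> pd X F x + pd Y \<nu> x \<bullet> pd Z (pd X F) x" by simp
  have "((\<lambda>x. \<nu> x \<bullet> pd Y \<nu> x) has_derivative (\<lambda>v. \<nu> x \<bullet> pd v (pd Y \<nu>) x + pd v \<nu> x \<bullet> pd Y \<nu> x)) (at x)"
    using d\<nu>[OF \<Omega>(2)] dd\<nu>[OF \<Omega>(2)] by (auto intro!: derivative_eq_intros)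
  from D0[OF this, of 0 X] \<Omega> 1 show "\<nu> x \<bullet> pd X (pd Y \<nu>) x + pd X \<nu> x \<bullet> pd Y \<nu> x = 0" by simp
qed

text \<open>As \<nu> is orthogonal to dF, the derivative of a height above the tangent plane is
  d\<nu> paired with the difference vector. By the product rule each difference vector is weighted
  with the other height. In directions in the kernel of d\<nu>, all products of first derivatives of
  heights drop out of the second derivative.\<close>

lemma two_point_height_derivatives:
  fixes F \<nu> :: "real^2 \<Rightarrow> real^3" and \<epsilon> :: real
  assumes \<Omega>: "open \<Omega>" "x \<in> \<Omega>" and F: "Ck_on (Suc (Suc 0)) F \<Omega>" and \<nu>: "Ck_on (Suc (Suc 0)) \<nu> \<Omega>"
    and tang: "\<And>x v. x \<in> \<Omega> \<Longrightarrow> \<nu> x \<bullet> pd v F x = 0"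
    and max: "\<And>y. y \<in> \<Omega> \<Longrightarrow> (\<nu> y \<bullet> (a - F y)) * (\<nu> y \<bullet> (F y - b)) + \<epsilon> * (F y \<bullet> F y) \<le>
        (\<nu> x \<bullet> (a - F x)) * (\<nu> x \<bullet> (F x - b)) + \<epsilon> * (F x \<bullet> F x)"
  shows "pd X \<nu> x \<bullet> ((\<nu> x \<bullet> (F x - b)) *\<^sub>R (a - F x) + (\<nu> x \<bullet> (a - F x)) *\<^sub>R (F x - b)) + 2 * \<epsilon> * (F x \<bullet> pd X F x) = 0"
    (is ?first)
    and "pd X \<nu> x = 0 \<Longrightarrow>
      pd X (pd X \<nu>) x \<bullet> ((\<nu> x \<bullet> (F x - b)) *\<^sub>R (a - F x) + (\<nu> x \<bullet> (a - F x)) *\<^sub>R (F x - b))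
       + 2 * \<epsilon> * (F x \<bullet> pd X (pd X F) x + pd X F x \<bullet> pd X F x) \<le> 0"
    (is "_ \<Longrightarrow> ?second \<le> 0")
proof -
  obtain \<rho> where \<rho>: "\<rho> > 0" "ball x \<rho> \<subseteq> \<Omega>" using \<Omega> open_contains_ball by blast
  define \<delta> where "\<delta> = \<rho> / (norm X + 1)"
  have nX: "norm X + 1 > 0" by (simp add: add_nonneg_pos)
  have \<delta>: "\<delta> > 0" using \<rho> nX by (simp add: \<delta>_def)
  have line: "x + t *\<^sub>R X \<in> \<Omega>" if "\<bar>t\<bar> < \<delta>" for t
  proof -
    have "\<bar>t\<bar> * norm X \<le> \<bar>t\<bar> * (norm X + 1)" by (simp add: algebra_simps)
    also have "\<dots> < \<delta> * (norm X + 1)" using that nX by (intro mult_strict_right_mono)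
    also have "\<dots> = \<rho>" using nX by (simp add: \<delta>_def)
    finally show ?thesis using \<rho>(2) by (auto simp: dist_norm)
  qed
  define F0 F1 F2 N0 N1 N2 where "F0 t = F (x + t *\<^sub>R X)" and "F1 t = pd X F (x + t *\<^sub>R X)"
    and "F2 t = pd X (pd X F) (x + t *\<^sub>R X)" and "N0 t = \<nu> (x + t *\<^sub>R X)" and "N1 t = pd X \<nu> (x + t *\<^sub>R X)"
    and "N2 t = pd X (pd X \<nu>) (x + t *\<^sub>R X)" for t
  have lineD: "((\<lambda>t. g (x + t *\<^sub>R X)) has_vector_derivative D X) (at t)"
    if "(g has_derivative D) (at (x + t *\<^sub>R X))" for g :: "real^2 \<Rightarrow> real^3" and D t
  proof -
    have "((\<lambda>t. x + t *\<^sub>R X) has_derivative (\<lambda>s. s *\<^sub>R X)) (at t)"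
      by (auto intro!: derivative_eq_intros)
    from has_derivative_compose[OF this that] show ?thesis
      using has_derivative_linear[OF that] by (simp add: has_vector_derivative_def linear_scale)
  qed
  have D: "(F0 has_vector_derivative F1 t) (at t)" "(F1 has_vector_derivative F2 t) (at t)"
    "(N0 has_vector_derivative N1 t) (at t)" "(N1 has_vector_derivative N2 t) (at t)" if "\<bar>t\<bar> < \<delta>" for t
    unfolding F0_def[abs_def] F1_def[abs_def] F2_def N0_def[abs_def] N1_def[abs_def] N2_def using line[OF that]
    by (rule lineD[OF has_derivative_pd[OF F]] lineD[OF has_derivative_pd[OF \<nu>]]
        lineD[OF has_derivative_pd_pd[OF F \<Omega>(1)]] lineD[OF has_derivative_pd_pd[OF \<nu> \<Omega>(1)]]; assumption)+
  have NF: "N0 t \<bullet> F1 t = 0" if "\<bar>t\<bar> < \<delta>" for t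
    using tang[OF line[OF that]] by (simp add: N0_def F1_def)
  have inner_D: "((\<lambda>t. p t \<bullet> q t) has_real_derivative (p t \<bullet> q' + p' \<bullet> q t)) (at t)"
    if "(p has_vector_derivative p') (at t)" "(q has_vector_derivative q') (at t)" for p q :: "real \<Rightarrow> real^3" and p' q' t
  proof -
    have "(*) (p t \<bullet> q' + p' \<bullet> q t) = (\<lambda>h. p t \<bullet> (h *\<^sub>R q') + (h *\<^sub>R p') \<bullet> q t)"
      by (auto simp: algebra_simps)
    then show ?thesis
      using has_derivative_inner[OF that[unfolded has_vector_derivative_def]]
      by (simp only: has_field_derivative_def)
  qed
  define s1 s2 where "s1 t = N0 t \<bullet> (a - F0 t)" and "s2 t = N0 t \<bullet> (F0 t - b)" for t
  have s1: "(s1 has_real_derivative N1 t \<bullet> (a - F0 t)) (at t)" if "\<bar>t\<bar> < \<delta>" for t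
    unfolding s1_def[abs_def]
    by (rule DERIV_cong[OF inner_D[OF D(3)[OF that] has_vector_derivative_diff[OF has_vector_derivative_const D(1)[OF that]]]])
       (simp add: NF[OF that])
  have s2: "(s2 has_real_derivative N1 t \<bullet> (F0 t - b)) (at t)" if "\<bar>t\<bar> < \<delta>" for t
    unfolding s2_def[abs_def]
    by (rule DERIV_cong[OF inner_D[OF D(3)[OF that] has_vector_derivative_diff[OF D(1)[OF that] has_vector_derivative_const]]])
       (simp add: NF[OF that])
  have s1': "((\<lambda>t. N1 t \<bullet> (a - F0 t)) has_real_derivative N2 t \<bullet> (a - F0 t) - N1 t \<bullet> F1 t) (at t)" if "\<bar>t\<bar> < \<delta>" for t
    by (rule DERIV_cong[OF inner_D[OF D(4)[OF that] has_vector_derivative_diff[OF has_vector_derivative_const D(1)[OF that]]]]) simp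
  have s2': "((\<lambda>t. N1 t \<bullet> (F0 t - b)) has_real_derivative N2 t \<bullet> (F0 t - b) + N1 t \<bullet> F1 t) (at t)" if "\<bar>t\<bar> < \<delta>" for t
    by (rule DERIV_cong[OF inner_D[OF D(4)[OF that] has_vector_derivative_diff[OF D(1)[OF that] has_vector_derivative_const]]]) simp
  define k where "k t = s1 t * s2 t + \<epsilon> * (F0 t \<bullet> F0 t)" for t
  define k' where "k' t = s1 t * (N1 t \<bullet> (F0 t - b)) + (N1 t \<bullet> (a - F0 t)) * s2 t + \<epsilon> * (F0 t \<bullet> F1 t + F1 t \<bullet> F0 t)" for t
  define k'' where "k'' = (s1 0 * (N2 0 \<bullet> (F0 0 - b) + N1 0 \<bullet> F1 0) + (N1 0 \<bullet> (a - F0 0)) * (N1 0 \<bullet> (F0 0 - b)))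
     + ((N1 0 \<bullet> (a - F0 0)) * (N1 0 \<bullet> (F0 0 - b)) + (N2 0 \<bullet> (a - F0 0) - N1 0 \<bullet> F1 0) * s2 0)
     + \<epsilon> * ((F0 0 \<bullet> F2 0 + F1 0 \<bullet> F1 0) + (F1 0 \<bullet> F1 0 + F2 0 \<bullet> F0 0))"
  have kD: "(k has_real_derivative k' t) (at t)" if "\<bar>t\<bar> < \<delta>" for t
    unfolding k_def[abs_def] k'_def
    by (rule derivative_eq_intros s1[OF that] s2[OF that] inner_D D[OF that] refl | simp add: algebra_simps)+
  have z: "\<bar>0::real\<bar> < \<delta>" using \<delta> by simp
  have k'D: "(k' has_real_derivative k'') (at 0)"
    unfolding k''_def k'_def[abs_def]
    by (rule DERIV_cong[OF DERIV_add[OF DERIV_add[OF DERIV_mult[OF s1[OF z] s2'[OF z]] DERIV_mult[OF s1'[OF z] s2[OF z]]]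
        DERIV_cmult[OF DERIV_add[OF inner_D[OF D(1)[OF z] D(2)[OF z]] inner_D[OF D(2)[OF z] D(1)[OF z]]], of \<epsilon>]]])
       (simp add: algebra_simps)
  have max': "k t \<le> k 0" if "\<bar>t\<bar> < \<delta>" for t
    using max[OF line[OF that]] by (simp add: k_def s1_def s2_def N0_def F0_def)
  note test = local_max_second_derivative[OF \<delta> kD k'D max']
  have e0: "N \<bullet> (c *\<^sub>R u + d *\<^sub>R v) = c * (N \<bullet> u) + d * (N \<bullet> v)" for N u v :: "real^3" and c d
    by (simp add: inner_add_right)
  show ?first
    using test(1) unfolding e0 by (simp add: k'_def s1_def s2_def N0_def N1_def F0_def F1_def inner_commute[of _ "F x"] mult.commute)
  show "?second \<le> 0" if "pd X \<nu> x = 0"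
    using test(2) that unfolding e0 by (simp add: k''_def s1_def s2_def N0_def N1_def N2_def F0_def F1_def F2_def
        inner_commute[of _ "F x"] mult.commute distrib_left)
qed

lemma cross3_bilinear: "bounded_bilinear cross3"
  using bilinear_cross bilinear_conv_bounded_bilinear by blast

lemma has_vector_derivative_difference_quotient:
  fixes g :: "real \<Rightarrow> 'b::real_normed_vector"
  assumes "(g has_vector_derivative d) (at 0)"
  shows "((\<lambda>t. (1 / t) *\<^sub>R (g t - g 0)) \<longlongrightarrow> d) (at 0)"
proof -
  have "((\<lambda>t. norm (g t - g 0 - t *\<^sub>R d) / norm t) \<longlongrightarrow> 0) (at 0)"
    using assms by (simp add: has_vector_derivative_def has_derivative_iff_norm)
  moreover have "norm (g t - g 0 - t *\<^sub>R d) / norm t = norm ((1 / t) *\<^sub>R (g t - g 0) - d)" if "t \<noteq> 0" for t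
  proof -
    have "g t - g 0 - t *\<^sub>R d = t *\<^sub>R ((1 / t) *\<^sub>R (g t - g 0) - d)"
      using that by (simp add: scaleR_diff_right)
    then have "norm (g t - g 0 - t *\<^sub>R d) = \<bar>t\<bar> * norm ((1 / t) *\<^sub>R (g t - g 0) - d)"
      by (simp only: norm_scaleR)
    then show ?thesis using that by simp
  qed
  ultimately have "((\<lambda>t. norm ((1 / t) *\<^sub>R (g t - g 0) - d)) \<longlongrightarrow> 0) (at 0)"
    by (elim Lim_transform_within[OF _ zero_less_one]) auto
  then show ?thesis using LIM_zero_iff tendsto_norm_zero_iff by blast
qed

text \<open>The second derivative test in a suitable direction \<open>X\<close> of the kernel of \<open>d\<nu>\<close>.  If \<open>d\<nu>\<close> has rank one at \<open>x\<close>,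
  flatness gives \<open>d\<nu>(Z) = D\<^sub>X D\<^sub>X \<nu>\<close> for the \<open>Z\<close> with \<open>dF(Z) = D\<^sub>X D\<^sub>X F\<close>, so by the first order
  condition for \<open>Z\<close> only the term \<open>2 \<epsilon> \<bar>D\<^sub>X F\<bar>\<^sup>2\<close> is left.
  If \<open>d\<nu>\<close> vanishes at \<open>x\<close>, maximality makes \<open>X \<mapsto> D\<^sub>W D\<^sub>X \<nu>\<close> injective for some \<open>W\<close>, so \<open>d\<nu>\<close> would have rank two at
  points \<open>x + t W\<close>.\<close>

lemma flat_no_local_max:
  fixes F \<nu> :: "real^2 \<Rightarrow> real^3" and \<epsilon> :: real
  assumes \<Omega>: "open \<Omega>" "x \<in> \<Omega>" and F: "Ck_on (Suc (Suc 0)) F \<Omega>" and \<nu>: "Ck_on (Suc (Suc 0)) \<nu> \<Omega>"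
    and tang: "\<And>x v. x \<in> \<Omega> \<Longrightarrow> \<nu> x \<bullet> pd v F x = 0" and unit: "\<And>x. x \<in> \<Omega> \<Longrightarrow> norm (\<nu> x) = 1"
    and imm: "inj (\<lambda>v. pd v F x)" and flat: "\<And>x. x \<in> \<Omega> \<Longrightarrow> \<exists>v. v \<noteq> 0 \<and> pd v \<nu> x = 0" and \<epsilon>: "\<epsilon> > 0"
    and max: "\<And>y. y \<in> \<Omega> \<Longrightarrow> (\<nu> y \<bullet> (a - F y)) * (\<nu> y \<bullet> (F y - b)) + \<epsilon> * (F y \<bullet> F y) \<le>
        (\<nu> x \<bullet> (a - F x)) * (\<nu> x \<bullet> (F x - b)) + \<epsilon> * (F x \<bullet> F x)"
  shows False
proof -
  note id = flat_gauss_map_identities[OF \<Omega> F \<nu> tang unit]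
  note der = two_point_height_derivatives[OF \<Omega> F \<nu> tang max]
  \<comment> \<open>The vector with which d\<nu> is paired in both derivative conditions.\<close>
  define w where "w = (\<nu> x \<bullet> (F x - b)) *\<^sub>R (a - F x) + (\<nu> x \<bullet> (a - F x)) *\<^sub>R (F x - b)"
  have linF: "linear (\<lambda>v. pd v F x)" and lin\<nu>: "linear (\<lambda>v. pd v \<nu> x)"
    using linear_pd F \<nu> \<Omega>(2) by blast+
  note add = linear_add[OF linF] linear_add[OF lin\<nu>] linear_scale[OF linF] linear_scale[OF lin\<nu>]
  have lin2: "linear (\<lambda>v. pd v (pd u \<nu>) x)" for u
    using has_derivative_linear[OF has_derivative_pd_pd[OF \<nu> \<Omega>]] .
  have pos: "pd X F x \<bullet> pd X F x > 0" if "X \<noteq> 0" for X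
    using that imm linF linear_injective_0 by (metis inner_gt_zero_iff)
  note range = tangent_plane_range[OF linF imm unit[OF \<Omega>(2)] tang[OF \<Omega>(2)]]
  have cross: "cross3 (pd X \<nu> y) (pd Y \<nu> y) = 0" if "y \<in> \<Omega>" for X Y y
    using flat[OF that] cross3_rank_one[of "\<lambda>v. pd v \<nu> y"] linear_pd[OF \<nu> that] by metis
  \<comment> \<open>In a kernel direction the second fundamental form vanishes, so the second
    derivative of \<open>F\<close> is tangent.\<close>
  have "\<exists>Z. pd X (pd X F) x = pd Z F x" if "pd X \<nu> x = 0" for X
    using id(2)[of X X] that range by (metis add_0 inner_zero_left)
  then obtain Z where Z: "pd X (pd X F) x = pd (Z X) F x" if "pd X \<nu> x = 0" for X by metis
  show False
  proof (cases "\<forall>Y. pd Y \<nu> x = 0")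
    case False
    then obtain Y where Y: "pd Y \<nu> x \<noteq> 0" by blast
    obtain X where X: "X \<noteq> 0" "pd X \<nu> x = 0" using flat \<Omega>(2) by blast
    have nY: "Y \<noteq> c *\<^sub>R X" for c using Y X(2) by (auto simp: add)
    \<comment> \<open>Flatness in differentiated form: at \<open>x\<close> one term of the
      derivative of the cross product contains d\<nu>(X) = 0, and the other term says that D_V D_X
      \<nu> is parallel to d\<nu>(Y).\<close>
    have D: "\<exists>c. pd V (pd X \<nu>) x = c *\<^sub>R pd Y \<nu> x" for V
    proof -
      have "((\<lambda>y. cross3 (pd X \<nu> y) (pd Y \<nu> y)) has_derivative
          (\<lambda>v. cross3 (pd X \<nu> x) (pd v (pd Y \<nu>) x) + cross3 (pd v (pd X \<nu>) x) (pd Y \<nu> x))) (at x)"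
        by (intro bounded_bilinear.FDERIV[OF cross3_bilinear] has_derivative_pd_pd[OF \<nu> \<Omega>])
      then have "((\<lambda>y. 0) has_derivative
          (\<lambda>v. cross3 (pd X \<nu> x) (pd v (pd Y \<nu>) x) + cross3 (pd v (pd X \<nu>) x) (pd Y \<nu> x))) (at x)"
        by (rule has_derivative_transform_within_open[OF _ \<Omega>]) (use cross in auto)
      then have "(\<lambda>v. cross3 (pd X \<nu> x) (pd v (pd Y \<nu>) x) + cross3 (pd v (pd X \<nu>) x) (pd Y \<nu> x)) = (\<lambda>v. 0)"
        by (rule has_derivative_unique[OF _ has_derivative_const])
      from fun_cong[OF this, of V] have "cross3 (pd V (pd X \<nu>) x) (pd Y \<nu> x) = 0"
        by (simp add: X(2))
      then show ?thesis using cross3_eq_0_parallel Y by metis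
    qed
    obtain \<mu> where \<mu>: "pd X (pd X \<nu>) x = \<mu> *\<^sub>R pd Y \<nu> x" using D by blast
    obtain \<kappa> where "pd Y (pd X \<nu>) x = \<kappa> *\<^sub>R pd Y \<nu> x" using D by blast
    then have \<kappa>: "pd X (pd Y \<nu>) x = \<kappa> *\<^sub>R pd Y \<nu> x" using pd_pd_commute[OF \<nu> \<Omega>] by metis
    obtain \<alpha> \<beta> where "Z X = \<alpha> *\<^sub>R X + \<beta> *\<^sub>R Y" using real2_coords[OF X(1) nY] by blast
    then have ZX: "pd (Z X) \<nu> x = \<beta> *\<^sub>R pd Y \<nu> x" using X(2) by (simp add: add)
    have YX: "pd Y \<nu> x \<bullet> pd X F x = 0" using id(3)[of X Y] X(2) by simp
    \<comment> \<open>d\<nu>(Y) is a nonzero tangent vector orthogonal to dF(X), so it cannot also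
      be orthogonal to dF(Y).\<close>
    have "pd Y \<nu> x \<bullet> pd Y F x \<noteq> 0"
    proof
      assume YY: "pd Y \<nu> x \<bullet> pd Y F x = 0"
      obtain V where V: "pd Y \<nu> x = pd V F x" using range id(1)[of Y] by metis
      obtain c d where "V = c *\<^sub>R X + d *\<^sub>R Y" using real2_coords[OF X(1) nY] by blast
      then have "pd Y \<nu> x \<bullet> pd V F x = 0"
        using YX YY by (simp add: add inner_add_right)
      then show False using V Y by simp
    qed
    moreover have "pd X (pd X \<nu>) x \<bullet> pd Y F x = pd (Z X) \<nu> x \<bullet> pd Y F x"
    proof -
      have "pd X (pd X \<nu>) x \<bullet> pd Y F x = pd Y \<nu> x \<bullet> pd X (pd X F) x"
        using id(4)[of X X Y] X(2) \<kappa> YX by simp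
      also have "\<dots> = pd (Z X) \<nu> x \<bullet> pd Y F x" unfolding Z[OF X(2)] by (rule id(3))
      finally show ?thesis .
    qed
    \<comment> \<open>Both sides are multiples of d\<nu>(Y), so equality of their products with
      dF(Y) suffices.\<close>
    ultimately have "pd X (pd X \<nu>) x = pd (Z X) \<nu> x" using \<mu> ZX by simp
    then have "pd (Z X) \<nu> x \<bullet> w + 2 * \<epsilon> * (F x \<bullet> pd (Z X) F x + pd X F x \<bullet> pd X F x) \<le> 0"
      using der(2)[OF _ _ X(2)] Z[OF X(2)] by (simp add: w_def)
    moreover have "pd (Z X) \<nu> x \<bullet> w + 2 * \<epsilon> * (F x \<bullet> pd (Z X) F x) = 0"
      using der(1)[of "Z X"] by (simp add: w_def)
    ultimately have "\<epsilon> * (pd X F x \<bullet> pd X F x) \<le> 0" by (simp add: distrib_left)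
    then show False using pos[OF X(1)] \<epsilon> by (simp add: mult_le_0_iff)
  next
    case True
    \<comment> \<open>With d\<nu> = 0 the first order condition says that F x is normal to the
      surface. Hence its product with the tangent vector D_X D_X F vanishes below.\<close>
    have crit: "F x \<bullet> pd X F x = 0" for X using der(1)[of X] True \<epsilon> by simp
    have def_pos: "pd X (pd X \<nu>) x \<bullet> w < 0" if "X \<noteq> 0" for X
    proof -
      have "pd X (pd X \<nu>) x \<bullet> w + 2 * (\<epsilon> * (pd X F x \<bullet> pd X F x)) \<le> 0"
        using der(2)[of X] True Z[of X] crit by (simp add: w_def)
      moreover have "\<epsilon> * (pd X F x \<bullet> pd X F x) > 0" using \<epsilon> pos[OF that] by simp
      ultimately show ?thesis by linarith
    qed
    \<comment> \<open>D_X D_X \<nu> is orthogonal to \<nu> at a planar point, so \<open>w\<close>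
      may be replaced by its tangential part, which is a vector dF(W).\<close>
    define u where "u = w - (\<nu> x \<bullet> w) *\<^sub>R \<nu> x"
    have "\<nu> x \<bullet> \<nu> x = 1" using unit[OF \<Omega>(2)] by (simp add: dot_square_norm)
    then have "\<nu> x \<bullet> u = 0" by (simp add: u_def inner_diff_right)
    then obtain W where W: "u = pd W F x" using range by blast
    have nz: "pd W (pd X \<nu>) x \<noteq> 0" if "X \<noteq> 0" for X
    proof -
      have "\<nu> x \<bullet> pd X (pd X \<nu>) x = 0" using id(5)[of X X] True by simp
      then have "pd X (pd X \<nu>) x \<bullet> pd W F x = pd X (pd X \<nu>) x \<bullet> w"
        unfolding W[symmetric] u_def by (simp add: inner_diff_right inner_commute)
      then have "pd X (pd W \<nu>) x \<bullet> pd X F x < 0"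
        using id(4)[of X X W] True def_pos[OF that] by simp
      then show ?thesis using pd_pd_commute[OF \<nu> \<Omega>, of W X] by auto
    qed
    have lim: "((\<lambda>t. (1 / t) *\<^sub>R pd X \<nu> (x + t *\<^sub>R W)) \<longlongrightarrow> pd W (pd X \<nu>) x) (at_right 0)" for X
    proof -
      have "((\<lambda>t. x + t *\<^sub>R W) has_derivative (\<lambda>s. s *\<^sub>R W)) (at 0)"
        by (auto intro!: derivative_eq_intros)
      moreover have "(pd X \<nu> has_derivative (\<lambda>v. pd v (pd X \<nu>) x)) (at (x + 0 *\<^sub>R W))"
        using has_derivative_pd_pd[OF \<nu> \<Omega>] by simp
      ultimately have "((\<lambda>t. pd X \<nu> (x + t *\<^sub>R W)) has_derivative (\<lambda>s. pd (s *\<^sub>R W) (pd X \<nu>) x)) (at 0)"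
        by (rule has_derivative_compose)
      then have "((\<lambda>t. pd X \<nu> (x + t *\<^sub>R W)) has_vector_derivative pd W (pd X \<nu>) x) (at 0)"
        by (simp add: has_vector_derivative_def linear_scale[OF lin2])
      from has_vector_derivative_difference_quotient[OF this]
      have "((\<lambda>t. (1 / t) *\<^sub>R pd X \<nu> (x + t *\<^sub>R W)) \<longlongrightarrow> pd W (pd X \<nu>) x) (at 0)"
        using True by simp
      then show ?thesis by (rule filterlim_mono) (auto intro: at_le)
    qed
    \<comment> \<open>As d\<nu> vanishes at \<open>x\<close>, the quotients d\<nu>/t along
      \<open>W\<close> tend to the derivative of d\<nu>, and the vanishing of the cross product
      survives the limit. The derivative thus has rank below two.\<close>
    have "((\<lambda>t::real. 0) \<longlongrightarrow> cross3 (pd W (pd X \<nu>) x) (pd W (pd Y \<nu>) x)) (at_right 0)" for X Y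
    proof (rule Lim_transform_eventually[OF bounded_bilinear.tendsto[OF cross3_bilinear lim lim]])
      have "continuous (at_right 0) (\<lambda>t. x + t *\<^sub>R W)" by (intro continuous_intros)
      then have "\<forall>\<^sub>F t in at_right 0. x + t *\<^sub>R W \<in> \<Omega>"
        using \<Omega> by (auto simp: continuous_within tendsto_def)
      then show "\<forall>\<^sub>F t in at_right 0. cross3 ((1 / t) *\<^sub>R pd X \<nu> (x + t *\<^sub>R W)) ((1 / t) *\<^sub>R pd Y \<nu> (x + t *\<^sub>R W)) = 0"
        by eventually_elim (use cross in \<open>simp add: cross_mult_left cross_mult_right\<close>)
    qed
    then have cr: "cross3 (pd W (pd X \<nu>) x) (pd W (pd Y \<nu>) x) = 0" for X Y
      using tendsto_unique[OF _ tendsto_const] by (metis trivial_limit_at_right_real)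
    have "axis 1 1 \<noteq> (0 :: real^2)" "axis 2 1 \<noteq> (0 :: real^2)" by (auto simp: axis_eq_0_iff)
    then obtain c where c: "pd W (pd (axis 1 1) \<nu>) x = c *\<^sub>R pd W (pd (axis 2 1) \<nu>) x"
      using cross3_eq_0_parallel[OF cr nz] by metis
    have linW: "linear (\<lambda>v. pd W (pd v \<nu>) x)"
      using lin2[of W] pd_pd_commute[OF \<nu> \<Omega>, of W] by simp
    have "pd W (pd (axis 1 1 - c *\<^sub>R axis 2 1) \<nu>) x = 0"
      using linear_diff[OF linW] linear_scale[OF linW] c by simp
    moreover have "axis 1 1 - c *\<^sub>R axis 2 1 \<noteq> (0 :: real^2)"
      by (auto simp: vec_eq_iff forall_2 axis_def)
    ultimately show False using nz by blast
  qed
qed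

section \<open>Closed surfaces and their Gauss maps\<close>

text \<open>Local injectivity requires the derivative to be continuous in the operator norm. In
  finite dimension this follows from continuity in each direction, since the operator norm is at
  most the sum of the norms on \<open>Basis\<close>.\<close>

lemma locally_injective_of_derivative:
  fixes g :: "'a::euclidean_space \<Rightarrow> 'b::euclidean_space"
  assumes \<Omega>: "open \<Omega>" "x \<in> \<Omega>" and D: "\<And>y. y \<in> \<Omega> \<Longrightarrow> (g has_derivative D y) (at y)"
    and cont: "\<And>v. continuous_on \<Omega> (\<lambda>y. D y v)" and inj: "inj (D x)"
  obtains r where "r > 0" "ball x r \<subseteq> \<Omega>" "inj_on g (ball x r)"
proof -
  have lin: "linear (D y)" if "y \<in> \<Omega>" for y using D[OF that] has_derivative_linear by blast
  obtain h where h: "linear h" "h \<circ> D x = id"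
    using linear_injective_left_inverse[OF lin[OF \<Omega>(2)] inj] by blast
  have near: "\<exists>d>0. \<forall>y. dist x y < d \<longrightarrow> onorm (\<lambda>v. D y v - D x v) < e" if e: "e > 0" for e
  proof -
    define k where "k y = (\<Sum>i\<in>Basis. norm (D y i - D x i))" for y
    have "continuous_on \<Omega> k"
      unfolding k_def by (intro continuous_intros cont)
    then have "isCont k x" using \<Omega> continuous_on_eq_continuous_at by blast
    moreover have "k x = 0" by (simp add: k_def)
    ultimately obtain d1 where d1: "d1 > 0" "\<forall>y. dist y x < d1 \<longrightarrow> dist (k y) 0 < e"
      using e unfolding continuous_at_eps_delta by metis
    obtain d2 where d2: "d2 > 0" "ball x d2 \<subseteq> \<Omega>" using \<Omega> open_contains_ball by blast
    have "onorm (\<lambda>v. D y v - D x v) < e" if y: "dist x y < min d1 d2" for y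
    proof -
      have "y \<in> \<Omega>" using y d2 by auto
      then interpret L: linear "\<lambda>v. D y v - D x v"
        using lin \<Omega>(2) by (intro linear_compose_sub) auto
      have "norm (D y v - D x v) \<le> k y * norm v" for v
      proof -
        have "D y v - D x v = (\<Sum>i\<in>Basis. (v \<bullet> i) *\<^sub>R (D y i - D x i))"
          using L.sum[of "\<lambda>i. (v \<bullet> i) *\<^sub>R i" Basis] by (simp add: euclidean_representation L.scale)
        also have "norm \<dots> \<le> (\<Sum>i\<in>Basis. norm v * norm (D y i - D x i))"
          by (intro sum_norm_le) (auto intro: mult_right_mono Basis_le_norm)
        also have "\<dots> = k y * norm v" by (simp add: k_def sum_distrib_left mult.commute)
        finally show ?thesis .
      qed
      then have "onorm (\<lambda>v. D y v - D x v) \<le> k y" by (rule onorm_le)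
      then show ?thesis using d1(2)[rule_format, of y] y by (simp add: dist_commute)
    qed
    then show ?thesis using d1 d2 by (metis min_less_iff_conj)
  qed
  show ?thesis
    using has_derivative_locally_injective[OF \<Omega>(2,1) linear_conv_bounded_linear[THEN iffD1, OF h(1)] h(2) D near]
      that by blast
qed

locale closed_surface =
  fixes M :: "'a::{t2_space,second_countable_topology} set"
    and A :: "('a, 2) chart set"
    and f n :: "'a \<Rightarrow> real ^ 3"
  assumes atlas: "smooth_atlas M A" and compact: "compact M" and nonempty: "M \<noteq> {}"
    and immersion: "smooth_immersion A f" and gauss: "gauss_map M A f n"
begin

text \<open>Rank two is asked for in some chart only: a chart of a finite subatlas can then supply
  it, while the negation gives degeneracy in every chart around the point.\<close>

definition regular :: "'a \<Rightarrow> bool" where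
  "regular p \<longleftrightarrow> (\<exists>c\<in>A. p \<in> fst c \<and> inj (differential c n p))"

lemma chart_facts:
  assumes "(U, \<phi>) \<in> A"
  defines "\<psi> \<equiv> inv_into U \<phi>"
  shows "openin (top_of_set M) U" "open (\<phi> ` U)" "homeomorphism U (\<phi> ` U) \<phi> \<psi>"
    "Ck_on (Suc (Suc 0)) (f \<circ> \<psi>) (\<phi> ` U)" "Ck_on (Suc (Suc 0)) (n \<circ> \<psi>) (\<phi> ` U)"
    "\<And>x. x \<in> \<phi> ` U \<Longrightarrow> norm ((n \<circ> \<psi>) x) = 1"
    "\<And>x v. x \<in> \<phi> ` U \<Longrightarrow> (n \<circ> \<psi>) x \<bullet> pd v (f \<circ> \<psi>) x = 0"
    "\<And>x. x \<in> \<phi> ` U \<Longrightarrow> inj (\<lambda>v. pd v (f \<circ> \<psi>) x)"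
    "\<And>p. p \<in> U \<Longrightarrow> differential (U, \<phi>) n p = (\<lambda>v. pd v (n \<circ> \<psi>) (\<phi> p))"
    "\<And>p. p \<in> U \<Longrightarrow> \<psi> (\<phi> p) = p" "U \<subseteq> M"
proof -
  show op: "openin (top_of_set M) U" and "open (\<phi> ` U)" and hom: "homeomorphism U (\<phi> ` U) \<phi> \<psi>"
    using atlas assms unfolding smooth_atlas_def by auto
  show UM: "U \<subseteq> M" using op by (meson openin_imp_subset)
  show inv: "\<And>p. p \<in> U \<Longrightarrow> \<psi> (\<phi> p) = p" using hom by (simp add: homeomorphism_def)
  show "Ck_on (Suc (Suc 0)) (f \<circ> \<psi>) (\<phi> ` U)" "Ck_on (Suc (Suc 0)) (n \<circ> \<psi>) (\<phi> ` U)"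
    using immersion gauss assms unfolding smooth_immersion_def gauss_map_def smooth_map_def smooth_on_def
    by fastforce+
  have d: "differential (U, \<phi>) g p = (\<lambda>v. pd v (g \<circ> \<psi>) (\<phi> p))" for g :: "'a \<Rightarrow> real^3" and p
    by (simp add: differential_def pd_def \<psi>_def)
  then show "\<And>p. p \<in> U \<Longrightarrow> differential (U, \<phi>) n p = (\<lambda>v. pd v (n \<circ> \<psi>) (\<phi> p))" by simp
  fix x assume "x \<in> \<phi> ` U"
  then obtain p where p: "p \<in> U" "x = \<phi> p" by blast
  show "norm ((n \<circ> \<psi>) x) = 1" using gauss p inv subsetD[OF UM p(1)] by (simp add: gauss_map_def image_subset_iff)
  show "(n \<circ> \<psi>) x \<bullet> pd v (f \<circ> \<psi>) x = 0" for v
    using gauss p assms(1) inv d[of f p] unfolding gauss_map_def by fastforce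
  show "inj (\<lambda>v. pd v (f \<circ> \<psi>) x)"
    using immersion p assms(1) d[of f p] unfolding smooth_immersion_def by fastforce
qed

lemma open_chart_image:
  assumes c: "(U, \<phi>) \<in> A" and V: "openin (top_of_set M) V"
  shows "open (\<phi> ` (U \<inter> V))"
proof -
  note F = chart_facts[OF c]
  have "openin (top_of_set U) (U \<inter> V)"
    using V F(1,11) by (metis inf.commute openin_Int openin_subset_trans inf_le2)
  then have "openin (top_of_set (\<phi> ` U)) (\<phi> ` (U \<inter> V))"
    using homeomorphism_imp_open_map[OF F(3)] by blast
  then show ?thesis using F(2) openin_open_trans by blast
qed

lemma obtain_chart:
  assumes "p \<in> M"
  obtains U \<phi> where "(U, \<phi>) \<in> A" "p \<in> U"
  using atlas assms unfolding smooth_atlas_def by fastforce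

lemma norm_gauss: "p \<in> M \<Longrightarrow> norm (n p) = 1"
  using gauss by (auto simp: gauss_map_def)

lemma locally_planar: "locally_planar M"
  unfolding locally_planar_def
proof
  fix p assume "p \<in> M"
  then obtain U \<phi> where c: "(U, \<phi>) \<in> A" "p \<in> U" by (rule obtain_chart)
  show "\<exists>U (\<phi> :: 'a \<Rightarrow> real^2) \<psi>. p \<in> U \<and> openin (top_of_set M) U \<and> homeomorphism U (\<phi> ` U) \<phi> \<psi> \<and> open (\<phi> ` U)"
    using chart_facts(1-3)[OF c(1)] c(2) by blast
qed

lemma continuous_on_surface:
  fixes g :: "'a \<Rightarrow> 'b::topological_space"
  assumes "\<And>U \<phi>. (U, \<phi>) \<in> A \<Longrightarrow> continuous_on (\<phi> ` U) (g \<circ> inv_into U \<phi>)"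
  shows "continuous_on M g"
  unfolding continuous_on_eq_continuous_within
proof
  fix p assume "p \<in> M"
  then obtain U \<phi> where c: "(U, \<phi>) \<in> A" "p \<in> U" by (rule obtain_chart)
  note F = chart_facts[OF c(1)]
  have "continuous_on U ((g \<circ> inv_into U \<phi>) \<circ> \<phi>)"
    by (rule continuous_on_compose[OF _ assms[OF c(1)]]) (use F(3) in \<open>simp add: homeomorphism_def\<close>)
  then have "continuous_on U g" by (rule continuous_on_eq) (simp only: o_apply F(10))
  then have "continuous (at p within U) g" using c(2) by (simp add: continuous_on_eq_continuous_within)
  moreover obtain T where T: "open T" "U = M \<inter> T" using F(1) openin_open by blast
  have "at p within M = at p within U"
    using c(2) T by (intro at_within_nhd[of p T]) auto
  ultimately show "continuous (at p within M) g" by simp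
qed

lemma continuous_on_f: "continuous_on M f"
  by (rule continuous_on_surface) (use chart_facts(4) Ck_on_continuous in blast)

lemma continuous_on_n: "continuous_on M n"
  by (rule continuous_on_surface) (use chart_facts(5) Ck_on_continuous in blast)

text \<open>The differential of the height vanishes at \<open>p\<close>, so \<open>u\<close> is a
  unit normal there, and it is unique up to sign.\<close>

lemma local_max_normal:
  assumes V: "openin (top_of_set M) V" "p \<in> V" and max: "\<And>q. q \<in> V \<Longrightarrow> f q \<bullet> u \<le> f p \<bullet> u" and u: "norm u = 1"
  shows "n p = u \<or> n p = - u"
proof -
  have "p \<in> M" using V openin_imp_subset by blast
  then obtain U \<phi> where c: "(U, \<phi>) \<in> A" "p \<in> U" by (rule obtain_chart)
  let ?\<psi> = "inv_into U \<phi>"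
  note F = chart_facts[OF c(1)]
  have x: "\<phi> p \<in> \<phi> ` U" using c(2) by blast
  have op: "open (\<phi> ` (U \<inter> V))" by (rule open_chart_image[OF c(1) V(1)])
  have "((\<lambda>x. (f \<circ> ?\<psi>) x \<bullet> u) has_derivative (\<lambda>v. pd v (f \<circ> ?\<psi>) (\<phi> p) \<bullet> u)) (at (\<phi> p))"
    by (intro has_derivative_inner_left has_derivative_pd[OF F(4) x])
  moreover have "\<forall>y\<in>\<phi> ` (U \<inter> V). (f \<circ> ?\<psi>) y \<bullet> u \<le> (f \<circ> ?\<psi>) (\<phi> p) \<bullet> u"
    using max F(10) c(2) by auto
  ultimately have "(\<lambda>v. pd v (f \<circ> ?\<psi>) (\<phi> p) \<bullet> u) = (\<lambda>v. 0)"
    using differential_zero_maxmin[OF _ op, of "\<phi> p"] c(2) V(2) by blast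
  then have "u \<bullet> pd v (f \<circ> ?\<psi>) (\<phi> p) = 0" for v by (metis inner_commute)
  then have "u = n p \<or> u = - n p"
    using unit_normal_unique[OF linear_pd[OF F(4) x] F(8)[OF x] F(6)[OF x] F(7)[OF x] u] F(10)[OF c(2)] by simp
  then show ?thesis by auto
qed

text \<open>An open and compact \<open>V\<close> covers both the whole surface and a piece of a
  separation of it. Minima are obtained from the direction \<open>- u\<close>.\<close>

lemma obtain_max_point:
  assumes "norm u = 1" "openin (top_of_set M) V" "compact V" "V \<noteq> {}"
  obtains p where "p \<in> V" "\<And>q. q \<in> V \<Longrightarrow> f q \<bullet> u \<le> f p \<bullet> u" "n p = u \<or> n p = - u"
proof -
  have "continuous_on V (\<lambda>q. f q \<bullet> u)"
    using continuous_on_subset[OF continuous_on_f] openin_imp_subset[OF assms(2)]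
    by (intro continuous_intros) auto
  then obtain p where "p \<in> V" "\<And>q. q \<in> V \<Longrightarrow> f q \<bullet> u \<le> f p \<bullet> u"
    using continuous_attains_sup[OF assms(3,4)] by metis
  then show ?thesis using that local_max_normal[OF assms(2) _ _ assms(1)] by blast
qed

end

section \<open>Orthonormal frames and the projection along a pole of the sphere\<close>

definition orthonormal_frame :: "real^3 \<Rightarrow> real^3 \<Rightarrow> real^3 \<Rightarrow> bool" where
  "orthonormal_frame u e1 e2 \<longleftrightarrow> norm u = 1 \<and> norm e1 = 1 \<and> norm e2 = 1 \<and>
     u \<bullet> e1 = 0 \<and> u \<bullet> e2 = 0 \<and> e1 \<bullet> e2 = 0 \<and> (\<forall>x. x = (x \<bullet> u) *\<^sub>R u + (x \<bullet> e1) *\<^sub>R e1 + (x \<bullet> e2) *\<^sub>R e2)"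

lemma orthonormal_frame_exists:
  fixes u :: "real^3"
  assumes "norm u = 1"
  obtains e1 e2 where "orthonormal_frame u e1 e2"
proof -
  obtain g :: "real^3 \<Rightarrow> real^3" where g: "orthogonal_transformation g" "g (axis 1 1) = u"
    using orthogonal_transformation_exists_1[of "axis 1 1 :: real^3" u] assms by (auto simp: norm_axis_1)
  have ip: "g x \<bullet> g y = x \<bullet> y" and lin: "linear g" for x y
    using g(1) by (auto simp: orthogonal_transformation_def)
  have nm: "norm (g x) = norm x" for x using ip[of x x] by (simp add: norm_eq_sqrt_inner)
  have "x = (x \<bullet> u) *\<^sub>R u + (x \<bullet> g (axis 2 1)) *\<^sub>R g (axis 2 1) + (x \<bullet> g (axis 3 1)) *\<^sub>R g (axis 3 1)" for x
  proof -
    obtain y where y: "x = g y" using orthogonal_transformation_surj[OF g(1)] by (metis surjD)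
    have "y = y $ 1 *\<^sub>R axis 1 1 + y $ 2 *\<^sub>R axis 2 1 + y $ 3 *\<^sub>R axis 3 1"
      by (simp add: vec_eq_iff forall_3 axis_def)
    then have "g y = y $ 1 *\<^sub>R u + y $ 2 *\<^sub>R g (axis 2 1) + y $ 3 *\<^sub>R g (axis 3 1)"
      using g(2) linear_add[OF lin] linear_scale[OF lin] by metis
    then show ?thesis unfolding y g(2)[symmetric] ip by (simp add: inner_axis g(2))
  qed
  moreover have "u \<bullet> g (axis 2 1) = 0" "u \<bullet> g (axis 3 1) = 0" "g (axis 2 1) \<bullet> g (axis 3 1) = 0"
    unfolding g(2)[symmetric] ip by (simp_all add: inner_axis_axis)
  ultimately show ?thesis
    using that[of "g (axis 2 1)" "g (axis 3 1)"] assms nm unfolding orthonormal_frame_def by (simp add: norm_axis_1)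
qed

text \<open>The values are complex so that winding numbers apply and the directions orthogonal to
  the pole become the numbers cis \<theta>.\<close>

definition frame_proj :: "real^3 \<Rightarrow> real^3 \<Rightarrow> real^3 \<Rightarrow> complex" where
  "frame_proj e1 e2 x = Complex (x \<bullet> e1) (x \<bullet> e2)"

lemma frame_proj_simps [simp]: "Re (frame_proj e1 e2 x) = x \<bullet> e1" "Im (frame_proj e1 e2 x) = x \<bullet> e2"
  by (simp_all add: frame_proj_def)

lemma bounded_linear_frame_proj: "bounded_linear (frame_proj e1 e2)"
proof -
  have "linear (frame_proj e1 e2)"
    by (rule linearI) (simp_all add: complex_eq_iff inner_add_left)
  then show ?thesis by (simp add: linear_conv_bounded_linear)
qed

lemma orthonormal_frame_inner:
  assumes "orthonormal_frame u e1 e2"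
  shows "u \<bullet> u = 1" "e1 \<bullet> e1 = 1" "e2 \<bullet> e2 = 1" "u \<bullet> e1 = 0" "u \<bullet> e2 = 0" "e1 \<bullet> e2 = 0"
    "e1 \<bullet> u = 0" "e2 \<bullet> u = 0" "e2 \<bullet> e1 = 0"
  using assms by (simp_all add: orthonormal_frame_def dot_square_norm inner_commute)

lemma frame_norm:
  assumes "orthonormal_frame u e1 e2"
  shows "(norm x)\<^sup>2 = (x \<bullet> u)\<^sup>2 + (norm (frame_proj e1 e2 x))\<^sup>2"
proof -
  define a b c where "a = x \<bullet> u" and "b = x \<bullet> e1" and "c = x \<bullet> e2"
  note F = orthonormal_frame_inner[OF assms]
  have x: "x = a *\<^sub>R u + b *\<^sub>R e1 + c *\<^sub>R e2"
    using assms unfolding a_def b_def c_def orthonormal_frame_def by blast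
  have "x \<bullet> x = a\<^sup>2 + b\<^sup>2 + c\<^sup>2"
    unfolding x by (simp add: inner_add_left inner_add_right F power2_eq_square)
  then show ?thesis
    by (simp add: power2_norm_eq_inner[of x] cmod_power2 a_def b_def c_def)
qed

text \<open>The unit length determines the component along \<open>u\<close> up to sign, and the
  hemisphere fixes the sign.\<close>

lemma frame_eqI:
  assumes fr: "orthonormal_frame u e1 e2" and "norm x = 1" "norm y = 1"
    and "frame_proj e1 e2 x = frame_proj e1 e2 y" "x \<bullet> u > 0" "y \<bullet> u > 0"
  shows "x = y"
proof -
  have "(x \<bullet> u)\<^sup>2 = (y \<bullet> u)\<^sup>2" using frame_norm[OF fr, of x] frame_norm[OF fr, of y] assms(2-4) by (metis add_right_cancel)
  then have "x \<bullet> u = y \<bullet> u" using assms(5,6) by (auto simp: power2_eq_iff)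
  moreover have "x \<bullet> e1 = y \<bullet> e1" "x \<bullet> e2 = y \<bullet> e2" using assms(4) by (metis frame_proj_simps)+
  ultimately show ?thesis using fr unfolding orthonormal_frame_def by metis
qed

lemma frame_proj_pole:
  assumes "orthonormal_frame u e1 e2" "x = u \<or> x = - u"
  shows "frame_proj e1 e2 x = 0"
  using assms by (auto simp: complex_eq_iff orthonormal_frame_def)

section \<open>The projected Gauss map as a coordinate near regular points\<close>

context closed_surface
begin

text \<open>At a point with normal \<open>u\<close> or \<open>- u\<close>, the image of dn is
  orthogonal to \<open>u\<close>, so projecting along \<open>u\<close> keeps dn injective. The two
  poles are treated alike, as both project to 0.\<close>

lemma regular_coordinate:
  assumes p: "p \<in> M" "regular p" and fr: "orthonormal_frame u e1 e2" and np: "n p = u \<or> n p = - u"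
  obtains \<iota> r where "r > 0" "continuous_on (ball 0 r) \<iota>" "openin (top_of_set M) (\<iota> ` ball 0 r)"
    "\<And>z. z \<in> ball 0 r \<Longrightarrow> frame_proj e1 e2 (n (\<iota> z)) = z" "\<iota> 0 = p"
proof -
  obtain U \<phi> where c: "(U, \<phi>) \<in> A" "p \<in> U" "inj (differential (U, \<phi>) n p)"
    using p(2) unfolding regular_def by auto
  let ?\<psi> = "inv_into U \<phi>" and ?w = "frame_proj e1 e2"
  note F = chart_facts[OF c(1)]
  define x where "x = \<phi> p"
  have x: "x \<in> \<phi> ` U" using c(2) by (simp add: x_def)
  define G where "G = ?w \<circ> (n \<circ> ?\<psi>)"
  define D where "D y v = ?w (pd v (n \<circ> ?\<psi>) y)" for y v
  have GD: "(G has_derivative D y) (at y)" if "y \<in> \<phi> ` U" for y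
    unfolding G_def D_def using has_derivative_pd[OF F(5) that]
    by (auto simp: o_def intro!: bounded_linear.has_derivative[OF bounded_linear_frame_proj])
  have contD: "continuous_on (\<phi> ` U) (\<lambda>y. D y v)" for v
    unfolding D_def
    by (intro bounded_linear.continuous_on[OF bounded_linear_frame_proj] continuous_on_pd[OF F(5,2)])
  have linD: "linear (D x)" using GD[OF x] has_derivative_linear by blast
  have lin\<nu>: "linear (\<lambda>v. pd v (n \<circ> ?\<psi>) x)" using linear_pd[OF F(5) x] .
  have "v = 0" if "D x v = 0" for v
  proof -
    have "(n \<circ> ?\<psi>) x \<bullet> pd v (n \<circ> ?\<psi>) x = 0"
      by (rule flat_gauss_map_identities(1)[OF F(2) x F(4,5) F(7,6)])
    then have "pd v (n \<circ> ?\<psi>) x \<bullet> u = 0"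
      using np F(10)[OF c(2)] by (auto simp: x_def inner_commute)
    moreover have "pd v (n \<circ> ?\<psi>) x \<bullet> e1 = 0" "pd v (n \<circ> ?\<psi>) x \<bullet> e2 = 0"
      using that by (simp_all add: D_def complex_eq_iff)
    ultimately have "pd v (n \<circ> ?\<psi>) x = 0"
      using fr unfolding orthonormal_frame_def by (metis add.right_neutral scaleR_zero_left)
    then show "v = 0" using c(3) lin\<nu> linear_injective_0 unfolding F(9)[OF c(2)] x_def by blast
  qed
  then have injD: "inj (D x)" using linear_injective_0[OF linD] by blast
  obtain r0 where r0: "r0 > 0" "ball x r0 \<subseteq> \<phi> ` U" "inj_on G (ball x r0)"
    using locally_injective_of_derivative[OF F(2) x GD contD injD] by blast
  let ?B = "ball x r0"
  have contG: "continuous_on ?B G"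
    using GD r0(2) by (meson continuous_at_imp_continuous_on has_derivative_continuous subsetD)
  \<comment> \<open>Invariance of domain takes the place of the inverse function theorem: a
    continuous inverse is all that is needed.\<close>
  have opG: "open (G ` ?B)"
    by (rule invariance_of_domain_gen[OF open_ball contG r0(3)]) simp
  obtain K where K: "homeomorphism ?B (G ` ?B) G K"
    by (rule invariance_of_domain_homeomorphism[OF open_ball contG _ r0(3)]) auto
  have Gx: "G x = 0"
    using frame_proj_pole[OF fr np] F(10)[OF c(2)] by (simp add: G_def x_def)
  have "0 \<in> G ` ?B" using Gx r0(1) by (metis centre_in_ball imageI)
  then obtain r where r: "r > 0" "ball 0 r \<subseteq> G ` ?B" using opG open_contains_ball by blast
  define \<iota> where "\<iota> = ?\<psi> \<circ> K"
  have KB: "K z \<in> ?B" "G (K z) = z" if "z \<in> ball 0 r" for z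
    using K r(2) that by (auto simp: homeomorphism_def)
  show ?thesis
  proof (rule that[OF r(1)])
    have cK: "continuous_on (ball 0 r) K" using K r(2) by (auto simp: homeomorphism_def intro: continuous_on_subset)
    have K1: "K ` ball 0 r \<subseteq> \<phi> ` U" by (intro image_subsetI subsetD[OF r0(2)] KB(1))
    then show "continuous_on (ball 0 r) \<iota>" unfolding \<iota>_def
      by (intro continuous_on_compose[OF cK continuous_on_subset[OF homeomorphism_cont2[OF F(3)]]])
    have "openin (top_of_set (G ` ?B)) (ball 0 r)" using r(2) by (simp add: open_subset)
    then have "openin (top_of_set ?B) (K ` ball 0 r)"
      using homeomorphism_imp_open_map[OF homeomorphism_symD[OF K]] by blast
    then have "open (K ` ball 0 r)" using openin_open_trans by blast
    then have "openin (top_of_set (\<phi> ` U)) (K ` ball 0 r)" using K1 by (simp add: open_subset)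
    then have "openin (top_of_set U) (?\<psi> ` K ` ball 0 r)"
      using homeomorphism_imp_open_map[OF homeomorphism_symD[OF F(3)]] by blast
    then show "openin (top_of_set M) (\<iota> ` ball 0 r)"
      using F(1) openin_trans by (metis \<iota>_def image_comp)
    show "?w (n (\<iota> z)) = z" if "z \<in> ball 0 r" for z
      using KB(2)[OF that] by (simp add: \<iota>_def G_def)
    have "K 0 = x" using K Gx r0(1) unfolding homeomorphism_def by (metis centre_in_ball)
    then show "\<iota> 0 = p" using F(10)[OF c(2)] by (simp add: \<iota>_def x_def)
  qed
qed

text \<open>With the normal projected along \<open>u\<close>, the shadows in the directions cos
  \<theta> e1 + sin \<theta> e2 are the rotating half-surfaces.\<close>

lemma regular_three_normals:
  assumes con: "connected M" and sc: "\<And>v. norm v = 1 \<Longrightarrow> simply_connected (shadow M n v)" and u: "norm u = 1"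
    and p: "p1 \<in> M" "p2 \<in> M" "p3 \<in> M" "p1 \<noteq> p2" "p1 \<noteq> p3" "p2 \<noteq> p3"
    and normals: "n p1 = u \<or> n p1 = - u" "n p2 = u \<or> n p2 = - u" "n p3 = u \<or> n p3 = - u"
    and reg: "regular p1" "regular p2"
  shows False
proof -
  obtain e1 e2 where fr: "orthonormal_frame u e1 e2" using orthonormal_frame_exists u by blast
  let ?w = "\<lambda>p. frame_proj e1 e2 (n p)"
  obtain \<iota>1 r1 where 1: "r1 > 0" "continuous_on (ball 0 r1) \<iota>1" "openin (top_of_set M) (\<iota>1 ` ball 0 r1)"
    "\<And>z. z \<in> ball 0 r1 \<Longrightarrow> ?w (\<iota>1 z) = z" "\<iota>1 0 = p1"
    using regular_coordinate[OF p(1) reg(1) fr normals(1)] by blast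
  obtain \<iota>2 r2 where 2: "r2 > 0" "continuous_on (ball 0 r2) \<iota>2" "openin (top_of_set M) (\<iota>2 ` ball 0 r2)"
    "\<And>z. z \<in> ball 0 r2 \<Longrightarrow> ?w (\<iota>2 z) = z" "\<iota>2 0 = p2"
    using regular_coordinate[OF p(2) reg(2) fr normals(2)] by blast
  define r where "r = min r1 r2"
  have sub: "ball (0::complex) r \<subseteq> ball 0 r1" "ball (0::complex) r \<subseteq> ball 0 r2" by (auto simp: r_def)
  have contw: "continuous_on M ?w"
    by (intro bounded_linear.continuous_on[OF bounded_linear_frame_proj] continuous_on_n)
  have op: "openin (top_of_set M) (\<iota>1 ` ball 0 r)"
  proof -
    \<comment> \<open>After shrinking to a common radius, openness is regained by describing the
      smaller disc through the size of the projected normal.\<close>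
    have "\<iota>1 ` ball 0 r = \<iota>1 ` ball 0 r1 \<inter> ?w -` ball 0 r"
    proof (intro set_eqI iffI)
      fix q assume "q \<in> \<iota>1 ` ball 0 r"
      then obtain z where "z \<in> ball 0 r" "q = \<iota>1 z" by blast
      then show "q \<in> \<iota>1 ` ball 0 r1 \<inter> ?w -` ball 0 r" using 1(4) sub(1) by auto
    next
      fix q assume q: "q \<in> \<iota>1 ` ball 0 r1 \<inter> ?w -` ball 0 r"
      then obtain z where z: "z \<in> ball 0 r1" "q = \<iota>1 z" by blast
      then have "z \<in> ball 0 r" using q 1(4) by simp
      then show "q \<in> \<iota>1 ` ball 0 r" using z(2) by blast
    qed
    moreover have "openin (top_of_set M) (M \<inter> ?w -` ball 0 r)"
      using continuous_openin_preimage_gen[OF contw open_ball] by blast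
    moreover have "\<iota>1 ` ball 0 r1 \<subseteq> M" using 1(3) by (meson openin_imp_subset)
    ultimately show ?thesis
      using openin_Int[OF 1(3), of "M \<inter> ?w -` ball 0 r"] by (metis inf.absorb1 inf_assoc)
  qed
  have sc': "simply_connected {p \<in> M. Re (?w p * cnj (cis \<theta>)) > 0}" for \<theta>
  proof -
    define v where "v = cos \<theta> *\<^sub>R e1 + sin \<theta> *\<^sub>R e2"
    have "v \<bullet> v = (cos \<theta>)\<^sup>2 + (sin \<theta>)\<^sup>2"
      unfolding v_def by (simp add: inner_add_left inner_add_right orthonormal_frame_inner[OF fr] power2_eq_square)
    then have "norm v = 1" by (simp add: norm_eq_sqrt_inner)
    moreover have "shadow M n v = {p \<in> M. Re (?w p * cnj (cis \<theta>)) > 0}"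
      by (simp add: shadow_def v_def inner_add_right mult.commute)
    ultimately show ?thesis using sc by metis
  qed
  have r: "r > 0" using 1(1) 2(1) by (simp add: r_def)
  show False
  proof (rule three_points_contradiction[where w = ?w and r = r and ?\<iota>1.0 = \<iota>1 and ?\<iota>2.0 = \<iota>2 and ?p3.0 = p3, OF con locally_planar contw r sc'
        continuous_on_subset[OF 1(2) sub(1)] op])
    show "continuous_on (ball 0 r) \<iota>2" using continuous_on_subset[OF 2(2) sub(2)] .
    show "\<iota>2 ` ball 0 r \<subseteq> M" using image_mono[OF sub(2)] openin_imp_subset[OF 2(3)] by (rule order_trans)
    show "?w (\<iota>1 z) = z" if "z \<in> ball 0 r" for z using 1(4) sub(1) that by blast
    show "?w (\<iota>2 z) = z" if "z \<in> ball 0 r" for z using 2(4) sub(2) that by blast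
    show "?w p3 = 0" by (rule frame_proj_pole[OF fr normals(3)])
  qed (use 1(5) 2(5) p in simp_all)
qed

end

section \<open>Tangent planes support the surface\<close>

lemma negligible_linear_uminus:
  fixes S :: "(real^'n) set"
  assumes "negligible S"
  shows "negligible (uminus ` S)"
  by (rule negligible_differentiable_image_negligible[OF _ assms]) (auto intro!: derivative_intros simp: differentiable_on_def)

context closed_surface
begin

text \<open>Sard's theorem for the plane map w o n in a chart: where dn is not injective, its
  composition with \<open>w\<close> is not injective either.\<close>

lemma negligible_critical_values:
  fixes w :: "real^3 \<Rightarrow> real^2"
  assumes w: "linear w" and c: "(U, \<phi>) \<in> A"
  shows "negligible ((\<lambda>p. w (n p)) ` {p \<in> U. \<not> inj (differential (U, \<phi>) n p)})"
proof -
  let ?\<psi> = "inv_into U \<phi>"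
  note F = chart_facts[OF c]
  define S where "S = {x \<in> \<phi> ` U. \<not> inj (\<lambda>v. pd v (n \<circ> ?\<psi>) x)}"
  define D where "D x v = w (pd v (n \<circ> ?\<psi>) x)" for x v
  have der: "((w \<circ> (n \<circ> ?\<psi>)) has_derivative D x) (at x)" if "x \<in> \<phi> ` U" for x
  proof -
    have "bounded_linear w" using w by (simp add: linear_conv_bounded_linear)
    from bounded_linear.has_derivative[OF this has_derivative_pd[OF F(5) that]]
    show ?thesis unfolding D_def[abs_def] by (simp only: comp_def)
  qed
  have "negligible ((w \<circ> (n \<circ> ?\<psi>)) ` S)"
  proof (rule baby_Sard)
    fix x assume x: "x \<in> S"
    then have x': "x \<in> \<phi> ` U" by (simp add: S_def)
    show "((w \<circ> (n \<circ> ?\<psi>)) has_derivative D x) (at x within S)"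
      using der[OF x'] has_derivative_at_withinI by blast
    have "linear (D x)" using der[OF x'] has_derivative_linear by blast
    then have "(*v) (matrix (D x)) = D x" by (simp add: matrix_works fun_eq_iff)
    moreover have "\<not> inj (D x)"
    proof
      assume "inj (D x)"
      then have "inj (\<lambda>v. pd v (n \<circ> ?\<psi>) x)" unfolding D_def inj_def by metis
      then show False using x by (simp add: S_def)
    qed
    ultimately show "rank (matrix (D x)) < CARD(2)"
      using less_rank_noninjective[of "matrix (D x)"] by simp
  qed simp
  moreover have "(\<lambda>p. w (n p)) ` {p \<in> U. \<not> inj (differential (U, \<phi>) n p)} \<subseteq> (w \<circ> (n \<circ> ?\<psi>)) ` S"
  proof
    fix y assume "y \<in> (\<lambda>p. w (n p)) ` {p \<in> U. \<not> inj (differential (U, \<phi>) n p)}"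
    then obtain p where p: "p \<in> U" "\<not> inj (differential (U, \<phi>) n p)" "y = w (n p)" by blast
    then have "\<phi> p \<in> S" "y = (w \<circ> (n \<circ> ?\<psi>)) (\<phi> p)" using F(9,10)[OF p(1)] by (auto simp: S_def)
    then show "y \<in> (w \<circ> (n \<circ> ?\<psi>)) ` S" by blast
  qed
  ultimately show ?thesis using negligible_subset by blast
qed

lemma finite_atlas:
  obtains C where "finite C" "C \<subseteq> A" "M = (\<Union>(U, \<phi>)\<in>C. U)"
proof -
  have "\<forall>U\<in>fst ` A. openin (top_of_set M) U" using chart_facts(1) by auto
  moreover have "M \<subseteq> \<Union>(fst ` A)" using atlas unfolding smooth_atlas_def by fastforce
  ultimately obtain D where D: "D \<subseteq> fst ` A" "finite D" "M \<subseteq> \<Union>D"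
    using compact unfolding compact_eq_openin_cover by (metis (no_types, lifting))
  then obtain C where C: "C \<subseteq> A" "finite C" "D = fst ` C" using finite_subset_image by metis
  have "(\<Union>(U, \<phi>)\<in>C. U) = \<Union>D" using C(3) by force
  moreover have "\<Union>D \<subseteq> M" using C(1,3) chart_facts(11) by fastforce
  ultimately show ?thesis using that[OF C(2,1)] D(3) by simp
qed

text \<open>Directions near \<open>u0\<close> are parametrised by their projections to the plane
  orthogonal to \<open>u0\<close>, where the critical values form a null set.\<close>

lemma regular_direction_exists:
  assumes u0: "norm u0 = 1" and e: "e > 0"
  obtains u where "norm u = 1" "dist u u0 < e" "\<And>p. p \<in> M \<Longrightarrow> n p = u \<or> n p = - u \<Longrightarrow> regular p"
proof -
  obtain e1 e2 where fr: "orthonormal_frame u0 e1 e2" using orthonormal_frame_exists u0 by blast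
  note I = orthonormal_frame_inner[OF fr]
  define w :: "real^3 \<Rightarrow> real^2" where "w x = (x \<bullet> e1) *\<^sub>R axis 1 1 + (x \<bullet> e2) *\<^sub>R axis 2 1" for x
  have linw: "linear w"
    by (rule linearI) (simp_all add: w_def inner_add_left algebra_simps)
  obtain C where C: "finite C" "C \<subseteq> A" "M = (\<Union>(U, \<phi>)\<in>C. U)" by (rule finite_atlas)
  define B where "B = (\<Union>(U, \<phi>)\<in>C. (\<lambda>p. w (n p)) ` {p \<in> U. \<not> inj (differential (U, \<phi>) n p)})"
  have negB: "negligible B"
    unfolding B_def using C(1,2) by (intro negligible_Union) (auto intro!: negligible_critical_values[OF linw])
  \<comment> \<open>Points with normal \<open>- u\<close> project to the opposite point, so the
    reflected set has to be avoided too.\<close>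
  have negB': "negligible (B \<union> uminus ` B)"
    using negB negligible_linear_uminus by (intro negligible_Un) auto
  \<comment> \<open>The lift of the unit disc to the hemisphere around \<open>u0\<close>, with
    \<open>w\<close> as left inverse.\<close>
  define h where "h y = sqrt (1 - (norm y)\<^sup>2) *\<^sub>R u0 + (y $ 1) *\<^sub>R e1 + (y $ 2) *\<^sub>R e2" for y :: "real^2"
  have "continuous_on UNIV h" unfolding h_def by (intro continuous_intros)
  then have "open (h -` ball u0 e)" by (simp add: open_vimage)
  then have "open (h -` ball u0 e \<inter> ball 0 1)" by blast
  moreover have "0 \<in> h -` ball u0 e \<inter> ball 0 1" using e by (simp add: h_def)
  ultimately have "\<not> negligible (h -` ball u0 e \<inter> ball 0 1)" using open_not_negligible by blast
  then have "\<not> h -` ball u0 e \<inter> ball 0 1 \<subseteq> B \<union> uminus ` B"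
    using negligible_subset[OF negB'] by metis
  then obtain y where y: "y \<in> h -` ball u0 e" "y \<in> ball 0 1" "y \<notin> B" "y \<notin> uminus ` B"
    by (meson IntD1 IntD2 UnI1 UnI2 subsetI)
  moreover from y(4) have "- y \<notin> B" by (metis image_eqI minus_minus)
  ultimately have y: "h y \<in> ball u0 e" "norm y < 1" "y \<notin> B" "- y \<notin> B" by auto
  have wh: "w (h y) = y"
    by (simp add: w_def h_def inner_add_left I vec_eq_iff forall_2 axis_def)
  have ny: "(norm y)\<^sup>2 = (y $ 1)\<^sup>2 + (y $ 2)\<^sup>2"
    unfolding power2_norm_eq_inner by (simp only: inner_vec_def sum_2) (simp add: power2_eq_square)
  have le: "(norm y)\<^sup>2 \<le> 1" using y(2) by (simp add: power_le_one)
  have "h y \<bullet> h y = 1"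
    by (simp add: h_def inner_add_left inner_add_right I) (use le ny in \<open>simp add: power2_eq_square\<close>)
  then have nh: "norm (h y) = 1" by (simp add: norm_eq_sqrt_inner)
  show ?thesis
  proof (rule that[OF nh])
    show "dist (h y) u0 < e" using y(1) by (simp add: dist_commute)
    fix p assume p: "p \<in> M" "n p = h y \<or> n p = - h y"
    then obtain U \<phi> where c: "(U, \<phi>) \<in> C" "p \<in> U" using C(3) by blast
    have "w (n p) = y \<or> w (n p) = - y" using p(2) wh linear_neg[OF linw] by auto
    then have "w (n p) \<notin> B" using y(3,4) by auto
    then have "inj (differential (U, \<phi>) n p)" using c unfolding B_def by fastforce
    then show "regular p" unfolding regular_def using c C(2) by force
  qed
qed

section \<open>The region where the tangent plane has points on both sides\<close>

definition two_sided :: "'a \<Rightarrow> 'a \<Rightarrow> 'a \<Rightarrow> bool" where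
  "two_sided p q q' \<longleftrightarrow> n p \<bullet> (f q - f p) > 0 \<and> n p \<bullet> (f p - f q') > 0"

lemma openin_two_sided: "openin (top_of_set M) {p \<in> M. two_sided p q q'}"
proof -
  have "continuous_on M (\<lambda>p. n p \<bullet> (f q - f p))" "continuous_on M (\<lambda>p. n p \<bullet> (f p - f q'))"
    by (intro continuous_intros continuous_on_f continuous_on_n)+
  then have "openin (top_of_set M) (M \<inter> (\<lambda>p. n p \<bullet> (f q - f p)) -` {0<..})"
    "openin (top_of_set M) (M \<inter> (\<lambda>p. n p \<bullet> (f p - f q')) -` {0<..})"
    by (auto intro: continuous_openin_preimage_gen)
  from openin_Int[OF this] show ?thesis
    by (rule arg_cong[THEN iffD1, rotated]) (auto simp: two_sided_def)
qed

text \<open>Near a regular \<open>p0\<close> the Gauss map takes all directions close to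
  \<open>n p0\<close>, in particular one for which all critical points of the height are regular.
  The point \<open>p1\<close> with this normal is still two-sided, so it is neither the maximum
  \<open>a\<close> nor the minimum \<open>b\<close>, and three critical points result.\<close>

lemma two_sided_not_regular:
  assumes con: "connected M" and sc: "\<And>v. norm v = 1 \<Longrightarrow> simply_connected (shadow M n v)"
    and p0: "p0 \<in> M" and q: "q \<in> M" "q' \<in> M" "two_sided p0 q q'"
  shows "\<not> regular p0"
proof
  assume reg: "regular p0"
  define u0 where "u0 = n p0"
  have u0: "norm u0 = 1" using norm_gauss p0 by (simp add: u0_def)
  obtain e1 e2 where fr: "orthonormal_frame u0 e1 e2" using orthonormal_frame_exists u0 by blast
  let ?w = "frame_proj e1 e2"
  obtain \<iota> r where i: "r > 0" "continuous_on (ball 0 r) \<iota>" "openin (top_of_set M) (\<iota> ` ball 0 r)"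
    "\<And>z. z \<in> ball 0 r \<Longrightarrow> ?w (n (\<iota> z)) = z" "\<iota> 0 = p0"
    using regular_coordinate[OF p0 reg fr] u0_def by blast
  have iM: "\<iota> ` ball 0 r \<subseteq> M" using i(3) by (meson openin_imp_subset)
  \<comment> \<open>The hemisphere condition later recovers \<open>n p1\<close> from its
    projection.\<close>
  define V where "V = {p \<in> M. two_sided p q q'} \<inter> {p \<in> M. n p \<bullet> u0 > 0}"
  have "continuous_on M (\<lambda>p. n p \<bullet> u0)" by (intro continuous_intros continuous_on_n)
  then have "openin (top_of_set M) (M \<inter> (\<lambda>p. n p \<bullet> u0) -` {0<..})"
    by (auto intro: continuous_openin_preimage_gen)
  then have "openin (top_of_set M) {p \<in> M. n p \<bullet> u0 > 0}"
    by (rule arg_cong[THEN iffD1, rotated]) auto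
  then have opV: "openin (top_of_set M) V" unfolding V_def by (intro openin_Int openin_two_sided)
  have p0V: "p0 \<in> V" using p0 q u0 by (simp add: V_def u0_def dot_square_norm)
  have "openin (top_of_set (ball 0 r)) (ball 0 r \<inter> \<iota> -` V)"
    by (rule continuous_openin_preimage[OF i(2) _ opV]) (use iM in auto)
  then have "open (ball 0 r \<inter> \<iota> -` V)" using openin_open_trans by blast
  moreover have "0 \<in> ball 0 r \<inter> \<iota> -` V" using i(1,5) p0V by simp
  ultimately obtain \<delta> where \<delta>: "\<delta> > 0" "ball 0 \<delta> \<subseteq> ball 0 r \<inter> \<iota> -` V" using open_contains_ball by blast
  \<comment> \<open>The bound \<delta> puts the projection of \<open>u\<close> into the coordinate
    disc, and the bound 1 puts \<open>u\<close> into the hemisphere of \<open>u0\<close>.\<close>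
  obtain u where u: "norm u = 1" "dist u u0 < min \<delta> 1" "\<And>p. p \<in> M \<Longrightarrow> n p = u \<or> n p = - u \<Longrightarrow> regular p"
    using regular_direction_exists[OF u0, of "min \<delta> 1"] \<delta>(1) by auto
  define z where "z = ?w u"
  have "z = ?w (u - u0)"
    using frame_proj_pole[OF fr, of u0] linear_diff[OF bounded_linear.linear[OF bounded_linear_frame_proj]] by (simp add: z_def)
  then have "(norm z)\<^sup>2 \<le> (norm (u - u0))\<^sup>2" using frame_norm[OF fr, of "u - u0"] by simp
  then have "norm z \<le> norm (u - u0)" by (rule power2_le_imp_le) simp
  then have z: "z \<in> ball 0 \<delta>" using u(2) by (simp add: dist_norm)
  define p1 where "p1 = \<iota> z"
  have p1: "p1 \<in> V" "?w (n p1) = ?w u" using \<delta>(2) z i(4) by (auto simp: p1_def z_def)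
  have "(norm (u - u0))\<^sup>2 < 1" using u(2) by (simp add: dist_norm power_less_one_iff)
  moreover have "(norm (u - u0))\<^sup>2 = 2 - 2 * (u \<bullet> u0)"
    using u(1) u0 unfolding power2_norm_eq_inner norm_eq_1
    by (simp add: inner_diff_left inner_diff_right inner_commute)
  ultimately have "u \<bullet> u0 > 0" by simp
  then have n1: "n p1 = u"
    using frame_eqI[OF fr _ u(1) p1(2)] p1(1) norm_gauss by (simp add: V_def)
  obtain a where a: "a \<in> M" "\<And>q. q \<in> M \<Longrightarrow> f q \<bullet> u \<le> f a \<bullet> u" "n a = u \<or> n a = - u"
    using obtain_max_point[OF u(1) _ compact nonempty] by auto
  have u': "norm (- u) = 1" using u(1) by simp
  obtain b where b: "b \<in> M" "\<And>q. q \<in> M \<Longrightarrow> f b \<bullet> u \<le> f q \<bullet> u" "n b = u \<or> n b = - u"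
    using obtain_max_point[OF u' _ compact nonempty] by auto
  have "f q' \<bullet> u < f p1 \<bullet> u" "f p1 \<bullet> u < f q \<bullet> u"
    using p1(1) n1 by (auto simp: V_def two_sided_def inner_diff_right inner_commute)
  then have ne: "p1 \<noteq> a" "p1 \<noteq> b" "a \<noteq> b" using a(2)[OF q(1)] b(2)[OF q(2)] by auto
  have "p1 \<in> M" using p1(1) by (simp add: V_def)
  then show False
    using regular_three_normals[OF con sc u(1) \<open>p1 \<in> M\<close> a(1) b(1) ne(1,2,3) _ a(3) b(3) u(3) u(3)] n1 a by simp
qed

text \<open>At the maximum over \<open>(p, q, q')\<close> of the product of the heights of \<open>q\<close> above and \<open>q'\<close> below the tangent plane at \<open>p\<close>,
  plus a small multiple of \<open>\<bar>f p\<bar>\<^sup>2\<close>, the tangent plane at \<open>p\<close> still has points on both sides, so the surface is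
  flat around \<open>p\<close>.\<close>

lemma no_two_sided:
  assumes con: "connected M" and sc: "\<And>v. norm v = 1 \<Longrightarrow> simply_connected (shadow M n v)"
    and p0: "p0 \<in> M" and q: "q0 \<in> M" "q0' \<in> M"
  shows "\<not> two_sided p0 q0 q0'"
proof
  assume ts: "two_sided p0 q0 q0'"
  define T where "T \<epsilon> t = (case t of (p, q, q') \<Rightarrow> (n p \<bullet> (f q - f p)) * (n p \<bullet> (f p - f q')) + \<epsilon> * (f p \<bullet> f p))" for \<epsilon> t
  have "compact ((\<lambda>p. f p \<bullet> f p) ` M)"
    by (intro compact_continuous_image compact continuous_intros continuous_on_f)
  then obtain B where B: "B > 0" "\<And>p. p \<in> M \<Longrightarrow> f p \<bullet> f p \<le> B"
    using compact_imp_bounded bounded_pos by (metis (no_types, lifting) abs_le_D1 image_eqI real_norm_def)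
  define m where "m = T 0 (p0, q0, q0')"
  have m: "m > 0" using ts by (simp add: m_def T_def two_sided_def)
  \<comment> \<open>The perturbation is at most m/2, while the maximum is at least m, so the product
    of the heights stays positive at the maximum.\<close>
  define \<epsilon> where "\<epsilon> = m / (2 * B)"
  have \<epsilon>: "\<epsilon> > 0" using m B by (simp add: \<epsilon>_def)
  have cf: "continuous_on (M \<times> M \<times> M) (\<lambda>t. f (g t))" "continuous_on (M \<times> M \<times> M) (\<lambda>t. n (g t))"
    if "continuous_on (M \<times> M \<times> M) g" "g ` (M \<times> M \<times> M) \<subseteq> M" for g
    using that continuous_on_compose2[OF continuous_on_f] continuous_on_compose2[OF continuous_on_n] by auto
  have "continuous_on (M \<times> M \<times> M) (T \<epsilon>)"
    unfolding T_def case_prod_beta by (intro continuous_intros cf) auto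
  moreover have "compact (M \<times> M \<times> M)" "M \<times> M \<times> M \<noteq> {}"
    using compact nonempty by (auto intro: compact_Times)
  ultimately obtain t where t: "t \<in> M \<times> M \<times> M" "\<And>t'. t' \<in> M \<times> M \<times> M \<Longrightarrow> T \<epsilon> t' \<le> T \<epsilon> t"
    using continuous_attains_sup by metis
  obtain p q q' where pq: "t = (p, q, q')" by (cases t) auto
  have M: "p \<in> M" "q \<in> M" "q' \<in> M" using t(1) pq by auto
  have "m \<le> T \<epsilon> (p0, q0, q0')" using \<epsilon> by (simp add: m_def T_def)
  also have "\<dots> \<le> T \<epsilon> (p, q, q')" using t(2) p0 q pq by auto
  also have "\<dots> \<le> (n p \<bullet> (f q - f p)) * (n p \<bullet> (f p - f q')) + \<epsilon> * B"
    using \<epsilon> B(2)[OF M(1)] by (simp add: T_def mult_left_mono)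
  also have "\<epsilon> * B = m / 2" using B by (simp add: \<epsilon>_def)
  finally have "(n p \<bullet> (f q - f p)) * (n p \<bullet> (f p - f q')) > 0" using m by simp
  \<comment> \<open>A positive product also arises from two negative heights; then \<open>q\<close>
    and \<open>q'\<close> exchange roles.\<close>
  then consider "two_sided p q q'" | "two_sided p q' q"
    unfolding two_sided_def zero_less_mult_iff by (fastforce simp: inner_diff_right)
  then obtain q1 q2 where q12: "q1 \<in> M" "q2 \<in> M" "two_sided p q1 q2" using M by metis
  define V where "V = {p \<in> M. two_sided p q1 q2}"
  have V: "openin (top_of_set M) V" "p \<in> V" unfolding V_def using openin_two_sided M(1) q12 by auto
  obtain U \<phi> where c: "(U, \<phi>) \<in> A" "p \<in> U" using obtain_chart M(1) by blast
  let ?\<psi> = "inv_into U \<phi>"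
  note F = chart_facts[OF c(1)]
  have op: "open (\<phi> ` (U \<inter> V))" by (rule open_chart_image[OF c(1) V(1)])
  have sub: "\<phi> ` (U \<inter> V) \<subseteq> \<phi> ` U" by blast
  have x: "\<phi> p \<in> \<phi> ` (U \<inter> V)" using c(2) V(2) by blast
  have Ck_sub: "Ck_on k g S" if "Ck_on k g T" "S \<subseteq> T" for k S T and g :: "real^2 \<Rightarrow> real^3"
    using that by (induction k arbitrary: g) (auto intro: continuous_on_subset)
  show False
  proof (rule flat_no_local_max[OF op x Ck_sub[OF F(4) sub] Ck_sub[OF F(5) sub]])
    show "\<And>x v. x \<in> \<phi> ` (U \<inter> V) \<Longrightarrow> (n \<circ> ?\<psi>) x \<bullet> pd v (f \<circ> ?\<psi>) x = 0" using F(7) sub by blast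
    show "\<And>x. x \<in> \<phi> ` (U \<inter> V) \<Longrightarrow> norm ((n \<circ> ?\<psi>) x) = 1" using F(6) sub by blast
    show "inj (\<lambda>v. pd v (f \<circ> ?\<psi>) (\<phi> p))" using F(8) sub x by blast
    show "\<epsilon> > 0" by fact
    show "\<exists>v. v \<noteq> 0 \<and> pd v (n \<circ> ?\<psi>) x = 0" if x: "x \<in> \<phi> ` (U \<inter> V)" for x
    proof -
      obtain s where s: "s \<in> U" "s \<in> V" "x = \<phi> s" using x by blast
      then have "\<not> regular s" using two_sided_not_regular[OF con sc _ q12(1,2)] by (simp add: V_def)
      then have "\<not> inj (\<lambda>v. pd v (n \<circ> ?\<psi>) x)"
        using c(1) s F(9)[OF s(1)] unfolding regular_def by force
      then show ?thesis using linear_injective_0[OF linear_pd[OF F(5)]] sub x by blast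
    qed
    show "((n \<circ> ?\<psi>) y \<bullet> (f q - (f \<circ> ?\<psi>) y)) * ((n \<circ> ?\<psi>) y \<bullet> ((f \<circ> ?\<psi>) y - f q')) + \<epsilon> * ((f \<circ> ?\<psi>) y \<bullet> (f \<circ> ?\<psi>) y) \<le>
      ((n \<circ> ?\<psi>) (\<phi> p) \<bullet> (f q - (f \<circ> ?\<psi>) (\<phi> p))) * ((n \<circ> ?\<psi>) (\<phi> p) \<bullet> ((f \<circ> ?\<psi>) (\<phi> p) - f q')) + \<epsilon> * ((f \<circ> ?\<psi>) (\<phi> p) \<bullet> (f \<circ> ?\<psi>) (\<phi> p))"
      if y: "y \<in> \<phi> ` (U \<inter> V)" for y
    proof -
      obtain s where s: "s \<in> U" "y = \<phi> s" using y by blast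
      then have "T \<epsilon> (s, q, q') \<le> T \<epsilon> (p, q, q')" using t(2)[of "(s, q, q')"] pq M F(11) by auto
      then show ?thesis using s F(10) c(2) by (simp add: T_def)
    qed
  qed
qed

end

section \<open>Convex bodies\<close>

text \<open>\<open>R\<close> may touch the frontier, so the hyperplane is found for the interior of
  \<open>K\<close>, and the inequality extends to its closure.\<close>

lemma convex_body_separation:
  fixes K R :: "'a::euclidean_space set"
  assumes K: "convex_body K" and R: "convex R" "R \<noteq> {}" "R \<inter> interior K = {}"
  obtains a b where "a \<noteq> 0" "\<And>x. x \<in> R \<Longrightarrow> b \<le> a \<bullet> x" "\<And>y. y \<in> K \<Longrightarrow> a \<bullet> y \<le> b"
proof -
  have K': "convex K" "interior K \<noteq> {}" "compact K" using K by (auto simp: convex_body_def)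
  obtain a b where ab: "a \<noteq> 0" "\<forall>x\<in>interior K. a \<bullet> x \<le> b" "\<forall>x\<in>R. b \<le> a \<bullet> x"
    using separating_hyperplane_sets[OF convex_interior[OF K'(1)] R(1) K'(2) R(2)] R(3) by auto
  have "closure (interior K) \<subseteq> {y. a \<bullet> y \<le> b}"
    using ab(2) by (intro closure_minimal closed_halfspace_le) auto
  then have "a \<bullet> y \<le> b" if "y \<in> K" for y
    using that convex_closure_interior[OF K'(1,2)] closure_subset[of K] by auto
  then show ?thesis using that[of a b] ab(1,3) by auto
qed

lemma interior_halfspace_strict:
  fixes a :: "'a::euclidean_space"
  assumes a: "a \<noteq> 0" "\<And>y. y \<in> K \<Longrightarrow> a \<bullet> y \<le> b" and x: "x \<in> interior K"
  shows "a \<bullet> x < b"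
proof -
  obtain e where e: "e > 0" "ball x e \<subseteq> K" using x mem_interior by blast
  define y where "y = x + (e / (2 * norm a)) *\<^sub>R a"
  have "y \<in> ball x e" using e(1) a(1) by (simp add: y_def dist_norm)
  then have "a \<bullet> y \<le> b" using e(2) a(2) by blast
  moreover have "a \<bullet> y = a \<bullet> x + (e / (2 * norm a)) * (a \<bullet> a)" by (simp add: y_def inner_add_right)
  moreover have "(e / (2 * norm a)) * (a \<bullet> a) > 0" using e(1) a(1) by simp
  ultimately show ?thesis by linarith
qed

text \<open>Of two frontier points on a ray from an interior point, the nearer one would be an
  interior point. This makes radial projection to the frontier well defined.\<close>

lemma convex_body_ray_unique:
  fixes K :: "'a::euclidean_space set"
  assumes K: "convex_body K" and o: "p \<in> interior K" and x: "x \<in> frontier K" "y \<in> frontier K"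
    and t: "y - p = t *\<^sub>R (x - p)" "t > 0"
  shows "t = 1"
proof -
  have K': "convex K" "closed K" using K by (auto simp: convex_body_def compact_imp_closed)
  have *: False if "u \<in> frontier K" "v \<in> frontier K" "v - p = s *\<^sub>R (u - p)" "0 < s" "s < 1" for u v s
  proof -
    have "u \<in> closure K" "v \<notin> interior K" using that by (auto simp: frontier_def)
    moreover have "v = (1 - s) *\<^sub>R p + s *\<^sub>R u" using that(3) by (simp add: algebra_simps)
    moreover have "p \<noteq> u" using that(1) o by (auto simp: frontier_def)
    ultimately have "v \<in> open_segment p u" using that(4,5) by (auto simp: in_segment)
    then show False
      using in_interior_closure_convex_segment[OF K'(1) o \<open>u \<in> closure K\<close>] \<open>v \<notin> interior K\<close> by blast
  qed
  have "x - p = (1 / t) *\<^sub>R (y - p)" using t by simp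
  then show ?thesis using *[OF x t] *[OF x(2,1), of "1 / t"] t(2) by (cases "t < 1"; cases "t > 1") auto
qed

lemma connected_frontier_convex_body:
  fixes K :: "(real^3) set"
  assumes "convex_body K"
  shows "connected (frontier K)"
proof -
  have K: "convex K" "bounded K" "interior K \<noteq> {}" using assms by (auto simp: convex_body_def compact_imp_bounded)
  have "aff_dim K = 3" using aff_dim_nonempty_interior[OF K(3)] by simp
  moreover have "rel_frontier K = frontier K"
    using rel_interior_nonempty_interior[OF K(3)] by (simp add: rel_frontier_def frontier_def)
  ultimately show ?thesis using connected_sphere_gen[OF K(1,2)] by simp
qed

text \<open>The part of the boundary illuminated from the direction \<open>u\<close> is a retract of the convex cylinder
  \<open>interior K + \<real> u\<close>: the retraction moves each point along \<open>u\<close> up to its exit point from \<open>K\<close>,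
  which is continuous because the height of the exit point is concave.\<close>

lemma illuminated_frontier_simply_connected:
  fixes K :: "'a::euclidean_space set"
  assumes K: "convex_body K" and u: "u \<noteq> 0"
  shows "simply_connected {x \<in> frontier K. \<exists>t>0. x - t *\<^sub>R u \<in> interior K}" (is "simply_connected ?X")
proof -
  have K': "convex K" "closed K" "bounded K" "interior K \<noteq> {}"
    using K by (auto simp: convex_body_def compact_imp_closed compact_imp_bounded)
  define C where "C = {y. \<exists>t. y + t *\<^sub>R u \<in> interior K}"
  define T where "T y = {t. y + t *\<^sub>R u \<in> K}" for y
  define h where "h y = Sup (T y)" for y
  obtain B where B: "B > 0" "\<And>x. x \<in> K \<Longrightarrow> norm x \<le> B" using K'(3) bounded_pos by metis
  have bddT: "bdd_above (T y)" for y
  proof (rule bdd_aboveI)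
    fix t assume "t \<in> T y"
    then have "norm (y + t *\<^sub>R u) \<le> B" using B(2) by (simp add: T_def)
    then have "norm (t *\<^sub>R u) \<le> B + norm y"
      using norm_triangle_ineq4[of "y + t *\<^sub>R u" y] by simp
    then have "\<bar>t\<bar> \<le> (B + norm y) / norm u" using u by (simp add: pos_le_divide_eq)
    then show "t \<le> (B + norm y) / norm u" by linarith
  qed
  have neT: "T y \<noteq> {}" if "y \<in> C" for y using that interior_subset by (auto simp: C_def T_def)
  have closedT: "closed (T y)" for y
  proof -
    have "T y = (\<lambda>t. y + t *\<^sub>R u) -` K" by (auto simp: T_def)
    then show ?thesis using K'(2) by (auto intro!: closed_vimage continuous_intros)
  qed
  have hT: "y + h y *\<^sub>R u \<in> K" if "y \<in> C" for y
    using closed_contains_Sup[OF neT[OF that] bddT closedT] by (simp add: h_def T_def)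
  have hmax: "t \<le> h y" if "y + t *\<^sub>R u \<in> K" for t y
    unfolding h_def by (rule cSup_upper[OF _ bddT]) (use that in \<open>simp add: T_def\<close>)
  have openC: "open C"
  proof -
    have "C = (\<Union>t. (\<lambda>y. y + t *\<^sub>R u) -` interior K)" by (auto simp: C_def)
    then show ?thesis by (auto intro!: open_vimage continuous_intros)
  qed
  have convC: "convex C"
  proof (rule convexI)
    fix x y a b assume xy: "x \<in> C" "y \<in> C" and ab: "0 \<le> a" "0 \<le> b" "a + b = (1::real)"
    obtain s t where "x + s *\<^sub>R u \<in> interior K" "y + t *\<^sub>R u \<in> interior K" using xy by (auto simp: C_def)
    from convexD[OF convex_interior[OF K'(1)] this ab]
    have "a *\<^sub>R x + b *\<^sub>R y + (a * s + b * t) *\<^sub>R u \<in> interior K" by (simp add: algebra_simps)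
    then show "a *\<^sub>R x + b *\<^sub>R y \<in> C" by (auto simp: C_def)
  qed
  have "convex_on C (\<lambda>y. - h y)"
  proof (rule convex_onI)
    fix t :: real and x y assume t: "0 < t" "t < 1" and xy: "x \<in> C" "y \<in> C"
    have "(1 - t) *\<^sub>R (x + h x *\<^sub>R u) + t *\<^sub>R (y + h y *\<^sub>R u) \<in> K"
      by (rule convexD[OF K'(1) hT[OF xy(1)] hT[OF xy(2)]]) (use t in auto)
    then have "((1 - t) *\<^sub>R x + t *\<^sub>R y) + ((1 - t) * h x + t * h y) *\<^sub>R u \<in> K" by (simp add: algebra_simps)
    from hmax[OF this] show "- h ((1 - t) *\<^sub>R x + t *\<^sub>R y) \<le> (1 - t) * - h x + t * - h y" by simp
  qed (fact convC)
  then have "continuous_on C (\<lambda>y. - (- h y))"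
    using convex_on_continuous[OF openC] continuous_on_minus by blast
  then have conth: "continuous_on C h" by simp
  define r where "r y = y + h y *\<^sub>R u" for y
  have rX: "r y \<in> ?X" if y: "y \<in> C" for y
  proof -
    have rK: "r y \<in> K" using hT[OF y] by (simp add: r_def)
    have "r y \<notin> interior K"
    proof
      assume "r y \<in> interior K"
      then obtain e where e: "e > 0" "ball (r y) e \<subseteq> K" using mem_interior by blast
      define d where "d = e / (2 * norm u)"
      have d: "d > 0" using e u by (simp add: d_def)
      have "r y + d *\<^sub>R u \<in> ball (r y) e" using e u by (simp add: d_def dist_norm)
      then have "y + (h y + d) *\<^sub>R u \<in> K" using e(2) by (auto simp: r_def algebra_simps)
      then show False using hmax d by fastforce
    qed
    moreover obtain s where s: "y + s *\<^sub>R u \<in> interior K" using y by (auto simp: C_def)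
    ultimately have "s \<noteq> h y" by (auto simp: r_def)
    moreover have "s \<le> h y" using hmax s interior_subset by blast
    ultimately have "h y - s > 0" by simp
    moreover have "r y - (h y - s) *\<^sub>R u \<in> interior K" using s by (simp add: r_def algebra_simps)
    ultimately have "\<exists>t>0. r y - t *\<^sub>R u \<in> interior K" by blast
    then show ?thesis
      using rK \<open>r y \<notin> interior K\<close> closure_subset[of K] by (auto simp: frontier_def)
  qed
  have XC: "?X \<subseteq> C"
  proof
    fix x assume "x \<in> ?X"
    then obtain t where "x + (- t) *\<^sub>R u \<in> interior K" by auto
    then show "x \<in> C" unfolding C_def by blast
  qed
  have rid: "r x = x" if x: "x \<in> ?X" for x
  proof -
    obtain t where t: "t > 0" "x - t *\<^sub>R u \<in> interior K" using x by blast
    have xK: "x \<in> K" "x \<notin> interior K" using x K'(2) by (auto simp: frontier_def)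
    then have "0 \<le> h x" by (intro hmax) simp
    moreover have "\<not> 0 < h x"
    proof
      assume h: "0 < h x"
      \<comment> \<open>The barycentric coordinate that puts x strictly between the interior point
        and the exit point. Then x would be interior.\<close>
      define c where "c = t / (t + h x)"
      have c: "0 < c" "c < 1" using t h by (auto simp: c_def)
      have ch: "c * (h x + t) = t" using t h by (simp add: c_def add.commute)
      have "(1 - c) *\<^sub>R (x - t *\<^sub>R u) + c *\<^sub>R (x + h x *\<^sub>R u) = x + (c * (h x + t) - t) *\<^sub>R u"
        by (simp add: algebra_simps)
      then have "x = (1 - c) *\<^sub>R (x - t *\<^sub>R u) + c *\<^sub>R (x + h x *\<^sub>R u)" using ch by simp
      moreover have "x - t *\<^sub>R u \<noteq> x + h x *\<^sub>R u"
      proof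
        assume "x - t *\<^sub>R u = x + h x *\<^sub>R u"
        then have "(t + h x) *\<^sub>R u = 0" by (simp add: algebra_simps)
        then show False using t h u by simp
      qed
      ultimately have "x \<in> open_segment (x - t *\<^sub>R u) (x + h x *\<^sub>R u)"
        unfolding in_segment using c by blast
      moreover have "x + h x *\<^sub>R u \<in> closure K" using hT x XC closure_subset by blast
      ultimately show False
        using in_interior_closure_convex_segment[OF K'(1) t(2)] xK(2) by blast
    qed
    ultimately show ?thesis by (simp add: r_def)
  qed
  show ?thesis
  proof (rule simply_connected_retraction_gen[of C r ?X id])
    show "simply_connected C" by (rule convex_imp_simply_connected[OF convC])
    show "continuous_on C r" unfolding r_def by (intro continuous_intros conth)
    show "r ` C = ?X"
    proof
      show "r ` C \<subseteq> ?X" using rX by (rule image_subsetI)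
      show "?X \<subseteq> r ` C" using rid XC by (metis (no_types, lifting) image_eqI subsetD subsetI)
    qed
  qed (use XC rid in auto)
qed

section \<open>From simply connected shadows to a convex embedding\<close>

context closed_surface
begin

text \<open>In a plane orthogonal to \<open>u\<close>, all normals would be \<open>u\<close> or
  \<open>- u\<close>. But the highest point in a direction \<open>w\<close> orthogonal to
  \<open>u\<close> has normal \<open>w\<close> or \<open>- w\<close>.\<close>

lemma not_planar:
  assumes u: "norm u = 1"
  obtains p q where "p \<in> M" "q \<in> M" "f p \<bullet> u < f q \<bullet> u"
proof -
  have False if *: "\<forall>p\<in>M. \<forall>q\<in>M. f p \<bullet> u \<le> f q \<bullet> u"
  proof -
    obtain w e2 where fr: "orthonormal_frame u w e2" using orthonormal_frame_exists u by blast
    have nw: "norm w = 1" using fr by (simp add: orthonormal_frame_def)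
    obtain p where p: "p \<in> M" "n p = w \<or> n p = - w"
      using obtain_max_point[OF nw _ compact nonempty] by auto
    have "n p = u \<or> n p = - u"
      by (rule local_max_normal[OF _ p(1) _ u]) (use * p in auto)
    then show False
      using p(2) orthonormal_frame_inner[OF fr] by (metis inner_minus_left inner_zero_right neg_equal_0_iff_equal zero_neq_one)
  qed
  then show ?thesis using that by (meson not_le)
qed

text \<open>If \<open>V\<close> and \<open>W\<close> separate \<open>M\<close>, the normals of \<open>V\<close> contain \<open>w\<close> or \<open>-w\<close> for every \<open>w\<close>, hence a pair \<open>w, -w\<close>.
  No shadow meets both parts, so no normal of \<open>W\<close> makes an acute angle with \<open>w\<close> or \<open>-w\<close>, and all of them are
  orthogonal to \<open>w\<close>.\<close>

lemma connected_of_simply_connected_shadows: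
  assumes sc: "\<And>v. norm v = 1 \<Longrightarrow> simply_connected (shadow M n v)"
  shows "connected M"
proof (rule ccontr)
  assume "\<not> connected M"
  then obtain V W where VW: "openin (top_of_set M) V" "openin (top_of_set M) W" "M \<subseteq> V \<union> W" "V \<inter> W = {}"
    "V \<noteq> {}" "W \<noteq> {}"
    unfolding connected_openin by blast
  have sub: "V \<subseteq> M" "W \<subseteq> M" using VW(1,2) by (meson openin_imp_subset)+
  have "V = M - W" "W = M - V" using VW(3,4) sub by auto
  then have "closedin (top_of_set M) V" "closedin (top_of_set M) W"
    using VW(1,2) by (metis closedin_diff closedin_subtopology_refl topspace_euclidean_subtopology closedin_topspace)+
  then have cpt: "compact V" "compact W" using closedin_compact[OF compact] by blast+
  have cover: "\<exists>p\<in>V. n p = w \<or> n p = - w" "\<exists>p\<in>W. n p = w \<or> n p = - w" if "norm w = 1" for w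
    using obtain_max_point[OF that VW(1) cpt(1) VW(5)] obtain_max_point[OF that VW(2) cpt(2) VW(6)] by metis+
  \<comment> \<open>The closed set of normals of \<open>V\<close> and its negative cover the
    connected sphere, so they meet.\<close>
  have "\<exists>p\<in>V. \<exists>p'\<in>V. n p' = - n p"
  proof -
    have cl: "closed (n ` V)"
      using cpt(1) sub(1) by (intro compact_imp_closed compact_continuous_image continuous_on_subset[OF continuous_on_n])
    then have cl': "closed (uminus ` n ` V)" by (rule closed_negations)
    have cov: "sphere 0 1 \<subseteq> n ` V \<union> uminus ` n ` V"
    proof
      fix w :: "real^3" assume "w \<in> sphere 0 1"
      then obtain p where "p \<in> V" "n p = w \<or> n p = - w" using cover(1)[of w] by auto
      then have "w = n p \<or> w = - n p" by auto
      then show "w \<in> n ` V \<union> uminus ` n ` V" using \<open>p \<in> V\<close> by blast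
    qed
    obtain p0 where "p0 \<in> V" using VW(5) by blast
    then have "n p0 \<in> n ` V \<inter> sphere 0 1" "- n p0 \<in> uminus ` n ` V \<inter> sphere 0 1"
      using norm_gauss sub(1) by auto
    moreover have "connected (sphere (0 :: real^3) 1)" by (rule connected_sphere) simp
    ultimately have "n ` V \<inter> uminus ` n ` V \<inter> sphere 0 1 \<noteq> {}"
      using connected_closedD[OF _ _ cov cl cl'] by (metis empty_iff)
    then obtain p p' where "p \<in> V" "p' \<in> V" "n p = - n p'" by blast
    then show ?thesis by force
  qed
  then obtain p p' where pp: "p \<in> V" "p' \<in> V" "n p' = - n p" by blast
  have sep: "n a \<bullet> n b \<le> 0" if ab: "a \<in> V" "b \<in> W" for a b
  proof (rule ccontr)
    assume pos: "\<not> n a \<bullet> n b \<le> 0"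
    have nab: "norm (n a) = 1" "norm (n b) = 1" using norm_gauss ab sub by blast+
    \<comment> \<open>The bisector of two normals at an acute angle: its shadow contains both points
      and is path connected, which the separation forbids.\<close>
    define v where "v = (1 / norm (n a + n b)) *\<^sub>R (n a + n b)"
    have "n a \<bullet> (n a + n b) > 0" "n b \<bullet> (n a + n b) > 0"
      using nab pos by (simp_all add: inner_add_right dot_square_norm inner_commute)
    moreover from this have "n a + n b \<noteq> 0" by auto
    ultimately have v: "norm v = 1" "n a \<bullet> v > 0" "n b \<bullet> v > 0" by (simp_all add: v_def)
    then have "a \<in> shadow M n v" "b \<in> shadow M n v" using ab sub by (auto simp: shadow_def)
    then obtain g where g: "path g" "path_image g \<subseteq> shadow M n v" "pathstart g = a" "pathfinish g = b"
      using simply_connected_obtain_path[OF sc[OF v(1)]] by blast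
    have gM: "path_image g \<subseteq> M" using g(2) by (auto simp: shadow_def)
    have "openin (top_of_set (path_image g)) (path_image g \<inter> V)" "openin (top_of_set (path_image g)) (path_image g \<inter> W)"
      using VW(1,2) gM by (metis inf.absorb_iff2 inf_commute openin_subtopology_Int2 subtopology_subtopology)+
    moreover have "a \<in> path_image g \<inter> V" "b \<in> path_image g \<inter> W"
      using g ab by (metis IntI pathstart_in_path_image, metis IntI pathfinish_in_path_image)
    ultimately show False
      using connected_path_image[OF g(1)] VW(3,4) gM unfolding connected_openin by blast
  qed
  have "n p \<bullet> n b = 0" if "b \<in> W" for b
    using sep[OF pp(1) that] sep[OF pp(2) that] pp(3) by simp
  moreover obtain b where "b \<in> W" "n b = n p \<or> n b = - n p" using cover(2) norm_gauss pp(1) sub(1) by blast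
  ultimately have "n p \<bullet> n p = 0" by (metis inner_minus_right neg_equal_0_iff_equal)
  then show False using norm_gauss[of p] pp(1) sub(1) by auto
qed

text \<open>For each point some side of the tangent plane is free of the surface, but the side could
  vary. The points with something strictly above and those with something strictly below form
  disjoint open sets covering the connected \<open>M\<close>, so one sign serves everywhere.\<close>

lemma one_sided:
  assumes sc: "\<And>v. norm v = 1 \<Longrightarrow> simply_connected (shadow M n v)"
  obtains \<sigma> :: real where "\<bar>\<sigma>\<bar> = 1" "\<And>p q. p \<in> M \<Longrightarrow> q \<in> M \<Longrightarrow> (\<sigma> *\<^sub>R n p) \<bullet> f q \<le> (\<sigma> *\<^sub>R n p) \<bullet> f p"
proof -
  have con: "connected M" by (rule connected_of_simply_connected_shadows[OF sc])
  define P where "P q = {p \<in> M. n p \<bullet> (f q - f p) > 0}" for q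
  define N where "N q = {p \<in> M. n p \<bullet> (f q - f p) < 0}" for q
  have "openin (top_of_set M) (P q)" "openin (top_of_set M) (N q)" for q
  proof -
    have c: "continuous_on M (\<lambda>p. n p \<bullet> (f q - f p))"
      by (intro continuous_intros continuous_on_f continuous_on_n)
    have "P q = M \<inter> (\<lambda>p. n p \<bullet> (f q - f p)) -` {0<..}" "N q = M \<inter> (\<lambda>p. n p \<bullet> (f q - f p)) -` {..<0}"
      by (auto simp: P_def N_def)
    then show "openin (top_of_set M) (P q)" "openin (top_of_set M) (N q)"
      using continuous_openin_preimage_gen[OF c] by auto
  qed
  then have op: "openin (top_of_set M) (\<Union>q\<in>M. P q)" "openin (top_of_set M) (\<Union>q\<in>M. N q)"
    by (auto intro: openin_Union)
  have "(\<Union>q\<in>M. P q) \<inter> (\<Union>q\<in>M. N q) = {}"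
  proof -
    have "two_sided p q q'" if "p \<in> P q" "p \<in> N q'" for p q q'
      using that by (auto simp: two_sided_def P_def N_def inner_diff_right)
    then show ?thesis using no_two_sided[OF con sc] by (fastforce simp: P_def)
  qed
  moreover have "M \<subseteq> (\<Union>q\<in>M. P q) \<union> (\<Union>q\<in>M. N q)"
  proof
    fix p assume p: "p \<in> M"
    obtain a b where ab: "a \<in> M" "b \<in> M" "f a \<bullet> n p < f b \<bullet> n p" using not_planar[OF norm_gauss[OF p]] by blast
    then have "n p \<bullet> (f a - f p) < 0 \<or> n p \<bullet> (f b - f p) > 0"
      by (auto simp: inner_diff_right inner_commute)
    then show "p \<in> (\<Union>q\<in>M. P q) \<union> (\<Union>q\<in>M. N q)" using p ab by (auto simp: P_def N_def)
  qed
  ultimately have "(\<Union>q\<in>M. P q) = {} \<or> (\<Union>q\<in>M. N q) = {}"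
    using con[unfolded connected_openin, simplified not_ex, rule_format, of "\<Union>q\<in>M. P q" "\<Union>q\<in>M. N q"] op by argo
  then show ?thesis
  proof
    assume "(\<Union>q\<in>M. P q) = {}"
    then have "\<not> n p \<bullet> (f q - f p) > 0" if "p \<in> M" "q \<in> M" for p q using that by (auto simp: P_def)
    then show ?thesis using that[of 1] by (force simp: inner_diff_right)
  next
    assume "(\<Union>q\<in>M. N q) = {}"
    then have "\<not> n p \<bullet> (f q - f p) < 0" if "p \<in> M" "q \<in> M" for p q using that by (auto simp: N_def)
    then show ?thesis using that[of "-1"] by (force simp: inner_diff_right)
  qed
qed

text \<open>The surface lies in the boundary of its convex hull.  Locally it is open there by invariance of domain,
  applied to the cone over a piece of the surface with apex in the interior of the hull.\<close>

lemma locally_open_in_frontier: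
  assumes K: "convex_body K" and fK: "f ` M \<subseteq> frontier K" and V: "openin (top_of_set M) V" "p \<in> V"
  obtains W where "W \<subseteq> V" "openin (top_of_set M) W" "p \<in> W" "inj_on f W" "openin (top_of_set (frontier K)) (f ` W)"
proof -
  have "p \<in> M" using V openin_imp_subset by blast
  then obtain U \<phi> where c: "(U, \<phi>) \<in> A" "p \<in> U" by (rule obtain_chart)
  let ?\<psi> = "inv_into U \<phi>"
  note F = chart_facts[OF c(1)]
  have op: "open (\<phi> ` (U \<inter> V))" by (rule open_chart_image[OF c(1) V(1)])
  have sub: "\<phi> ` (U \<inter> V) \<subseteq> \<phi> ` U" by blast
  have x: "\<phi> p \<in> \<phi> ` (U \<inter> V)" using c(2) V(2) by blast
  then have xU: "\<phi> p \<in> \<phi> ` U" using sub by blast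
  obtain r where r: "r > 0" "ball (\<phi> p) r \<subseteq> \<phi> ` (U \<inter> V)" "inj_on (f \<circ> ?\<psi>) (ball (\<phi> p) r)"
  proof (rule locally_injective_of_derivative[OF op x])
    show "((f \<circ> ?\<psi>) has_derivative (\<lambda>v. pd v (f \<circ> ?\<psi>) y)) (at y)" if "y \<in> \<phi> ` (U \<inter> V)" for y
      using has_derivative_pd[OF F(4)] that sub by blast
    show "continuous_on (\<phi> ` (U \<inter> V)) (\<lambda>y. pd v (f \<circ> ?\<psi>) y)" for v
      using continuous_on_subset[OF continuous_on_pd[OF F(4,2)] sub] .
    show "inj (\<lambda>v. pd v (f \<circ> ?\<psi>) (\<phi> p))" by (rule F(8)[OF xU])
  qed
  let ?B = "ball (\<phi> p) r"
  define W where "W = ?\<psi> ` ?B"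
  have BU: "?B \<subseteq> \<phi> ` U" using r(2) sub by blast
  have WV: "W \<subseteq> V"
  proof
    fix y assume "y \<in> W"
    then obtain z where "z \<in> ?B" "y = ?\<psi> z" by (auto simp: W_def)
    then obtain s where "s \<in> U" "s \<in> V" "z = \<phi> s" using r(2) by blast
    then show "y \<in> V" using F(10) \<open>y = ?\<psi> z\<close> by simp
  qed
  have WM: "W \<subseteq> M" using WV V(1) openin_imp_subset by blast
  have "openin (top_of_set (\<phi> ` U)) ?B" using BU by (simp add: open_subset)
  then have "openin (top_of_set U) W"
    unfolding W_def using homeomorphism_imp_open_map[OF homeomorphism_symD[OF F(3)]] by blast
  then have opW: "openin (top_of_set M) W" using F(1) openin_trans by blast
  have pW: "p \<in> W" unfolding W_def using r(1) F(10)[OF c(2)] by (metis centre_in_ball imageI)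
  have injW: "inj_on f W" unfolding W_def using r(3) by (rule inj_on_imageI)
  obtain a where a: "a \<in> interior K" using K by (auto simp: convex_body_def)
  define \<Phi> where "\<Phi> = (\<lambda>(x, t). a + t *\<^sub>R ((f \<circ> ?\<psi>) x - a))"
  have fr: "(f \<circ> ?\<psi>) x \<in> frontier K" if "x \<in> ?B" for x
  proof -
    have "?\<psi> x \<in> M" using that WM by (auto simp: W_def)
    then show ?thesis using fK by auto
  qed
  have "open (\<Phi> ` (?B \<times> {0<..}))"
  proof (rule invariance_of_domain_gen)
    have "continuous_on ?B (f \<circ> ?\<psi>)"
      using continuous_on_subset[OF Ck_on_continuous[OF F(4)] BU] .
    then have "continuous_on (?B \<times> {0<..}) (\<lambda>y. (f \<circ> ?\<psi>) (fst y))"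
      by (rule continuous_on_compose2) (auto intro: continuous_intros)
    then show "continuous_on (?B \<times> {0<..}) \<Phi>"
      unfolding \<Phi>_def case_prod_beta by (intro continuous_intros)
    show "inj_on \<Phi> (?B \<times> {0<..})"
    proof (rule inj_onI, clarify)
      fix x y and s t :: real
      assume xy: "x \<in> ?B" "y \<in> ?B" and st: "0 < s" "0 < t" and "\<Phi> (x, s) = \<Phi> (y, t)"
      then have eq: "s *\<^sub>R ((f \<circ> ?\<psi>) x - a) = t *\<^sub>R ((f \<circ> ?\<psi>) y - a)" by (simp add: \<Phi>_def)
      then have "(1 / t) *\<^sub>R (s *\<^sub>R ((f \<circ> ?\<psi>) x - a)) = (f \<circ> ?\<psi>) y - a" using st by simp
      then have "(f \<circ> ?\<psi>) y - a = (s / t) *\<^sub>R ((f \<circ> ?\<psi>) x - a)" by simp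
      from convex_body_ray_unique[OF K a fr[OF xy(1)] fr[OF xy(2)] this] have "s / t = 1" using st by simp
      then have "s = t" using st by simp
      then have "(f \<circ> ?\<psi>) x = (f \<circ> ?\<psi>) y" using eq st by simp
      from inj_onD[OF r(3) this xy] show "x = y \<and> s = t" using \<open>s = t\<close> by simp
    qed
  qed (auto simp: open_Times)
  moreover have "f ` W = frontier K \<inter> \<Phi> ` (?B \<times> {0<..})"
  proof
    show "f ` W \<subseteq> frontier K \<inter> \<Phi> ` (?B \<times> {0<..})"
    proof
      fix y assume "y \<in> f ` W"
      then obtain x where x: "x \<in> ?B" "y = (f \<circ> ?\<psi>) x" by (auto simp: W_def)
      have "y \<in> frontier K" using fr[OF x(1)] x(2) by simp
      moreover have "y = \<Phi> (x, 1)" using x(2) by (simp add: \<Phi>_def)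
      then have "y \<in> \<Phi> ` (?B \<times> {0<..})" using x(1) by (intro image_eqI[of _ _ "(x, 1)"]) auto
      ultimately show "y \<in> frontier K \<inter> \<Phi> ` (?B \<times> {0<..})" by blast
    qed
    show "frontier K \<inter> \<Phi> ` (?B \<times> {0<..}) \<subseteq> f ` W"
    proof
      fix y assume y: "y \<in> frontier K \<inter> \<Phi> ` (?B \<times> {0<..})"
      then obtain x t where xt: "x \<in> ?B" "t > 0" "y = \<Phi> (x, t)" by auto
      then have "y - a = t *\<^sub>R ((f \<circ> ?\<psi>) x - a)" by (simp add: \<Phi>_def)
      then have "t = 1" using convex_body_ray_unique[OF K a fr[OF xt(1)]] y xt(2) by blast
      then have "y = f (?\<psi> x)" using xt(3) by (simp add: \<Phi>_def)
      then show "y \<in> f ` W" using xt(1) by (auto simp: W_def)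
    qed
  qed
  ultimately have "openin (top_of_set (frontier K)) (f ` W)" by (simp add: openin_open_Int)
  then show ?thesis using that WV opW pW injW by blast
qed

lemma convex_embedding_of_shadows:
  assumes sc: "\<And>v. norm v = 1 \<Longrightarrow> simply_connected (shadow M n v)"
  shows "convex_embedding M f"
proof -
  have con: "connected M" by (rule connected_of_simply_connected_shadows[OF sc])
  obtain \<sigma> :: real where \<sigma>: "\<bar>\<sigma>\<bar> = 1" "\<And>p q. p \<in> M \<Longrightarrow> q \<in> M \<Longrightarrow> (\<sigma> *\<^sub>R n p) \<bullet> f q \<le> (\<sigma> *\<^sub>R n p) \<bullet> f p"
    using one_sided[OF sc] by blast
  define K where "K = convex hull (f ` M)"
  have cptf: "compact (f ` M)" using compact_continuous_image[OF continuous_on_f compact] .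
  have fK: "f p \<in> K" if "p \<in> M" for p using that by (simp add: K_def hull_inc)
  have support: "(\<sigma> *\<^sub>R n p) \<bullet> y \<le> (\<sigma> *\<^sub>R n p) \<bullet> f p" if "p \<in> M" "y \<in> K" for p y
  proof -
    have "K \<subseteq> {y. (\<sigma> *\<^sub>R n p) \<bullet> y \<le> (\<sigma> *\<^sub>R n p) \<bullet> f p}"
      unfolding K_def
    proof (rule hull_minimal)
      show "convex {y. (\<sigma> *\<^sub>R n p) \<bullet> y \<le> (\<sigma> *\<^sub>R n p) \<bullet> f p}" by (rule convex_halfspace_le)
    qed (use \<sigma>(2)[OF that(1)] in auto)
    then show ?thesis using that(2) by blast
  qed
  have "interior K \<noteq> {}"
  proof
    assume "interior K = {}"
    then obtain a b where ab: "a \<noteq> 0" "K \<subseteq> {x. a \<bullet> x = b}"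
      using empty_interior_subset_hyperplane[of K] by (metis K_def convex_convex_hull)
    define u where "u = (1 / norm a) *\<^sub>R a"
    have "norm u = 1" using ab(1) by (simp add: u_def)
    then obtain p q where "p \<in> M" "q \<in> M" "f p \<bullet> u < f q \<bullet> u" by (rule not_planar)
    moreover have "f p \<bullet> u = b / norm a" if "p \<in> M" for p
    proof -
      have "a \<bullet> f p = b" using fK[OF that] ab(2) by blast
      then show ?thesis by (simp add: u_def inner_commute)
    qed
    ultimately show False by simp
  qed
  then have K: "convex_body K" using cptf by (simp add: convex_body_def K_def compact_convex_hull)
  have fr: "f ` M \<subseteq> frontier K"
  proof (rule image_subsetI)
    fix p assume p: "p \<in> M"
    have "\<sigma> *\<^sub>R n p \<noteq> 0" using norm_gauss[OF p] \<sigma>(1) by auto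
    then have "f p \<notin> interior K" using interior_halfspace_strict[OF _ support[OF p]] by blast
    then show "f p \<in> frontier K" using fK[OF p] closure_subset by (auto simp: frontier_def)
  qed
  \<comment> \<open>The double points of \<open>f\<close> form an open and closed set, so a single
    point outside gives injectivity.\<close>
  define D where "D = {p \<in> M. \<exists>p'\<in>M. p' \<noteq> p \<and> f p' = f p}"
  have opD: "openin (top_of_set M) D"
  proof (subst openin_subopen, intro ballI)
    fix p assume "p \<in> D"
    then obtain p' where p: "p \<in> M" "p' \<in> M" "p' \<noteq> p" "f p' = f p" by (auto simp: D_def)
    then obtain V1 V2 where V: "open V1" "open V2" "p \<in> V1" "p' \<in> V2" "V1 \<inter> V2 = {}"
      using hausdorff by metis
    have "openin (top_of_set M) (M \<inter> V2)" "p' \<in> M \<inter> V2" using V p by (auto simp: openin_open_Int)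
    then obtain W where W: "W \<subseteq> M \<inter> V2" "p' \<in> W" "openin (top_of_set (frontier K)) (f ` W)"
      using locally_open_in_frontier[OF K fr] by metis
    \<comment> \<open>Points near \<open>p\<close> with values in the open image of \<open>W\<close>
      have a partner in \<open>W\<close>, which differs from them since \<open>V1\<close> and
      \<open>V2\<close> are disjoint.\<close>
    define T where "T = (M \<inter> V1) \<inter> (M \<inter> f -` (f ` W))"
    have "openin (top_of_set M) (M \<inter> f -` (f ` W))"
      by (rule continuous_openin_preimage[OF continuous_on_f _ W(3)]) (use fr in auto)
    from openin_Int[OF openin_open_Int[OF V(1)] this] have "openin (top_of_set M) T" unfolding T_def .
    moreover have "p \<in> T" using p V(3) W(2) by (auto simp: T_def intro: rev_image_eqI)
    moreover have "T \<subseteq> D"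
    proof
      fix s assume "s \<in> T"
      then obtain s' where s: "s \<in> M" "s \<in> V1" "s' \<in> W" "f s = f s'" by (auto simp: T_def)
      then have "s' \<in> M" "s' \<noteq> s" using W(1) V(5) by auto
      then show "s \<in> D" using s by (auto simp: D_def)
    qed
    ultimately show "\<exists>T. openin (top_of_set M) T \<and> p \<in> T \<and> T \<subseteq> D" by blast
  qed
  \<comment> \<open>A second preimage cannot lie in \<open>W\<close>, where \<open>f\<close> is
    injective, nor outside \<open>W\<close> once the value avoids the compact image of
    \<open>M - W\<close>.\<close>
  have opD': "openin (top_of_set M) (M - D)"
  proof (subst openin_subopen, intro ballI)
    fix p assume p: "p \<in> M - D"
    then obtain W where W: "openin (top_of_set M) W" "p \<in> W" "inj_on f W"
      using locally_open_in_frontier[OF K fr, of M p] by auto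
    have "compact (M - W)"
      using closedin_compact[OF compact] W(1) by (metis closedin_diff closedin_topspace topspace_euclidean_subtopology)
    then have "closed (f ` (M - W))"
      by (intro compact_imp_closed compact_continuous_image continuous_on_subset[OF continuous_on_f]) auto
    then have "openin (top_of_set M) (M \<inter> f -` (- f ` (M - W)))"
      using continuous_openin_preimage_gen[OF continuous_on_f] by blast
    from openin_Int[OF W(1) this] have "openin (top_of_set M) (W \<inter> (M \<inter> f -` (- f ` (M - W))))" .
    moreover have "p \<in> W \<inter> (M \<inter> f -` (- f ` (M - W)))"
      using p W(2) by (auto simp: D_def)
    moreover have "W \<inter> (M \<inter> f -` (- f ` (M - W))) \<subseteq> M - D"
    proof
      fix s assume s: "s \<in> W \<inter> (M \<inter> f -` (- f ` (M - W)))"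
      have "s' = s" if "s' \<in> M" "f s' = f s" for s'
      proof (rule ccontr)
        assume ne: "s' \<noteq> s"
        then have "s' \<notin> W" using W(3) s that(2) by (auto dest: inj_onD)
        then have "f s \<in> f ` (M - W)" using that by (metis DiffI imageI)
        then show False using s by blast
      qed
      then show "s \<in> M - D" using s by (auto simp: D_def)
    qed
    ultimately show "\<exists>T. openin (top_of_set M) T \<and> p \<in> T \<and> T \<subseteq> M - D" by blast
  qed
  have "\<exists>a. a \<in> M - D"
  proof -
    obtain u where u: "norm u = 1" "\<And>p. p \<in> M \<Longrightarrow> n p = u \<or> n p = - u \<Longrightarrow> regular p"
      using regular_direction_exists[of "axis 1 1" 1] by (metis norm_axis_1 zero_less_one)
    obtain a where a: "a \<in> M" "\<And>q. q \<in> M \<Longrightarrow> f q \<bullet> u \<le> f a \<bullet> u" "n a = u \<or> n a = - u"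
      using obtain_max_point[OF u(1) _ compact nonempty] by auto
    have u': "norm (- u) = 1" using u(1) by simp
    obtain b where b: "b \<in> M" "\<And>q. q \<in> M \<Longrightarrow> f b \<bullet> u \<le> f q \<bullet> u" "n b = u \<or> n b = - u"
      using obtain_max_point[OF u' _ compact nonempty] by auto
    obtain p q where pq: "p \<in> M" "q \<in> M" "f p \<bullet> u < f q \<bullet> u" using not_planar[OF u(1)] .
    have ab: "f b \<bullet> u < f a \<bullet> u" using a(2)[OF pq(2)] b(2)[OF pq(1)] pq(3) by linarith
    \<comment> \<open>A partner of the highest point is again a highest point, and with the lowest
      point there would be three normals \<open>u\<close> or \<open>- u\<close>.\<close>
    have False if "a \<in> D"
    proof -
      obtain a' where a': "a' \<in> M" "a' \<noteq> a" "f a' = f a" using \<open>a \<in> D\<close> by (auto simp: D_def)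
      have na': "n a' = u \<or> n a' = - u"
        by (rule local_max_normal[OF _ a'(1) _ u(1)]) (use a' a in auto)
      have "a' \<noteq> b" "a \<noteq> b" using ab a'(3) by auto
      then show False
        using regular_three_normals[OF con sc u(1) a(1) a'(1) b(1) _ _ _ a(3) na' b(3) u(2) u(2)] a a' na' by simp
    qed
    then show ?thesis using a(1) by blast
  qed
  then have "D = {}"
    using con opD opD' unfolding connected_openin by (metis Diff_disjoint Un_Diff_cancel Un_upper2 empty_iff)
  then have inj: "inj_on f M" by (auto simp: D_def inj_on_def)
  have "openin (top_of_set (frontier K)) (f ` M)"
  proof (subst openin_subopen, intro ballI)
    fix y assume "y \<in> f ` M"
    then obtain p where p: "p \<in> M" "y = f p" by blast
    obtain W where W: "W \<subseteq> M" "p \<in> W" "openin (top_of_set (frontier K)) (f ` W)"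
      using locally_open_in_frontier[OF K fr _ p(1)] by (metis openin_subtopology_self)
    then show "\<exists>T. openin (top_of_set (frontier K)) T \<and> y \<in> T \<and> T \<subseteq> f ` M"
      using p(2) by (intro exI[of _ "f ` W"] conjI image_mono) auto
  qed
  moreover have "closedin (top_of_set (frontier K)) (f ` M)"
    using compact_imp_closed[OF cptf] fr by (simp add: closed_subset)
  ultimately have "f ` M = frontier K"
    using connected_frontier_convex_body[OF K] nonempty unfolding connected_clopen by (metis image_is_empty)
  then obtain g where "homeomorphism M (frontier K) f g"
    using homeomorphism_compact[OF compact continuous_on_f _ inj] by blast
  then show ?thesis using K unfolding convex_embedding_def by blast
qed

end

section \<open>From a convex embedding to simply connected shadows\<close>

context closed_surface
begin

text \<open>The functional \<open>a\<close> is maximal at \<open>p\<close>, hence parallel to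
  \<open>n p\<close>. The interior point \<open>c\<close> lies strictly below both planes, which
  settles the sign.\<close>

lemma supporting_normal:
  assumes K: "convex_body K" and fK: "f ` M \<subseteq> K" and p: "p \<in> M" and o: "c \<in> interior K"
    and a: "a \<noteq> 0" "\<And>y. y \<in> K \<Longrightarrow> a \<bullet> y \<le> a \<bullet> f p"
    and \<sigma>: "(\<sigma> *\<^sub>R n p) \<bullet> (f p - c) > 0" "\<bar>\<sigma>\<bar> = 1"
  shows "a = norm a *\<^sub>R (\<sigma> *\<^sub>R n p)"
proof -
  define u where "u = (1 / norm a) *\<^sub>R a"
  have u: "norm u = 1" "a = norm a *\<^sub>R u" using a(1) by (simp_all add: u_def)
  have "f q \<bullet> u \<le> f p \<bullet> u" if "q \<in> M" for q
  proof -
    have "f q \<in> K" using fK that by blast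
    then show ?thesis using a(2)[of "f q"] a(1) by (simp add: u_def inner_commute divide_right_mono)
  qed
  then have "n p = u \<or> n p = - u"
    by (intro local_max_normal[OF _ p _ u(1)]) auto
  moreover have "\<sigma> = 1 \<or> \<sigma> = -1" using \<sigma>(2) by linarith
  ultimately have "\<sigma> *\<^sub>R n p = u \<or> \<sigma> *\<^sub>R n p = - u" by auto
  moreover have "u \<bullet> (f p - c) > 0"
  proof -
    have "a \<bullet> (f p - c) > 0"
      using interior_halfspace_strict[OF a o] by (simp add: inner_diff_right)
    then show ?thesis using a(1) by (simp add: u_def)
  qed
  ultimately have "\<sigma> *\<^sub>R n p = u" using \<sigma>(1) by (metis inner_minus_left neg_0_less_iff_less less_asym)
  then show ?thesis using u(2) by simp
qed

text \<open>The core is \<open>lit\<close>: the outward normal makes an acute angle with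
  \<open>v\<close> exactly if the ray from \<open>f p\<close> along \<open>- v\<close> enters the
  interior. So \<open>f\<close> carries shadows to illuminated parts of the frontier.\<close>

lemma shadows_of_convex_embedding:
  assumes emb: "convex_embedding M f" and u: "norm u = 1"
  shows "simply_connected (shadow M n u)"
proof -
  obtain K g where K: "convex_body K" and hom: "homeomorphism M (frontier K) f g"
    using emb by (auto simp: convex_embedding_def)
  have fM: "f ` M = frontier K" and gM: "g ` frontier K = M" and contg: "continuous_on (frontier K) g"
    and gf: "\<And>p. p \<in> M \<Longrightarrow> g (f p) = p" and fg: "\<And>x. x \<in> frontier K \<Longrightarrow> f (g x) = x"
    using hom by (auto simp: homeomorphism_def)
  have K': "convex K" "closed K" using K by (auto simp: convex_body_def compact_imp_closed)
  have fK: "f ` M \<subseteq> K" using fM K'(2) by (simp add: frontier_subset_closed)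
  obtain c where c: "c \<in> interior K" using K by (auto simp: convex_body_def)
  have con: "connected M"
    using connected_continuous_image[OF contg connected_frontier_convex_body[OF K]] gM by simp
  \<comment> \<open>A supporting plane at \<open>f p\<close> has normal \<open>n p\<close> up to
    sign, and \<open>c\<close> is not on it. The sign of the product is then constant on the
    connected surface.\<close>
  have nz: "n p \<bullet> (f p - c) \<noteq> 0" if p: "p \<in> M" for p
  proof -
    have "f p \<in> frontier K" using fM p by blast
    then have "{f p} \<inter> interior K = {}" by (auto simp: frontier_def)
    then obtain a b where ab: "a \<noteq> 0" "b \<le> a \<bullet> f p" "\<And>y. y \<in> K \<Longrightarrow> a \<bullet> y \<le> b"
      using convex_body_separation[OF K, of "{f p}"] by (metis convex_singleton insert_not_empty singletonI)
    define v where "v = (1 / norm a) *\<^sub>R a"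
    have v: "norm v = 1" using ab(1) by (simp add: v_def)
    have "f q \<bullet> v \<le> f p \<bullet> v" if "q \<in> M" for q
    proof -
      have "a \<bullet> f q \<le> a \<bullet> f p" using ab(2) ab(3)[of "f q"] fK that by force
      then show ?thesis using ab(1) by (simp add: v_def inner_commute divide_right_mono)
    qed
    then have "n p = v \<or> n p = - v"
      by (intro local_max_normal[OF _ p _ v]) auto
    moreover have "a \<bullet> (f p - c) > 0"
      using interior_halfspace_strict[OF ab(1,3) c] ab(2) by (simp add: inner_diff_right)
    then have "v \<bullet> (f p - c) > 0" using ab(1) by (simp add: v_def)
    ultimately show ?thesis by auto
  qed
  obtain \<sigma> :: real where \<sigma>: "\<bar>\<sigma>\<bar> = 1" "\<And>p. p \<in> M \<Longrightarrow> (\<sigma> *\<^sub>R n p) \<bullet> (f p - c) > 0"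
  proof -
    have "continuous_on M (\<lambda>p. n p \<bullet> (f p - c))"
      by (intro continuous_intros continuous_on_f continuous_on_n)
    then have conn: "connected ((\<lambda>p. n p \<bullet> (f p - c)) ` M)" (is "connected ?I")
      using connected_continuous_image con by blast
    have "(\<forall>p\<in>M. n p \<bullet> (f p - c) > 0) \<or> (\<forall>p\<in>M. n p \<bullet> (f p - c) < 0)"
    proof (rule ccontr)
      assume "\<not> ?thesis"
      then obtain p q where "p \<in> M" "q \<in> M" "n p \<bullet> (f p - c) \<le> 0" "0 \<le> n q \<bullet> (f q - c)"
        by (meson not_less)
      then have "0 \<in> ?I" using connectedD_interval[OF conn, of "n p \<bullet> (f p - c)" "n q \<bullet> (f q - c)" 0] by blast
      then show False using nz by auto
    qed
    then show ?thesis using that[of 1] that[of "-1"] by auto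
  qed
  have lit: "(\<sigma> *\<^sub>R n p) \<bullet> v > 0 \<longleftrightarrow> (\<exists>t>0. f p - t *\<^sub>R v \<in> interior K)" if p: "p \<in> M" for p v
  proof
    assume pos: "(\<sigma> *\<^sub>R n p) \<bullet> v > 0"
    show "\<exists>t>0. f p - t *\<^sub>R v \<in> interior K"
    proof (rule ccontr)
      assume none: "\<not> ?thesis"
      \<comment> \<open>A ray missing the interior can be separated from \<open>K\<close>. For t
        tending to 0 the plane is seen to support \<open>K\<close> at \<open>f p\<close>, so its
        normal is the outward one; but the ray being beyond it forces a nonpositive product with
        \<open>v\<close>.\<close>
      define R where "R = (\<lambda>t. f p - t *\<^sub>R v) ` {0<..}"
      have "convex R"
      proof -
        have "R = (+) (f p) ` (\<lambda>t. t *\<^sub>R (- v)) ` {0<..}" by (simp add: R_def image_image)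
        moreover have "convex ((\<lambda>t. t *\<^sub>R (- v)) ` {0<..})"
          by (intro convex_linear_image convex_real_interval) (auto intro!: linearI simp: algebra_simps)
        ultimately show ?thesis by (simp add: convex_translation)
      qed
      moreover have "R \<noteq> {}" by (simp add: R_def)
      moreover have "R \<inter> interior K = {}" using none by (auto simp: R_def)
      ultimately obtain a b where ab: "a \<noteq> 0" "\<And>x. x \<in> R \<Longrightarrow> b \<le> a \<bullet> x" "\<And>y. y \<in> K \<Longrightarrow> a \<bullet> y \<le> b"
        using convex_body_separation[OF K] by metis
      have line: "b \<le> a \<bullet> f p - t * (a \<bullet> v)" if "t > 0" for t
        using ab(2)[of "f p - t *\<^sub>R v"] that by (auto simp: R_def inner_diff_right)
      have "b \<le> a \<bullet> f p"
      proof (rule ccontr)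
        assume "\<not> b \<le> a \<bullet> f p"
        \<comment> \<open>So small that moving by \<open>t\<close> along the ray covers at most half
          of the assumed gap.\<close>
        define t where "t = (b - a \<bullet> f p) / (2 * (\<bar>a \<bullet> v\<bar> + 1))"
        have t: "t > 0" using \<open>\<not> b \<le> a \<bullet> f p\<close> by (simp add: t_def)
        have "b - a \<bullet> f p \<le> - (t * (a \<bullet> v))" using line[OF t] by (simp add: algebra_simps)
        also have "\<dots> \<le> t * (\<bar>a \<bullet> v\<bar> + 1)"
          using t mult_left_mono[of "- (a \<bullet> v)" "\<bar>a \<bullet> v\<bar> + 1" t] by simp
        also have "\<dots> = (b - a \<bullet> f p) / 2" by (simp add: t_def field_simps)
        finally show False using \<open>\<not> b \<le> a \<bullet> f p\<close> by simp
      qed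
      then have supp: "a \<bullet> y \<le> a \<bullet> f p" if "y \<in> K" for y using ab(3)[OF that] by linarith
      have an: "a = norm a *\<^sub>R (\<sigma> *\<^sub>R n p)"
        by (rule supporting_normal[OF K fK p c ab(1) supp \<sigma>(2)[OF p] \<sigma>(1)])
      have "b \<le> a \<bullet> f p - 1 * (a \<bullet> v)" by (rule line) simp
      moreover have "a \<bullet> f p \<le> b" using ab(3) fK p by blast
      ultimately have "a \<bullet> v \<le> 0" by simp
      moreover have "a \<bullet> v = norm a * ((\<sigma> *\<^sub>R n p) \<bullet> v)" by (subst an) simp
      moreover have "norm a * ((\<sigma> *\<^sub>R n p) \<bullet> v) > 0" by (rule mult_pos_pos) (use pos ab(1) in simp_all)
      ultimately show False by linarith
    qed
  next
    assume "\<exists>t>0. f p - t *\<^sub>R v \<in> interior K"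
    then obtain t where t: "t > 0" "f p - t *\<^sub>R v \<in> interior K" by blast
    have "f p \<in> frontier K" using fM p by blast
    then have "{f p} \<inter> interior K = {}" by (auto simp: frontier_def)
    then obtain a b where ab: "a \<noteq> 0" "b \<le> a \<bullet> f p" "\<And>y. y \<in> K \<Longrightarrow> a \<bullet> y \<le> b"
      using convex_body_separation[OF K, of "{f p}"] by (metis convex_singleton insert_not_empty singletonI)
    have supp: "a \<bullet> y \<le> a \<bullet> f p" if "y \<in> K" for y using ab(2) ab(3)[OF that] by linarith
    have an: "a = norm a *\<^sub>R (\<sigma> *\<^sub>R n p)"
      by (rule supporting_normal[OF K fK p c ab(1) supp \<sigma>(2)[OF p] \<sigma>(1)])
    have "a \<bullet> (f p - t *\<^sub>R v) < a \<bullet> f p" by (rule interior_halfspace_strict[OF ab(1) supp t(2)])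
    then have "a \<bullet> v > 0" using t(1) by (simp add: inner_diff_right zero_less_mult_iff)
    moreover have "a \<bullet> v = norm a * ((\<sigma> *\<^sub>R n p) \<bullet> v)" by (subst an) simp
    ultimately show "(\<sigma> *\<^sub>R n p) \<bullet> v > 0" using ab(1) by (simp add: zero_less_mult_iff)
  qed
  define X where "X = {x \<in> frontier K. \<exists>t>0. x - t *\<^sub>R (\<sigma> *\<^sub>R u) \<in> interior K}"
  have "\<sigma> *\<^sub>R u \<noteq> 0" using u \<sigma>(1) by auto
  then have scX: "simply_connected X" unfolding X_def by (rule illuminated_frontier_simply_connected[OF K])
  \<comment> \<open>Light comes from direction \<open>\<sigma> *\<^sub>R u\<close>, so that the two
    signs cancel and the shadow of \<open>n\<close> itself appears even when \<open>n\<close> points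
    inward.\<close>
  have "\<sigma> * \<sigma> = 1" using \<sigma>(1) by (metis abs_mult_self_eq mult_1)
  then have mem: "p \<in> shadow M n u \<longleftrightarrow> p \<in> M \<and> f p \<in> X" for p
    using lit[of p "\<sigma> *\<^sub>R u"] fM by (auto simp: shadow_def X_def mult.assoc[symmetric])
  have XS: "X \<subseteq> frontier K" by (auto simp: X_def)
  have gX: "g ` X = shadow M n u"
  proof
    show "g ` X \<subseteq> shadow M n u"
    proof (rule image_subsetI)
      fix x assume "x \<in> X"
      then show "g x \<in> shadow M n u" using XS fg gM by (auto simp: mem)
    qed
    show "shadow M n u \<subseteq> g ` X"
    proof
      fix p assume "p \<in> shadow M n u"
      then show "p \<in> g ` X" using mem gf by (metis imageI)
    qed
  qed
  show ?thesis
  proof (rule simply_connected_retraction_gen[OF scX _ gX])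
    show "continuous_on X g" using continuous_on_subset[OF contg XS] .
    show "continuous_on (shadow M n u) f"
      by (rule continuous_on_subset[OF continuous_on_f]) (auto simp: shadow_def)
  qed (use mem gf in auto)
qed

end

theorem theorem1p1:
  fixes M :: "'a::{t2_space,second_countable_topology} set"
    and A :: "('a, 2) chart set"
    and f n :: "'a \<Rightarrow> real ^ 3"
  assumes "smooth_atlas M A" and "oriented_atlas A"
    and "compact M" and "M \<noteq> {}"
    and "smooth_immersion A f"
    and "gauss_map M A f n"
  shows "convex_embedding M f \<longleftrightarrow> (\<forall>u \<in> sphere 0 1. simply_connected (shadow M n u))"
proof -
  interpret closed_surface M A f n by unfold_locales fact+
  show ?thesis
    using shadows_of_convex_embedding convex_embedding_of_shadows by auto
qed

end
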